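(* Let $\mathcal{D}$ be a $2$-category with finite products admitting EM (Eilenberg-Moore) objects. Then the $2$-category $\mathbf{Mon}_{op}(\mathcal{D})$ of monoidal objects in $\mathcal{D}$, oplax monoidal morphisms and their transformations admits EM objects, and they are standard with respect to $\mathcal{D}$ (i.e. with respect to the forgetful $2$-functor $\mathbf{Mon}_{op}(\mathcal{D})\to\mathcal{D}$).
   Context: Whiskering notation: for $1$-cells $F,G$ and a $2$-cell $\sigma$, $F(\sigma)$ is $\sigma$ post-whiskered by $F$ and $\sigma_G$ is $\sigma$ pre-whiskered by $G$; $\circ$ also denotes vertical composition of $2$-cells. A $2$-category with finite products is one with finite products of $0$-cells. Monads. A monad in a $2$-category $\mathcal{E}$ is $(\mathcal{C},\mathcal{S},\eta,\mu)$ with $\mathcal{S}:\mathcal{C}\to\mathcal{C}$ a $1$-cell and $2$-cells $\eta:1_{\mathcal{C}}\to\mathcal{S}$, $\mu:\mathcal{S}^2\to\mathcal{S}$ with $\mu\circ\eta_{\mathcal{S}}=1_{\mathcal{S}}=\mu\circ\mathcal{S}(\eta)$, $\mu\circ\mu_{\mathcal{S}}=\mu\circ\mathcal{S}(\mu)$. A lax morphism of monads $(\mathcal{C},\mathcal{S},\eta,\mu)\to(\mathcal{C}',\mathcal{S}',\eta',\mu')$ is $(F,\tau)$ with a $1$-cell $F:\mathcal{C}\to\mathcal{C}'$ and a $2$-cell $\tau:\mathcal{S}'F\to F\mathcal{S}$ such that $\tau\circ\eta'_F=F(\eta)$ and $\tau\circ\mu'_F=F(\mu)\circ\tau_{\mathcal{S}}\circ\mathcal{S}'(\tau)$;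 composition is $(F',\tau')\circ(F,\tau)=(F'F,F'(\tau)\circ\tau'_F)$. A transformation $(F,\tau)\to(F',\tau')$ is a $2$-cell $\sigma:F\to F'$ with $\tau'\circ\mathcal{S}'(\sigma)=\sigma_{\mathcal{S}}\circ\tau$. These form the $2$-category $\mathbf{Mnd}(\mathcal{E})$; a $2$-functor $G$ induces $\mathbf{Mnd}(G)$ in the obvious way. The $2$-functor $\iota_{\mathcal{E}}:\mathcal{E}\to\mathbf{Mnd}(\mathcal{E})$ sends $\mathcal{C}$ to the identity monad on $\mathcal{C}$. EM objects. $\mathcal{E}$ admits EM objects if $\iota_{\mathcal{E}}$ has a right $2$-adjoint $EM_{\mathcal{E}}:\mathbf{Mnd}(\mathcal{E})\to\mathcal{E}$. For a $2$-functor $G:\mathcal{D}'\to\mathcal{E}$ between $2$-categories admitting EM objects, $\mathcal{D}'$ has standard EM objects with respect to $G$ (or with respect to $\mathcal{E}$, if $G$ is understood) if the canonical $2$-natural transformation $G\circ EM_{\mathcal{D}'}\to EM_{\mathcal{E}}\circ\mathbf{Mnd}(G)$ (the mate of $\mathbf{Mnd}(G)\circ\iota_{\mathcal{D}'}=\iota_{\mathcal{E}}\circ G$) is an isomorphism. Monoidal objects. Let $\mathcal{D}$ have finite products. A monoidal object in $\mathcal{D}$ is a $0$-cell $\mathcal{C}$ with $1$-cells $\otimes:\mathcal{C}\times\mathcal{C}\to\mathcal{C}$, $I:1\to\mathcal{C}$ and invertible $2$-cells $\alpha:\otimes\circ(1\times\otimes)\Rightarrow\otimes\circ(\otimes\times1)$,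 $\lambda:\otimes\circ\langle I,1_{\mathcal{C}}\rangle\Rightarrow1_{\mathcal{C}}$, $\varrho:\otimes\circ\langle1_{\mathcal{C}},I\rangle\Rightarrow1_{\mathcal{C}}$ (inside pairings $I$ means $\mathcal{C}\to1\to\mathcal{C}$) satisfying the pentagon $\otimes\langle\alpha,1\rangle\circ\alpha_{1\times\otimes\times1}\circ\otimes\langle1,\alpha\rangle=\alpha_{\otimes\times1\times1}\circ\alpha_{1\times1\times\otimes}$ and the triangle $\otimes\langle\varrho_{\pi_1},1_{\pi_2}\rangle\circ\alpha_{\langle\pi_1,I,\pi_2\rangle}=\otimes\langle1_{\pi_1},\lambda_{\pi_2}\rangle$. An oplax monoidal morphism $(F,\varphi,\bar\varphi)$ from $(\mathcal{C},\otimes,I,\alpha,\lambda,\varrho)$ to $(\mathcal{C}',\otimes',I',\alpha',\lambda',\varrho')$ consists of $F:\mathcal{C}\to\mathcal{C}'$, $\bar\varphi:F\circ I\Rightarrow I'$, $\varphi:F\circ\otimes\Rightarrow\otimes'\circ(F\times F)$ with $\alpha'_{F\times F\times F}\circ\otimes'(1,\varphi)\circ\varphi_{1\times\otimes}=\otimes'(\varphi,1)\circ\varphi_{\otimes\times1}\circ F(\alpha)$, $\varrho'_F\circ\otimes'(1,\bar\varphi)\circ\varphi_{\langle1,I\rangle}=F(\varrho)$, $\lambda'_F\circ\otimes'(\bar\varphi,1)\circ\varphi_{\langle I,1\rangle}=F(\lambda)$. A transformation $(F,\varphi,\bar\varphi)\Rightarrow(F',\varphi',\bar\varphi')$ is a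 $2$-cell $\sigma:F\to F'$ with $\varphi'\circ\sigma_\otimes=\otimes'(\sigma,\sigma)\circ\varphi$ and $\bar\varphi'\circ\sigma_I=\bar\varphi$. $\mathbf{Mon}_{op}(\mathcal{D})$ is the $2$-category of these; the forgetful $2$-functor $\mathbf{Mon}_{op}(\mathcal{D})\to\mathcal{D}$ forgets the monoidal structure. *)

theory Defs
  imports Main
begin

section \<open>Strict 2-categories\<close>

text \<open>
  A strict 2-category is given by carrier sets of cells of each dimension inside arbitrary types.
  The operations are total functions, constrained only on the carriers.
  \<open>g \<cdot> f\<close> is composition of 1-cells (\<open>g\<close> after \<open>f\<close>), \<open>\<tau> \<bullet> \<sigma>\<close> is vertical and
  \<open>\<tau> \<star> \<sigma>\<close> horizontal composition of 2-cells.
\<close>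

record ('o, 'f, 'c) twocat =
  Obj :: "'o set"
  Cell1 :: "'f set"
  Cell2 :: "'c set"
  dom1 :: "'f \<Rightarrow> 'o"
  cod1 :: "'f \<Rightarrow> 'o"
  dom2 :: "'c \<Rightarrow> 'f"
  cod2 :: "'c \<Rightarrow> 'f"
  id1 :: "'o \<Rightarrow> 'f"
  id2 :: "'f \<Rightarrow> 'c"
  comp1 :: "'f \<Rightarrow> 'f \<Rightarrow> 'f"  (infixr \<open>\<cdot>\<index>\<close> 75)
  vcomp :: "'c \<Rightarrow> 'c \<Rightarrow> 'c"  (infixr \<open>\<bullet>\<index>\<close> 65)
  hcomp :: "'c \<Rightarrow> 'c \<Rightarrow> 'c"  (infixr \<open>\<star>\<index>\<close> 70)

definition hom1 :: "('o, 'f, 'c) twocat \<Rightarrow> 'o \<Rightarrow> 'o \<Rightarrow> 'f set" where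
  "hom1 C A B = {f \<in> Cell1 C. dom1 C f = A \<and> cod1 C f = B}"

definition hom2 :: "('o, 'f, 'c) twocat \<Rightarrow> 'f \<Rightarrow> 'f \<Rightarrow> 'c set" where
  "hom2 C f g = {\<sigma> \<in> Cell2 C. dom2 C \<sigma> = f \<and> cod2 C \<sigma> = g}"

locale two_category =
  fixes C :: "('o, 'f, 'c) twocat" (structure)
  assumes dom1_Obj: "f \<in> Cell1 C \<Longrightarrow> dom1 C f \<in> Obj C"
    and cod1_Obj: "f \<in> Cell1 C \<Longrightarrow> cod1 C f \<in> Obj C"
    and id1_hom: "A \<in> Obj C \<Longrightarrow> id1 C A \<in> hom1 C A A"
    and comp1_hom: "\<lbrakk>f \<in> hom1 C X Y; g \<in> hom1 C Y Z\<rbrakk> \<Longrightarrow> g \<cdot> f \<in> hom1 C X Z"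
    and comp1_id_left: "f \<in> hom1 C X Y \<Longrightarrow> id1 C Y \<cdot> f = f"
    and comp1_id_right: "f \<in> hom1 C X Y \<Longrightarrow> f \<cdot> id1 C X = f"
    and comp1_assoc: "\<lbrakk>f \<in> hom1 C W X; g \<in> hom1 C X Y; h \<in> hom1 C Y Z\<rbrakk>
      \<Longrightarrow> (h \<cdot> g) \<cdot> f = h \<cdot> (g \<cdot> f)"
    and dom2_Cell1: "\<sigma> \<in> Cell2 C \<Longrightarrow> dom2 C \<sigma> \<in> Cell1 C"
    and cod2_Cell1: "\<sigma> \<in> Cell2 C \<Longrightarrow> cod2 C \<sigma> \<in> Cell1 C"
    and dom1_globular: "\<sigma> \<in> Cell2 C \<Longrightarrow> dom1 C (dom2 C \<sigma>) = dom1 C (cod2 C \<sigma>)"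
    and cod1_globular: "\<sigma> \<in> Cell2 C \<Longrightarrow> cod1 C (dom2 C \<sigma>) = cod1 C (cod2 C \<sigma>)"
    and id2_hom: "f \<in> Cell1 C \<Longrightarrow> id2 C f \<in> hom2 C f f"
    and vcomp_hom: "\<lbrakk>\<sigma> \<in> hom2 C f g; \<tau> \<in> hom2 C g h\<rbrakk> \<Longrightarrow> \<tau> \<bullet> \<sigma> \<in> hom2 C f h"
    and vcomp_id_left: "\<sigma> \<in> hom2 C f g \<Longrightarrow> id2 C g \<bullet> \<sigma> = \<sigma>"
    and vcomp_id_right: "\<sigma> \<in> hom2 C f g \<Longrightarrow> \<sigma> \<bullet> id2 C f = \<sigma>"
    and vcomp_assoc: "\<lbrakk>\<rho> \<in> hom2 C f g; \<sigma> \<in> hom2 C g h; \<tau> \<in> hom2 C h k\<rbrakk>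
      \<Longrightarrow> (\<tau> \<bullet> \<sigma>) \<bullet> \<rho> = \<tau> \<bullet> (\<sigma> \<bullet> \<rho>)"
    and hcomp_hom: "\<lbrakk>f \<in> hom1 C X Y; g \<in> hom1 C Y Z; \<sigma> \<in> hom2 C f f'; \<tau> \<in> hom2 C g g'\<rbrakk>
      \<Longrightarrow> \<tau> \<star> \<sigma> \<in> hom2 C (g \<cdot> f) (g' \<cdot> f')"
    and hcomp_id_left: "\<lbrakk>f \<in> hom1 C X Y; \<sigma> \<in> hom2 C f f'\<rbrakk> \<Longrightarrow> id2 C (id1 C Y) \<star> \<sigma> = \<sigma>"
    and hcomp_id_right: "\<lbrakk>f \<in> hom1 C X Y; \<sigma> \<in> hom2 C f f'\<rbrakk> \<Longrightarrow> \<sigma> \<star> id2 C (id1 C X) = \<sigma>"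
    and hcomp_assoc: "\<lbrakk>f \<in> hom1 C W X; g \<in> hom1 C X Y; h \<in> hom1 C Y Z;
        \<rho> \<in> hom2 C f f'; \<sigma> \<in> hom2 C g g'; \<tau> \<in> hom2 C h h'\<rbrakk>
      \<Longrightarrow> (\<tau> \<star> \<sigma>) \<star> \<rho> = \<tau> \<star> (\<sigma> \<star> \<rho>)"
    and hcomp_id2: "\<lbrakk>f \<in> hom1 C X Y; g \<in> hom1 C Y Z\<rbrakk> \<Longrightarrow> id2 C g \<star> id2 C f = id2 C (g \<cdot> f)"
    and interchange: "\<lbrakk>f \<in> hom1 C X Y; g \<in> hom1 C Y Z;
        \<sigma> \<in> hom2 C f f'; \<sigma>' \<in> hom2 C f' f''; \<tau> \<in> hom2 C g g'; \<tau>' \<in> hom2 C g' g''\<rbrakk>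
      \<Longrightarrow> (\<tau>' \<bullet> \<tau>) \<star> (\<sigma>' \<bullet> \<sigma>) = (\<tau>' \<star> \<sigma>') \<bullet> (\<tau> \<star> \<sigma>)"

text \<open>Whiskering: \<open>F \<rhd> \<sigma>\<close> is \<open>F(\<sigma>)\<close> and \<open>\<sigma> \<lhd> G\<close> is \<open>\<sigma>\<^sub>G\<close>.\<close>

definition post_whisker :: "('o, 'f, 'c) twocat \<Rightarrow> 'f \<Rightarrow> 'c \<Rightarrow> 'c"  (infixr \<open>\<rhd>\<index>\<close> 72) where
  "F \<rhd>\<^bsub>C\<^esub> \<sigma> = id2 C F \<star>\<^bsub>C\<^esub> \<sigma>"

definition pre_whisker :: "('o, 'f, 'c) twocat \<Rightarrow> 'c \<Rightarrow> 'f \<Rightarrow> 'c"  (infixl \<open>\<lhd>\<index>\<close> 73) where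
  "\<sigma> \<lhd>\<^bsub>C\<^esub> G = \<sigma> \<star>\<^bsub>C\<^esub> id2 C G"

definition invertible2 :: "('o, 'f, 'c) twocat \<Rightarrow> 'c \<Rightarrow> bool" where
  "invertible2 C \<sigma> \<longleftrightarrow> \<sigma> \<in> Cell2 C \<and> (\<exists>\<tau> \<in> hom2 C (cod2 C \<sigma>) (dom2 C \<sigma>).
     \<tau> \<bullet>\<^bsub>C\<^esub> \<sigma> = id2 C (dom2 C \<sigma>) \<and> \<sigma> \<bullet>\<^bsub>C\<^esub> \<tau> = id2 C (cod2 C \<sigma>))"

section \<open>2-functors, 2-natural transformations, 2-adjunctions\<close>

datatype ('o, 'f, 'c, 'p, 'g, 'd) twofun =
  TwoFun (on0: "'o \<Rightarrow> 'p") (on1: "'f \<Rightarrow> 'g") (on2: "'c \<Rightarrow> 'd")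

definition twofun_id :: "('o, 'f, 'c, 'o, 'f, 'c) twofun" where
  "twofun_id = TwoFun id id id"

definition twofun_comp ::
  "('p, 'g, 'd, 'q, 'h, 'e) twofun \<Rightarrow> ('o, 'f, 'c, 'p, 'g, 'd) twofun
    \<Rightarrow> ('o, 'f, 'c, 'q, 'h, 'e) twofun" where
  "twofun_comp G F = TwoFun (on0 G \<circ> on0 F) (on1 G \<circ> on1 F) (on2 G \<circ> on2 F)"

locale two_functor = source: two_category C + target: two_category D
  for C :: "('o, 'f, 'c) twocat" and D :: "('p, 'g, 'd) twocat" +
  fixes F :: "('o, 'f, 'c, 'p, 'g, 'd) twofun"
  assumes on0_Obj: "A \<in> Obj C \<Longrightarrow> on0 F A \<in> Obj D"
    and on1_hom: "f \<in> hom1 C A B \<Longrightarrow> on1 F f \<in> hom1 D (on0 F A) (on0 F B)"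
    and on2_hom: "\<sigma> \<in> hom2 C f g \<Longrightarrow> on2 F \<sigma> \<in> hom2 D (on1 F f) (on1 F g)"
    and on1_id: "A \<in> Obj C \<Longrightarrow> on1 F (id1 C A) = id1 D (on0 F A)"
    and on1_comp: "\<lbrakk>f \<in> hom1 C X Y; g \<in> hom1 C Y Z\<rbrakk>
      \<Longrightarrow> on1 F (g \<cdot>\<^bsub>C\<^esub> f) = on1 F g \<cdot>\<^bsub>D\<^esub> on1 F f"
    and on2_id: "f \<in> Cell1 C \<Longrightarrow> on2 F (id2 C f) = id2 D (on1 F f)"
    and on2_vcomp: "\<lbrakk>\<sigma> \<in> hom2 C f g; \<tau> \<in> hom2 C g h\<rbrakk>
      \<Longrightarrow> on2 F (\<tau> \<bullet>\<^bsub>C\<^esub> \<sigma>) = on2 F \<tau> \<bullet>\<^bsub>D\<^esub> on2 F \<sigma>"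
    and on2_hcomp: "\<lbrakk>f \<in> hom1 C X Y; g \<in> hom1 C Y Z; \<sigma> \<in> hom2 C f f'; \<tau> \<in> hom2 C g g'\<rbrakk>
      \<Longrightarrow> on2 F (\<tau> \<star>\<^bsub>C\<^esub> \<sigma>) = on2 F \<tau> \<star>\<^bsub>D\<^esub> on2 F \<sigma>"

locale two_natural = F: two_functor C D F + G: two_functor C D G
  for C :: "('o, 'f, 'c) twocat" and D :: "('p, 'g, 'd) twocat"
    and F G :: "('o, 'f, 'c, 'p, 'g, 'd) twofun" +
  fixes \<theta> :: "'o \<Rightarrow> 'g"
  assumes component_hom: "A \<in> Obj C \<Longrightarrow> \<theta> A \<in> hom1 D (on0 F A) (on0 G A)"
    and natural1: "f \<in> hom1 C A B \<Longrightarrow> \<theta> B \<cdot>\<^bsub>D\<^esub> on1 F f = on1 G f \<cdot>\<^bsub>D\<^esub> \<theta> A"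
    and natural2: "\<lbrakk>f \<in> hom1 C A B; \<sigma> \<in> hom2 C f g\<rbrakk>
      \<Longrightarrow> \<theta> B \<rhd>\<^bsub>D\<^esub> on2 F \<sigma> = on2 G \<sigma> \<lhd>\<^bsub>D\<^esub> \<theta> A"

definition two_natural_iso ::
  "('o, 'f, 'c) twocat \<Rightarrow> ('p, 'g, 'd) twocat \<Rightarrow> ('o, 'f, 'c, 'p, 'g, 'd) twofun
    \<Rightarrow> ('o, 'f, 'c, 'p, 'g, 'd) twofun \<Rightarrow> ('o \<Rightarrow> 'g) \<Rightarrow> bool" where
  "two_natural_iso C D F G \<theta> \<longleftrightarrow> two_natural C D F G \<theta> \<and>
     (\<exists>\<psi>. two_natural C D G F \<psi> \<and>
       (\<forall>A \<in> Obj C. \<psi> A \<cdot>\<^bsub>D\<^esub> \<theta> A = id1 D (on0 F A) \<and> \<theta> A \<cdot>\<^bsub>D\<^esub> \<psi> A = id1 D (on0 G A)))"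

text \<open>\<open>L : C \<rightarrow> D\<close> is left 2-adjoint to \<open>R : D \<rightarrow> C\<close> with unit \<open>u\<close> and counit \<open>e\<close>.\<close>

locale two_adjunction = L: two_functor C D L + R: two_functor D C R +
    unit: two_natural C C twofun_id "twofun_comp R L" u +
    counit: two_natural D D "twofun_comp L R" twofun_id e
  for C :: "('o, 'f, 'c) twocat" and D :: "('p, 'g, 'd) twocat"
    and L :: "('o, 'f, 'c, 'p, 'g, 'd) twofun" and R :: "('p, 'g, 'd, 'o, 'f, 'c) twofun"
    and u :: "'o \<Rightarrow> 'f" and e :: "'p \<Rightarrow> 'g" +
  assumes triangle_L: "A \<in> Obj C \<Longrightarrow> e (on0 L A) \<cdot>\<^bsub>D\<^esub> on1 L (u A) = id1 D (on0 L A)"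
    and triangle_R: "B \<in> Obj D \<Longrightarrow> on1 R (e B) \<cdot>\<^bsub>C\<^esub> u (on0 R B) = id1 C (on0 R B)"

section \<open>The 2-category of monads\<close>

datatype ('o, 'f, 'c) monad =
  Monad (mnd_ob: 'o) (mnd_end: 'f) (mnd_unit: 'c) (mnd_mult: 'c)

datatype ('o, 'f, 'c) monad_mor =
  MonadMor (mm_dom: "('o, 'f, 'c) monad") (mm_cod: "('o, 'f, 'c) monad") (mm_cell: 'f) (mm_tau: 'c)

text \<open>A 2-cell \<open>\<sigma>\<close> of an underlying 2-category together with its source and target structured
  1-cells; used for the 2-cells of both \<open>Mnd\<close> and \<open>Mon_op\<close>.\<close>

datatype ('g, 'c) trans = Trans (tr_dom: 'g) (tr_cod: 'g) (tr_cell: 'c)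

context
  fixes E :: "('o, 'f, 'c) twocat" (structure)
begin

definition is_monad :: "('o, 'f, 'c) monad \<Rightarrow> bool" where
  "is_monad M \<longleftrightarrow> (case M of Monad A S \<eta> \<mu> \<Rightarrow>
     A \<in> Obj E \<and> S \<in> hom1 E A A \<and>
     \<eta> \<in> hom2 E (id1 E A) S \<and> \<mu> \<in> hom2 E (S \<cdot> S) S \<and>
     \<mu> \<bullet> (\<eta> \<lhd> S) = id2 E S \<and>
     \<mu> \<bullet> (S \<rhd> \<eta>) = id2 E S \<and>
     \<mu> \<bullet> (\<mu> \<lhd> S) = \<mu> \<bullet> (S \<rhd> \<mu>))"

definition is_monad_mor :: "('o, 'f, 'c) monad_mor \<Rightarrow> bool" where
  "is_monad_mor m \<longleftrightarrow> (case m of MonadMor (Monad A S \<eta> \<mu>) (Monad A' S' \<eta>' \<mu>') F \<tau> \<Rightarrow>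
     is_monad (Monad A S \<eta> \<mu>) \<and> is_monad (Monad A' S' \<eta>' \<mu>') \<and>
     F \<in> hom1 E A A' \<and> \<tau> \<in> hom2 E (S' \<cdot> F) (F \<cdot> S) \<and>
     \<tau> \<bullet> (\<eta>' \<lhd> F) = F \<rhd> \<eta> \<and>
     \<tau> \<bullet> (\<mu>' \<lhd> F) = (F \<rhd> \<mu>) \<bullet> (\<tau> \<lhd> S) \<bullet> (S' \<rhd> \<tau>))"

definition is_monad_trans :: "(('o, 'f, 'c) monad_mor, 'c) trans \<Rightarrow> bool" where
  "is_monad_trans t \<longleftrightarrow> (case t of Trans (MonadMor M N F \<tau>) (MonadMor M' N' F' \<tau>') \<sigma> \<Rightarrow>
     is_monad_mor (MonadMor M N F \<tau>) \<and> is_monad_mor (MonadMor M' N' F' \<tau>') \<and>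
     M' = M \<and> N' = N \<and> \<sigma> \<in> hom2 E F F' \<and>
     \<tau>' \<bullet> (mnd_end N \<rhd> \<sigma>) = (\<sigma> \<lhd> mnd_end M) \<bullet> \<tau>)"

definition monad_mor_comp ::
  "('o, 'f, 'c) monad_mor \<Rightarrow> ('o, 'f, 'c) monad_mor \<Rightarrow> ('o, 'f, 'c) monad_mor" where
  "monad_mor_comp n m = MonadMor (mm_dom m) (mm_cod n) (mm_cell n \<cdot> mm_cell m)
     ((mm_cell n \<rhd> mm_tau m) \<bullet> (mm_tau n \<lhd> mm_cell m))"

definition Mnd ::
  "(('o, 'f, 'c) monad, ('o, 'f, 'c) monad_mor, (('o, 'f, 'c) monad_mor, 'c) trans) twocat" where
  "Mnd = \<lparr>
     Obj = {M. is_monad M},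
     Cell1 = {m. is_monad_mor m},
     Cell2 = {t. is_monad_trans t},
     dom1 = mm_dom, cod1 = mm_cod, dom2 = tr_dom, cod2 = tr_cod,
     id1 = (\<lambda>M. MonadMor M M (id1 E (mnd_ob M)) (id2 E (mnd_end M))),
     id2 = (\<lambda>m. Trans m m (id2 E (mm_cell m))),
     comp1 = monad_mor_comp,
     vcomp = (\<lambda>t s. Trans (tr_dom s) (tr_cod t) (tr_cell t \<bullet> tr_cell s)),
     hcomp = (\<lambda>t s. Trans (monad_mor_comp (tr_dom t) (tr_dom s))
                           (monad_mor_comp (tr_cod t) (tr_cod s)) (tr_cell t \<star> tr_cell s))\<rparr>"

definition identity_monad :: "'o \<Rightarrow> ('o, 'f, 'c) monad" where
  "identity_monad A = Monad A (id1 E A) (id2 E (id1 E A)) (id2 E (id1 E A))"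

definition identity_monad_mor :: "'f \<Rightarrow> ('o, 'f, 'c) monad_mor" where
  "identity_monad_mor F =
     MonadMor (identity_monad (dom1 E F)) (identity_monad (cod1 E F)) F (id2 E F)"

definition iota ::
  "('o, 'f, 'c, ('o, 'f, 'c) monad, ('o, 'f, 'c) monad_mor,
    (('o, 'f, 'c) monad_mor, 'c) trans) twofun" where
  "iota = TwoFun identity_monad identity_monad_mor
     (\<lambda>\<sigma>. Trans (identity_monad_mor (dom2 E \<sigma>)) (identity_monad_mor (cod2 E \<sigma>)) \<sigma>)"

end

definition Mnd_map0 :: "('o, 'f, 'c, 'p, 'g, 'd) twofun \<Rightarrow> ('o, 'f, 'c) monad \<Rightarrow> ('p, 'g, 'd) monad" where
  "Mnd_map0 G M = Monad (on0 G (mnd_ob M)) (on1 G (mnd_end M)) (on2 G (mnd_unit M)) (on2 G (mnd_mult M))"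

definition Mnd_map1 ::
  "('o, 'f, 'c, 'p, 'g, 'd) twofun \<Rightarrow> ('o, 'f, 'c) monad_mor \<Rightarrow> ('p, 'g, 'd) monad_mor" where
  "Mnd_map1 G m = MonadMor (Mnd_map0 G (mm_dom m)) (Mnd_map0 G (mm_cod m))
     (on1 G (mm_cell m)) (on2 G (mm_tau m))"

definition Mnd_map ::
  "('o, 'f, 'c, 'p, 'g, 'd) twofun \<Rightarrow>
   (('o, 'f, 'c) monad, ('o, 'f, 'c) monad_mor, (('o, 'f, 'c) monad_mor, 'c) trans,
    ('p, 'g, 'd) monad, ('p, 'g, 'd) monad_mor, (('p, 'g, 'd) monad_mor, 'd) trans) twofun" where
  "Mnd_map G = TwoFun (Mnd_map0 G) (Mnd_map1 G)
     (\<lambda>t. Trans (Mnd_map1 G (tr_dom t)) (Mnd_map1 G (tr_cod t)) (on2 G (tr_cell t)))"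

section \<open>Eilenberg-Moore objects\<close>

definition admits_EM :: "('o, 'f, 'c) twocat \<Rightarrow> bool" where
  "admits_EM E \<longleftrightarrow> (\<exists>EM u e. two_adjunction E (Mnd E) (iota E) EM u e)"

text \<open>
  The mate of \<open>Mnd(G) \<circ> \<iota>\<^sub>D = \<iota>\<^sub>E \<circ> G\<close>, i.e. the composite
  \<open>G EM\<^sub>D \<rightarrow> EM\<^sub>E \<iota>\<^sub>E G EM\<^sub>D = EM\<^sub>E Mnd(G) \<iota>\<^sub>D EM\<^sub>D \<rightarrow> EM\<^sub>E Mnd(G)\<close>
  of the unit \<open>u\<close> of \<open>\<iota>\<^sub>E \<stileturn> EM\<^sub>E\<close> and the counit \<open>e\<close> of \<open>\<iota>\<^sub>D \<stileturn> EM\<^sub>D\<close>.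
\<close>

definition EM_mate ::
  "('p, 'g, 'd) twocat \<Rightarrow> ('o, 'f, 'c, 'p, 'g, 'd) twofun \<Rightarrow>
   (('o, 'f, 'c) monad, ('o, 'f, 'c) monad_mor, (('o, 'f, 'c) monad_mor, 'c) trans, 'o, 'f, 'c) twofun \<Rightarrow>
   (('o, 'f, 'c) monad \<Rightarrow> ('o, 'f, 'c) monad_mor) \<Rightarrow>
   (('p, 'g, 'd) monad, ('p, 'g, 'd) monad_mor, (('p, 'g, 'd) monad_mor, 'd) trans, 'p, 'g, 'd) twofun \<Rightarrow>
   ('p \<Rightarrow> 'g) \<Rightarrow> ('o, 'f, 'c) monad \<Rightarrow> 'g" where
  "EM_mate E G EM_D e EM_E u M =
     on1 EM_E (on1 (Mnd_map G) (e M)) \<cdot>\<^bsub>E\<^esub> u (on0 G (on0 EM_D M))"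

text \<open>Right 2-adjoints are only determined up to isomorphism, so the condition is required for
  every choice of the two adjunctions.\<close>

definition standard_EM ::
  "('o, 'f, 'c) twocat \<Rightarrow> ('p, 'g, 'd) twocat \<Rightarrow> ('o, 'f, 'c, 'p, 'g, 'd) twofun \<Rightarrow> bool" where
  "standard_EM D E G \<longleftrightarrow> two_functor D E G \<and> admits_EM D \<and> admits_EM E \<and>
     (\<forall>EM_D u_D e_D EM_E u_E e_E.
        two_adjunction D (Mnd D) (iota D) EM_D u_D e_D \<longrightarrow>
        two_adjunction E (Mnd E) (iota E) EM_E u_E e_E \<longrightarrow>
        two_natural_iso (Mnd D) E (twofun_comp G EM_D) (twofun_comp EM_E (Mnd_map G))
          (EM_mate E G EM_D e_D EM_E u_E))"

section \<open>Finite products\<close>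

datatype ('o, 'f) products =
  Products (one: 'o) (prd: "'o \<Rightarrow> 'o \<Rightarrow> 'o") (pr1: "'o \<Rightarrow> 'o \<Rightarrow> 'f") (pr2: "'o \<Rightarrow> 'o \<Rightarrow> 'f")

text \<open>A choice of a terminal object and binary products of 0-cells, with the universal property
  for 1-cells and for 2-cells (that is, the products are 2-categorical limits).\<close>

locale two_category_with_products = two_category D
  for D :: "('o, 'f, 'c) twocat" (structure) +
  fixes P :: "('o, 'f) products"
  assumes one_Obj: "one P \<in> Obj D"
    and one_universal1: "X \<in> Obj D \<Longrightarrow> \<exists>!f. f \<in> hom1 D X (one P)"
    and one_universal2: "\<lbrakk>f \<in> hom1 D X (one P); g \<in> hom1 D X (one P)\<rbrakk> \<Longrightarrow> \<exists>!\<sigma>. \<sigma> \<in> hom2 D f g"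
    and prd_Obj: "\<lbrakk>A \<in> Obj D; B \<in> Obj D\<rbrakk> \<Longrightarrow> prd P A B \<in> Obj D"
    and pr1_hom: "\<lbrakk>A \<in> Obj D; B \<in> Obj D\<rbrakk> \<Longrightarrow> pr1 P A B \<in> hom1 D (prd P A B) A"
    and pr2_hom: "\<lbrakk>A \<in> Obj D; B \<in> Obj D\<rbrakk> \<Longrightarrow> pr2 P A B \<in> hom1 D (prd P A B) B"
    and prd_universal1: "\<lbrakk>f \<in> hom1 D X A; g \<in> hom1 D X B\<rbrakk> \<Longrightarrow>
      \<exists>!h. h \<in> hom1 D X (prd P A B) \<and> pr1 P A B \<cdot> h = f \<and> pr2 P A B \<cdot> h = g"
    and prd_universal2: "\<lbrakk>A \<in> Obj D; B \<in> Obj D; h \<in> hom1 D X (prd P A B); k \<in> hom1 D X (prd P A B);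
        \<sigma> \<in> hom2 D (pr1 P A B \<cdot> h) (pr1 P A B \<cdot> k);
        \<tau> \<in> hom2 D (pr2 P A B \<cdot> h) (pr2 P A B \<cdot> k)\<rbrakk> \<Longrightarrow>
      \<exists>!\<rho>. \<rho> \<in> hom2 D h k \<and> pr1 P A B \<rhd> \<rho> = \<sigma> \<and> pr2 P A B \<rhd> \<rho> = \<tau>"

section \<open>Monoidal objects and oplax monoidal morphisms\<close>

datatype ('o, 'f, 'c) monoidal =
  Monoidal (mo_ob: 'o) (mo_tensor: 'f) (mo_unit: 'f) (mo_assoc: 'c) (mo_lunit: 'c) (mo_runit: 'c)

datatype ('o, 'f, 'c) oplax_mor =
  OplaxMor (om_dom: "('o, 'f, 'c) monoidal") (om_cod: "('o, 'f, 'c) monoidal")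
    (om_cell: 'f) (om_phi: 'c) (om_phi0: 'c)

context
  fixes D :: "('o, 'f, 'c) twocat" (structure) and P :: "('o, 'f) products"
begin

definition bang :: "'o \<Rightarrow> 'f" where
  "bang X = (THE f. f \<in> hom1 D X (one P))"

definition pair1 :: "'f \<Rightarrow> 'f \<Rightarrow> 'f"  (\<open>\<langle>_,/ _\<rangle>\<close>) where
  "\<langle>f, g\<rangle> = (THE h. h \<in> hom1 D (dom1 D f) (prd P (cod1 D f) (cod1 D g)) \<and>
     pr1 P (cod1 D f) (cod1 D g) \<cdot> h = f \<and> pr2 P (cod1 D f) (cod1 D g) \<cdot> h = g)"

definition pair2 :: "'c \<Rightarrow> 'c \<Rightarrow> 'c"  (\<open>\<llangle>_,/ _\<rrangle>\<close>) where
  "\<llangle>\<sigma>, \<tau>\<rrangle> = (let A = cod1 D (dom2 D \<sigma>); B = cod1 D (dom2 D \<tau>) in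
     THE \<rho>. \<rho> \<in> hom2 D \<langle>dom2 D \<sigma>, dom2 D \<tau>\<rangle> \<langle>cod2 D \<sigma>, cod2 D \<tau>\<rangle> \<and>
       pr1 P A B \<rhd> \<rho> = \<sigma> \<and> pr2 P A B \<rhd> \<rho> = \<tau>)"

text \<open>
  Threefold and fourfold powers are bracketed to the right, with projections \<open>q\<^sub>i\<close> and \<open>p\<^sub>i\<close>.
  1-cells such as \<open>1 \<times> \<otimes>\<close> and \<open>\<otimes> \<times> 1\<close> from these powers are written as tuples of projections,
  e.g. \<open>\<langle>q\<^sub>1, \<otimes>\<langle>q\<^sub>2, q\<^sub>3\<rangle>\<rangle>\<close> and \<open>\<langle>\<otimes>\<langle>q\<^sub>1, q\<^sub>2\<rangle>, q\<^sub>3\<rangle>\<close>; this absorbs the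
  associativity isomorphisms of the products.
\<close>

definition pow3 :: "'o \<Rightarrow> 'o" where
  "pow3 A = prd P A (prd P A A)"

definition pow3_proj :: "'o \<Rightarrow> 'f \<times> 'f \<times> 'f" where
  "pow3_proj A = (pr1 P A (prd P A A),
                  pr1 P A A \<cdot> pr2 P A (prd P A A),
                  pr2 P A A \<cdot> pr2 P A (prd P A A))"

definition pow4_proj :: "'o \<Rightarrow> 'f \<times> 'f \<times> 'f \<times> 'f" where
  "pow4_proj A = (let r = pr2 P A (pow3 A); (q\<^sub>1, q\<^sub>2, q\<^sub>3) = pow3_proj A in
                  (pr1 P A (pow3 A), q\<^sub>1 \<cdot> r, q\<^sub>2 \<cdot> r, q\<^sub>3 \<cdot> r))"

definition pentagon :: "'o \<Rightarrow> 'f \<Rightarrow> 'c \<Rightarrow> bool" where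
  "pentagon A T \<alpha> \<longleftrightarrow> (let (p\<^sub>1, p\<^sub>2, p\<^sub>3, p\<^sub>4) = pow4_proj A in
     (T \<rhd> \<llangle>\<alpha> \<lhd> \<langle>p\<^sub>1, \<langle>p\<^sub>2, p\<^sub>3\<rangle>\<rangle>, id2 D p\<^sub>4\<rrangle>)
       \<bullet> (\<alpha> \<lhd> \<langle>p\<^sub>1, \<langle>T \<cdot> \<langle>p\<^sub>2, p\<^sub>3\<rangle>, p\<^sub>4\<rangle>\<rangle>)
       \<bullet> (T \<rhd> \<llangle>id2 D p\<^sub>1, \<alpha> \<lhd> \<langle>p\<^sub>2, \<langle>p\<^sub>3, p\<^sub>4\<rangle>\<rangle>\<rrangle>)
     = (\<alpha> \<lhd> \<langle>T \<cdot> \<langle>p\<^sub>1, p\<^sub>2\<rangle>, \<langle>p\<^sub>3, p\<^sub>4\<rangle>\<rangle>)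
       \<bullet> (\<alpha> \<lhd> \<langle>p\<^sub>1, \<langle>p\<^sub>2, T \<cdot> \<langle>p\<^sub>3, p\<^sub>4\<rangle>\<rangle>\<rangle>))"

definition triangle :: "'o \<Rightarrow> 'f \<Rightarrow> 'f \<Rightarrow> 'c \<Rightarrow> 'c \<Rightarrow> 'c \<Rightarrow> bool" where
  "triangle A T I \<alpha> l r \<longleftrightarrow> (let p\<^sub>1 = pr1 P A A; p\<^sub>2 = pr2 P A A in
     (T \<rhd> \<llangle>r \<lhd> p\<^sub>1, id2 D p\<^sub>2\<rrangle>) \<bullet> (\<alpha> \<lhd> \<langle>p\<^sub>1, \<langle>I \<cdot> bang (prd P A A), p\<^sub>2\<rangle>\<rangle>)
     = T \<rhd> \<llangle>id2 D p\<^sub>1, l \<lhd> p\<^sub>2\<rrangle>)"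

definition is_monoidal :: "('o, 'f, 'c) monoidal \<Rightarrow> bool" where
  "is_monoidal M \<longleftrightarrow> (case M of Monoidal A T I \<alpha> l r \<Rightarrow>
     A \<in> Obj D \<and> T \<in> hom1 D (prd P A A) A \<and> I \<in> hom1 D (one P) A \<and>
     (let (q\<^sub>1, q\<^sub>2, q\<^sub>3) = pow3_proj A in
        \<alpha> \<in> hom2 D (T \<cdot> \<langle>q\<^sub>1, T \<cdot> \<langle>q\<^sub>2, q\<^sub>3\<rangle>\<rangle>) (T \<cdot> \<langle>T \<cdot> \<langle>q\<^sub>1, q\<^sub>2\<rangle>, q\<^sub>3\<rangle>)) \<and>
     l \<in> hom2 D (T \<cdot> \<langle>I \<cdot> bang A, id1 D A\<rangle>) (id1 D A) \<and>
     r \<in> hom2 D (T \<cdot> \<langle>id1 D A, I \<cdot> bang A\<rangle>) (id1 D A) \<and>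
     invertible2 D \<alpha> \<and> invertible2 D l \<and> invertible2 D r \<and>
     pentagon A T \<alpha> \<and> triangle A T I \<alpha> l r)"

definition is_oplax_mor :: "('o, 'f, 'c) oplax_mor \<Rightarrow> bool" where
  "is_oplax_mor m \<longleftrightarrow>
     (case m of OplaxMor (Monoidal A T I \<alpha> l r) (Monoidal A' T' I' \<alpha>' l' r') F \<phi> \<phi>\<^sub>0 \<Rightarrow>
       is_monoidal (Monoidal A T I \<alpha> l r) \<and> is_monoidal (Monoidal A' T' I' \<alpha>' l' r') \<and>
       F \<in> hom1 D A A' \<and>
       \<phi> \<in> hom2 D (F \<cdot> T) (T' \<cdot> \<langle>F \<cdot> pr1 P A A, F \<cdot> pr2 P A A\<rangle>) \<and>
       \<phi>\<^sub>0 \<in> hom2 D (F \<cdot> I) I' \<and>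
       (let (q\<^sub>1, q\<^sub>2, q\<^sub>3) = pow3_proj A in
          (\<alpha>' \<lhd> \<langle>F \<cdot> q\<^sub>1, \<langle>F \<cdot> q\<^sub>2, F \<cdot> q\<^sub>3\<rangle>\<rangle>)
            \<bullet> (T' \<rhd> \<llangle>id2 D (F \<cdot> q\<^sub>1), \<phi> \<lhd> \<langle>q\<^sub>2, q\<^sub>3\<rangle>\<rrangle>)
            \<bullet> (\<phi> \<lhd> \<langle>q\<^sub>1, T \<cdot> \<langle>q\<^sub>2, q\<^sub>3\<rangle>\<rangle>)
          = (T' \<rhd> \<llangle>\<phi> \<lhd> \<langle>q\<^sub>1, q\<^sub>2\<rangle>, id2 D (F \<cdot> q\<^sub>3)\<rrangle>)
            \<bullet> (\<phi> \<lhd> \<langle>T \<cdot> \<langle>q\<^sub>1, q\<^sub>2\<rangle>, q\<^sub>3\<rangle>)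
            \<bullet> (F \<rhd> \<alpha>)) \<and>
       (r' \<lhd> F) \<bullet> (T' \<rhd> \<llangle>id2 D F, \<phi>\<^sub>0 \<lhd> bang A\<rrangle>) \<bullet> (\<phi> \<lhd> \<langle>id1 D A, I \<cdot> bang A\<rangle>) = F \<rhd> r \<and>
       (l' \<lhd> F) \<bullet> (T' \<rhd> \<llangle>\<phi>\<^sub>0 \<lhd> bang A, id2 D F\<rrangle>) \<bullet> (\<phi> \<lhd> \<langle>I \<cdot> bang A, id1 D A\<rangle>) = F \<rhd> l)"

definition is_oplax_trans :: "(('o, 'f, 'c) oplax_mor, 'c) trans \<Rightarrow> bool" where
  "is_oplax_trans t \<longleftrightarrow>
     (case t of Trans (OplaxMor M N F \<phi> \<phi>\<^sub>0) (OplaxMor M' N' F' \<phi>' \<phi>\<^sub>0') \<sigma> \<Rightarrow>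
       is_oplax_mor (OplaxMor M N F \<phi> \<phi>\<^sub>0) \<and> is_oplax_mor (OplaxMor M' N' F' \<phi>' \<phi>\<^sub>0') \<and>
       M' = M \<and> N' = N \<and> \<sigma> \<in> hom2 D F F' \<and>
       (let A = mo_ob M in
         \<phi>' \<bullet> (\<sigma> \<lhd> mo_tensor M) = (mo_tensor N \<rhd> \<llangle>\<sigma> \<lhd> pr1 P A A, \<sigma> \<lhd> pr2 P A A\<rrangle>) \<bullet> \<phi>) \<and>
       \<phi>\<^sub>0' \<bullet> (\<sigma> \<lhd> mo_unit M) = \<phi>\<^sub>0)"

definition oplax_mor_comp ::
  "('o, 'f, 'c) oplax_mor \<Rightarrow> ('o, 'f, 'c) oplax_mor \<Rightarrow> ('o, 'f, 'c) oplax_mor" where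
  "oplax_mor_comp n m =
     (let A = mo_ob (om_dom m); F = om_cell m; F' = om_cell n in
      OplaxMor (om_dom m) (om_cod n) (F' \<cdot> F)
        ((om_phi n \<lhd> \<langle>F \<cdot> pr1 P A A, F \<cdot> pr2 P A A\<rangle>) \<bullet> (F' \<rhd> om_phi m))
        (om_phi0 n \<bullet> (F' \<rhd> om_phi0 m)))"

definition Mon_op ::
  "(('o, 'f, 'c) monoidal, ('o, 'f, 'c) oplax_mor, (('o, 'f, 'c) oplax_mor, 'c) trans) twocat" where
  "Mon_op = \<lparr>
     Obj = {M. is_monoidal M},
     Cell1 = {m. is_oplax_mor m},
     Cell2 = {t. is_oplax_trans t},
     dom1 = om_dom, cod1 = om_cod, dom2 = tr_dom, cod2 = tr_cod,
     id1 = (\<lambda>M. OplaxMor M M (id1 D (mo_ob M)) (id2 D (mo_tensor M)) (id2 D (mo_unit M))),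
     id2 = (\<lambda>m. Trans m m (id2 D (om_cell m))),
     comp1 = oplax_mor_comp,
     vcomp = (\<lambda>t s. Trans (tr_dom s) (tr_cod t) (tr_cell t \<bullet> tr_cell s)),
     hcomp = (\<lambda>t s. Trans (oplax_mor_comp (tr_dom t) (tr_dom s))
                           (oplax_mor_comp (tr_cod t) (tr_cod s)) (tr_cell t \<star> tr_cell s))\<rparr>"

end

definition Mon_op_forget ::
  "(('o, 'f, 'c) monoidal, ('o, 'f, 'c) oplax_mor, (('o, 'f, 'c) oplax_mor, 'c) trans,
    'o, 'f, 'c) twofun" where
  "Mon_op_forget = TwoFun mo_ob om_cell tr_cell"

end

theory Submission
  imports Defs
begin

text \<open>
  Let \<open>M\<close> be a monad on a monoidal object \<open>\<C>\<close> in \<open>Mon_op D\<close>, with endomorphism \<open>(S, \<phi>, \<phi>\<^sub>0)\<close>, and let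
  \<open>U : E \<rightarrow> \<C>\<close> with action \<open>\<chi> : S U \<Rightarrow> U\<close> be the Eilenberg-Moore object in \<open>D\<close> of the underlying monad.
  If \<open>(f, a)\<close> and \<open>(g, b)\<close> are algebras with a common domain, then \<open>f \<otimes> g\<close> is an algebra with action
  \<open>(a \<otimes> b) \<bullet> \<phi>\<close>, because the unit and the multiplication of \<open>M\<close> are oplax monoidal; likewise \<open>\<phi>\<^sub>0\<close> is an
  action on the unit object, and the coherence cells of \<open>\<C>\<close> are morphisms of algebras.
  So the universal property of \<open>E\<close> lifts the structure of \<open>\<C>\<close> to \<open>E\<close> in such a way that \<open>U\<close> is strict
  monoidal and \<open>\<chi>\<close> is monoidal, and the axioms hold since \<open>U\<close> is faithful on 2-cells between lifted
  1-cells. The oplax structure cells of an algebra in \<open>Mon_op D\<close> are themselves morphisms of algebras in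
  \<open>D\<close> and therefore lift too, which makes \<open>U\<close> the Eilenberg-Moore object in \<open>Mon_op D\<close>. By construction
  its image in \<open>D\<close> is the given one; since universal arrows are unique up to isomorphism, every other
  choice of the two adjunctions is standard as well.
\<close>

text \<open>Lifting an EM object is a matter of one monad, whereas \<open>admits_EM\<close> and
  \<open>standard_EM\<close> speak of whole 2-adjunctions, the latter of all of them. The bridge is
  \<open>universal_arrow\<close>, the value of a right 2-adjoint at a single object: it suffices to
  find, for each monad in \<open>Mon_op D P\<close>, one universal arrow whose image in
  \<open>D\<close> is again universal.

  The lifted structure can be strict because the universal property determines 1-cells by equality:
  \<open>U\<close> composed with a lift is the prescribed 1-cell itself, and no comparison cells
  arise between \<open>E\<close> and the base.

  The axioms are stated at projections from powers, but composites of morphisms evaluate structure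
  cells at other tuples. Computations therefore run over arbitrary 1-cells into the object, where
  whiskering is substitution and interchange is naturality; the tuple of projections, being an
  identity, leads back to the axioms.

  Typing is expressed by equations on boundaries, which simp can discharge while it normalizes
  composites to the right.\<close>

declare hom1_def [simp] hom2_def [simp]

section \<open>Calculus of whiskering\<close>

context two_category
begin

declare dom1_Obj [simp] cod1_Obj [simp] dom2_Cell1 [simp] cod2_Cell1 [simp]

text \<open>The 0-cells of a 2-cell are normalized to those of its domain, so that boundary
  conditions meet in one form.\<close>

lemma globular [simp]:
  "\<sigma> \<in> Cell2 C \<Longrightarrow> dom1 C (cod2 C \<sigma>) = dom1 C (dom2 C \<sigma>)"
  "\<sigma> \<in> Cell2 C \<Longrightarrow> cod1 C (cod2 C \<sigma>) = cod1 C (dom2 C \<sigma>)"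
  by (simp_all add: dom1_globular cod1_globular)

lemma hom1D:
  assumes "f \<in> hom1 C X Y"
  shows "X \<in> Obj C" "f \<in> Cell1 C" "dom1 C f = X" "cod1 C f = Y"
  using assms dom1_Obj[of f] by simp_all

lemma id1_simps [simp]:
  assumes "A \<in> Obj C"
  shows "id1 C A \<in> Cell1 C" "dom1 C (id1 C A) = A" "cod1 C (id1 C A) = A"
  using id1_hom[OF assms] by simp_all

text \<open>Conditions on carriers and boundaries replace membership in hom-sets, since the
  intermediate 0-cell of the axiom would not be found by matching.\<close>

lemma comp1_simps [simp]:
  assumes "f \<in> Cell1 C" "g \<in> Cell1 C" "dom1 C g = cod1 C f"
  shows "g \<cdot> f \<in> Cell1 C" "dom1 C (g \<cdot> f) = dom1 C f" "cod1 C (g \<cdot> f) = cod1 C g"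
  using comp1_hom[of f "dom1 C f" "cod1 C f" g "cod1 C g"] assms by simp_all

lemma comp1_id1 [simp]:
  "f \<in> Cell1 C \<Longrightarrow> cod1 C f = Y \<Longrightarrow> id1 C Y \<cdot> f = f"
  "f \<in> Cell1 C \<Longrightarrow> dom1 C f = X \<Longrightarrow> f \<cdot> id1 C X = f"
  using comp1_id_left[of f "dom1 C f"] comp1_id_right[of f _ "cod1 C f"] by simp_all

lemma comp1_assoc' [simp]:
  assumes "f \<in> Cell1 C" "g \<in> Cell1 C" "h \<in> Cell1 C" "dom1 C g = cod1 C f" "dom1 C h = cod1 C g"
  shows "(h \<cdot> g) \<cdot> f = h \<cdot> (g \<cdot> f)"
  using comp1_assoc[of f "dom1 C f" "cod1 C f" g "cod1 C g" h "cod1 C h"] assms by simp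

lemma id2_simps [simp]:
  assumes "f \<in> Cell1 C"
  shows "id2 C f \<in> Cell2 C" "dom2 C (id2 C f) = f" "cod2 C (id2 C f) = f"
  using id2_hom[OF assms] by simp_all

lemma vcomp_simps [simp]:
  assumes "\<sigma> \<in> Cell2 C" "\<tau> \<in> Cell2 C" "dom2 C \<tau> = cod2 C \<sigma>"
  shows "\<tau> \<bullet> \<sigma> \<in> Cell2 C" "dom2 C (\<tau> \<bullet> \<sigma>) = dom2 C \<sigma>" "cod2 C (\<tau> \<bullet> \<sigma>) = cod2 C \<tau>"
  using vcomp_hom[of \<sigma> "dom2 C \<sigma>" "cod2 C \<sigma>" \<tau> "cod2 C \<tau>"] assms by simp_all

lemma vcomp_id2 [simp]:
  "\<sigma> \<in> Cell2 C \<Longrightarrow> cod2 C \<sigma> = g \<Longrightarrow> id2 C g \<bullet> \<sigma> = \<sigma>"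
  "\<sigma> \<in> Cell2 C \<Longrightarrow> dom2 C \<sigma> = f \<Longrightarrow> \<sigma> \<bullet> id2 C f = \<sigma>"
  using vcomp_id_left[of \<sigma> "dom2 C \<sigma>"] vcomp_id_right[of \<sigma> _ "cod2 C \<sigma>"] by simp_all

lemma vcomp_assoc' [simp]:
  assumes "\<rho> \<in> Cell2 C" "\<sigma> \<in> Cell2 C" "\<tau> \<in> Cell2 C" "dom2 C \<sigma> = cod2 C \<rho>" "dom2 C \<tau> = cod2 C \<sigma>"
  shows "(\<tau> \<bullet> \<sigma>) \<bullet> \<rho> = \<tau> \<bullet> (\<sigma> \<bullet> \<rho>)"
  using vcomp_assoc[of \<rho> "dom2 C \<rho>" "cod2 C \<rho>" \<sigma> "cod2 C \<sigma>" \<tau> "cod2 C \<tau>"] assms by simp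

lemma hcomp_simps:
  assumes "\<sigma> \<in> Cell2 C" "\<tau> \<in> Cell2 C" "dom1 C (dom2 C \<tau>) = cod1 C (dom2 C \<sigma>)"
  shows "\<tau> \<star> \<sigma> \<in> Cell2 C" "dom2 C (\<tau> \<star> \<sigma>) = dom2 C \<tau> \<cdot> dom2 C \<sigma>"
    "cod2 C (\<tau> \<star> \<sigma>) = cod2 C \<tau> \<cdot> cod2 C \<sigma>"
  using hcomp_hom[of "dom2 C \<sigma>" "dom1 C (dom2 C \<sigma>)" "cod1 C (dom2 C \<sigma>)" "dom2 C \<tau>"
      "cod1 C (dom2 C \<tau>)" \<sigma> "cod2 C \<sigma>" \<tau> "cod2 C \<tau>"] assms by simp_all

lemma hcomp_assoc':
  assumes "\<rho> \<in> Cell2 C" "\<sigma> \<in> Cell2 C" "\<tau> \<in> Cell2 C"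
    "dom1 C (dom2 C \<sigma>) = cod1 C (dom2 C \<rho>)" "dom1 C (dom2 C \<tau>) = cod1 C (dom2 C \<sigma>)"
  shows "(\<tau> \<star> \<sigma>) \<star> \<rho> = \<tau> \<star> (\<sigma> \<star> \<rho>)"
  by (rule hcomp_assoc[where f = "dom2 C \<rho>" and g = "dom2 C \<sigma>" and h = "dom2 C \<tau>"
        and f' = "cod2 C \<rho>" and g' = "cod2 C \<sigma>" and h' = "cod2 C \<tau>"])
    (use assms in simp_all)

lemma interchange':
  assumes "\<sigma> \<in> Cell2 C" "\<sigma>' \<in> Cell2 C" "\<tau> \<in> Cell2 C" "\<tau>' \<in> Cell2 C"
    "dom2 C \<sigma>' = cod2 C \<sigma>" "dom2 C \<tau>' = cod2 C \<tau>" "dom1 C (dom2 C \<tau>) = cod1 C (dom2 C \<sigma>)"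
  shows "(\<tau>' \<bullet> \<tau>) \<star> (\<sigma>' \<bullet> \<sigma>) = (\<tau>' \<star> \<sigma>') \<bullet> (\<tau> \<star> \<sigma>)"
  by (rule interchange[where f = "dom2 C \<sigma>" and g = "dom2 C \<tau>" and f' = "cod2 C \<sigma>"
        and g' = "cod2 C \<tau>" and f'' = "cod2 C \<sigma>'" and g'' = "cod2 C \<tau>'"])
    (use assms in simp_all)

lemma post_whisker_simps [simp]:
  assumes "F \<in> Cell1 C" "\<sigma> \<in> Cell2 C" "dom1 C F = cod1 C (dom2 C \<sigma>)"
  shows "F \<rhd> \<sigma> \<in> Cell2 C" "dom2 C (F \<rhd> \<sigma>) = F \<cdot> dom2 C \<sigma>" "cod2 C (F \<rhd> \<sigma>) = F \<cdot> cod2 C \<sigma>"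
  using assms by (simp_all add: post_whisker_def hcomp_simps)

lemma pre_whisker_simps [simp]:
  assumes "G \<in> Cell1 C" "\<sigma> \<in> Cell2 C" "dom1 C (dom2 C \<sigma>) = cod1 C G"
  shows "\<sigma> \<lhd> G \<in> Cell2 C" "dom2 C (\<sigma> \<lhd> G) = dom2 C \<sigma> \<cdot> G" "cod2 C (\<sigma> \<lhd> G) = cod2 C \<sigma> \<cdot> G"
  using assms by (simp_all add: pre_whisker_def hcomp_simps)

lemma post_whisker_id2 [simp]:
  assumes "F \<in> Cell1 C" "f \<in> Cell1 C" "dom1 C F = cod1 C f"
  shows "F \<rhd> id2 C f = id2 C (F \<cdot> f)"
  using assms by (simp add: post_whisker_def hcomp_id2[where X = "dom1 C f" and Y = "cod1 C f"])

lemma pre_whisker_id2 [simp]: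
  assumes "F \<in> Cell1 C" "f \<in> Cell1 C" "dom1 C F = cod1 C f"
  shows "id2 C F \<lhd> f = id2 C (F \<cdot> f)"
  using assms by (simp add: pre_whisker_def hcomp_id2[where X = "dom1 C f" and Y = "cod1 C f"])

lemma post_whisker_vcomp [simp]:
  assumes "F \<in> Cell1 C" "\<sigma> \<in> Cell2 C" "\<tau> \<in> Cell2 C" "dom2 C \<tau> = cod2 C \<sigma>" "dom1 C F = cod1 C (dom2 C \<sigma>)"
  shows "F \<rhd> (\<tau> \<bullet> \<sigma>) = (F \<rhd> \<tau>) \<bullet> (F \<rhd> \<sigma>)"
  using interchange'[of \<sigma> \<tau> "id2 C F" "id2 C F"] assms by (simp add: post_whisker_def)

lemma pre_whisker_vcomp [simp]:
  assumes "F \<in> Cell1 C" "\<sigma> \<in> Cell2 C" "\<tau> \<in> Cell2 C" "dom2 C \<tau> = cod2 C \<sigma>" "dom1 C (dom2 C \<sigma>) = cod1 C F"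
  shows "(\<tau> \<bullet> \<sigma>) \<lhd> F = (\<tau> \<lhd> F) \<bullet> (\<sigma> \<lhd> F)"
  using interchange'[of "id2 C F" "id2 C F" \<sigma> \<tau>] assms by (simp add: pre_whisker_def)

lemma post_whisker_id1 [simp]:
  "\<sigma> \<in> Cell2 C \<Longrightarrow> cod1 C (dom2 C \<sigma>) = Y \<Longrightarrow> id1 C Y \<rhd> \<sigma> = \<sigma>"
  using hcomp_id_left[of "dom2 C \<sigma>" "dom1 C (dom2 C \<sigma>)" Y \<sigma> "cod2 C \<sigma>"]
  by (simp add: post_whisker_def)

lemma pre_whisker_id1 [simp]:
  "\<sigma> \<in> Cell2 C \<Longrightarrow> dom1 C (dom2 C \<sigma>) = X \<Longrightarrow> \<sigma> \<lhd> id1 C X = \<sigma>"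
  using hcomp_id_right[of "dom2 C \<sigma>" X "cod1 C (dom2 C \<sigma>)" \<sigma> "cod2 C \<sigma>"]
  by (simp add: pre_whisker_def)

text \<open>Together with \<open>pre_whisker_comp1\<close>, \<open>post_pre_whisker\<close> and the
  rules for \<open>\<bullet>\<close> this brings whiskered cells to vertical composites of cells
  \<open>F \<rhd> (\<sigma> \<lhd> G)\<close>.\<close>

lemma post_whisker_comp1 [simp]:
  assumes "F \<in> Cell1 C" "G \<in> Cell1 C" "\<sigma> \<in> Cell2 C" "dom1 C F = cod1 C (dom2 C \<sigma>)" "dom1 C G = cod1 C F"
  shows "(G \<cdot> F) \<rhd> \<sigma> = G \<rhd> F \<rhd> \<sigma>"
  using hcomp_assoc'[of \<sigma> "id2 C F" "id2 C G"] pre_whisker_id2[of G F] assms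
  by (simp add: post_whisker_def pre_whisker_def)

lemma pre_whisker_comp1 [simp]:
  assumes "F \<in> Cell1 C" "G \<in> Cell1 C" "\<sigma> \<in> Cell2 C" "dom1 C (dom2 C \<sigma>) = cod1 C G" "dom1 C G = cod1 C F"
  shows "(\<sigma> \<lhd> G) \<lhd> F = \<sigma> \<lhd> (G \<cdot> F)"
  using hcomp_assoc'[of "id2 C F" "id2 C G" \<sigma>] pre_whisker_id2[of G F] assms
  by (simp add: pre_whisker_def)

lemma post_pre_whisker [simp]:
  assumes "F \<in> Cell1 C" "G \<in> Cell1 C" "\<sigma> \<in> Cell2 C" "dom1 C F = cod1 C (dom2 C \<sigma>)" "dom1 C (dom2 C \<sigma>) = cod1 C G"
  shows "(F \<rhd> \<sigma>) \<lhd> G = F \<rhd> (\<sigma> \<lhd> G)"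
  using hcomp_assoc'[of "id2 C G" \<sigma> "id2 C F"] assms
  by (simp add: pre_whisker_def post_whisker_def)

lemma hcomp_whisker:
  assumes "\<sigma> \<in> Cell2 C" "\<tau> \<in> Cell2 C" "dom1 C (dom2 C \<tau>) = cod1 C (dom2 C \<sigma>)"
  shows "\<tau> \<star> \<sigma> = (\<tau> \<lhd> cod2 C \<sigma>) \<bullet> (dom2 C \<tau> \<rhd> \<sigma>)"
  using interchange'[of \<sigma> "id2 C (cod2 C \<sigma>)" "id2 C (dom2 C \<tau>)" \<tau>] assms
  by (simp add: pre_whisker_def post_whisker_def)

text \<open>Interchange in whiskered form, the source of the naturality squares below. It has no
  preferred direction and is applied by hand; the boundaries are separate equations so that a goal
  may display them in normalized form.\<close>

lemma whisker_swap:
  assumes "\<sigma> \<in> Cell2 C" "\<tau> \<in> Cell2 C" "dom1 C (dom2 C \<tau>) = cod1 C (dom2 C \<sigma>)"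
    "dom2 C \<sigma> = f" "cod2 C \<sigma> = f'" "dom2 C \<tau> = g" "cod2 C \<tau> = g'"
  shows "(\<tau> \<lhd> f') \<bullet> (g \<rhd> \<sigma>) = (g' \<rhd> \<sigma>) \<bullet> (\<tau> \<lhd> f)"
  using interchange'[of \<sigma> "id2 C (cod2 C \<sigma>)" "id2 C (dom2 C \<tau>)" \<tau>]
    interchange'[of "id2 C (dom2 C \<sigma>)" \<sigma> \<tau> "id2 C (cod2 C \<tau>)"] assms
  by (auto simp: pre_whisker_def post_whisker_def)

text \<open>Simp associates to the right, and then \<open>a \<bullet> b\<close> is not a subterm of
  a longer composite; the equation is therefore restated with a tail \<open>x\<close>.\<close>

lemma vcomp_reassoc:
  assumes "a \<bullet> b = c" "x \<in> Cell2 C" "b \<in> Cell2 C" "a \<in> Cell2 C" "dom2 C b = cod2 C x" "dom2 C a = cod2 C b"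
  shows "a \<bullet> (b \<bullet> x) = c \<bullet> x"
  using vcomp_assoc'[of x b a] assms by simp

end

context two_functor
begin

lemma on1_simps [simp]:
  assumes "f \<in> Cell1 C"
  shows "on1 F f \<in> Cell1 D" "dom1 D (on1 F f) = on0 F (dom1 C f)" "cod1 D (on1 F f) = on0 F (cod1 C f)"
  using on1_hom[of f "dom1 C f" "cod1 C f"] assms by simp_all

lemma on2_simps [simp]:
  assumes "\<sigma> \<in> Cell2 C"
  shows "on2 F \<sigma> \<in> Cell2 D" "dom2 D (on2 F \<sigma>) = on1 F (dom2 C \<sigma>)" "cod2 D (on2 F \<sigma>) = on1 F (cod2 C \<sigma>)"
  using on2_hom[of \<sigma> "dom2 C \<sigma>" "cod2 C \<sigma>"] assms by simp_all

declare on0_Obj [simp] on1_id [simp] on2_id [simp]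

lemma on1_comp' [simp]:
  "f \<in> Cell1 C \<Longrightarrow> g \<in> Cell1 C \<Longrightarrow> dom1 C g = cod1 C f \<Longrightarrow> on1 F (g \<cdot>\<^bsub>C\<^esub> f) = on1 F g \<cdot>\<^bsub>D\<^esub> on1 F f"
  using on1_comp[of f "dom1 C f" "cod1 C f" g "cod1 C g"] by simp

lemma on2_vcomp' [simp]:
  "\<sigma> \<in> Cell2 C \<Longrightarrow> \<tau> \<in> Cell2 C \<Longrightarrow> dom2 C \<tau> = cod2 C \<sigma>
    \<Longrightarrow> on2 F (\<tau> \<bullet>\<^bsub>C\<^esub> \<sigma>) = on2 F \<tau> \<bullet>\<^bsub>D\<^esub> on2 F \<sigma>"
  using on2_vcomp[of \<sigma> "dom2 C \<sigma>" "cod2 C \<sigma>" \<tau> "cod2 C \<tau>"] by simp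

lemma on2_hcomp':
  assumes "\<sigma> \<in> Cell2 C" "\<tau> \<in> Cell2 C" "dom1 C (dom2 C \<tau>) = cod1 C (dom2 C \<sigma>)"
  shows "on2 F (\<tau> \<star>\<^bsub>C\<^esub> \<sigma>) = on2 F \<tau> \<star>\<^bsub>D\<^esub> on2 F \<sigma>"
  by (rule on2_hcomp[where f = "dom2 C \<sigma>" and g = "dom2 C \<tau>" and f' = "cod2 C \<sigma>" and g' = "cod2 C \<tau>"])
    (use assms in simp_all)

lemma on2_post_whisker [simp]:
  "\<sigma> \<in> Cell2 C \<Longrightarrow> g \<in> Cell1 C \<Longrightarrow> dom1 C g = cod1 C (dom2 C \<sigma>)
    \<Longrightarrow> on2 F (g \<rhd>\<^bsub>C\<^esub> \<sigma>) = on1 F g \<rhd>\<^bsub>D\<^esub> on2 F \<sigma>"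
  by (simp add: post_whisker_def on2_hcomp')

lemma on2_pre_whisker [simp]:
  "\<sigma> \<in> Cell2 C \<Longrightarrow> g \<in> Cell1 C \<Longrightarrow> dom1 C (dom2 C \<sigma>) = cod1 C g
    \<Longrightarrow> on2 F (\<sigma> \<lhd>\<^bsub>C\<^esub> g) = on2 F \<sigma> \<lhd>\<^bsub>D\<^esub> on1 F g"
  by (simp add: pre_whisker_def on2_hcomp')

end

section \<open>2-categories of structured cells\<close>

text \<open>\<open>Mnd\<close> and \<open>Mon_op\<close> share this pattern: a 2-cell is a 2-cell of
  \<open>E\<close> with prescribed source and target, subject to a property. Equations of 2-cells
  are inherited from \<open>E\<close>, and only closure of the property remains to be checked. For
  horizontal composites this reduces to whiskering on either side, by
  \<open>hcomp_whisker\<close>.\<close>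

locale structured_two_category = E: two_category E
  for E :: "('o, 'f, 'c) twocat" +
  fixes C :: "('p, 'g, ('g, 'c) trans) twocat" and U0 :: "'p \<Rightarrow> 'o" and U1 :: "'g \<Rightarrow> 'f"
  assumes U0_Obj [simp]: "A \<in> Obj C \<Longrightarrow> U0 A \<in> Obj E"
    and boundary [simp]: "f \<in> Cell1 C \<Longrightarrow> dom1 C f \<in> Obj C" "f \<in> Cell1 C \<Longrightarrow> cod1 C f \<in> Obj C"
    and U1_hom [simp]: "f \<in> Cell1 C \<Longrightarrow> U1 f \<in> Cell1 E"
      "f \<in> Cell1 C \<Longrightarrow> dom1 E (U1 f) = U0 (dom1 C f)"
      "f \<in> Cell1 C \<Longrightarrow> cod1 E (U1 f) = U0 (cod1 C f)"
    and ident_hom [simp]: "A \<in> Obj C \<Longrightarrow> id1 C A \<in> hom1 C A A"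
    and U1_ident [simp]: "A \<in> Obj C \<Longrightarrow> U1 (id1 C A) = id1 E (U0 A)"
    and comp_hom: "\<lbrakk>f \<in> Cell1 C; g \<in> Cell1 C; dom1 C g = cod1 C f\<rbrakk>
      \<Longrightarrow> g \<cdot>\<^bsub>C\<^esub> f \<in> hom1 C (dom1 C f) (cod1 C g)"
    and U1_comp [simp]: "\<lbrakk>f \<in> Cell1 C; g \<in> Cell1 C; dom1 C g = cod1 C f\<rbrakk>
      \<Longrightarrow> U1 (g \<cdot>\<^bsub>C\<^esub> f) = U1 g \<cdot>\<^bsub>E\<^esub> U1 f"
    and ident_left [simp]: "\<lbrakk>f \<in> Cell1 C; cod1 C f = Y\<rbrakk> \<Longrightarrow> id1 C Y \<cdot>\<^bsub>C\<^esub> f = f"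
    and ident_right [simp]: "\<lbrakk>f \<in> Cell1 C; dom1 C f = X\<rbrakk> \<Longrightarrow> f \<cdot>\<^bsub>C\<^esub> id1 C X = f"
    and comp_assoc [simp]:
      "\<lbrakk>f \<in> Cell1 C; g \<in> Cell1 C; h \<in> Cell1 C; dom1 C g = cod1 C f; dom1 C h = cod1 C g\<rbrakk>
      \<Longrightarrow> (h \<cdot>\<^bsub>C\<^esub> g) \<cdot>\<^bsub>C\<^esub> f = h \<cdot>\<^bsub>C\<^esub> (g \<cdot>\<^bsub>C\<^esub> f)"
    and ops [simp]: "dom2 C = tr_dom" "cod2 C = tr_cod"
      "id2 C = (\<lambda>m. Trans m m (id2 E (U1 m)))"
      "vcomp C = (\<lambda>t s. Trans (tr_dom s) (tr_cod t) (tr_cell t \<bullet>\<^bsub>E\<^esub> tr_cell s))"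
      "hcomp C = (\<lambda>t s. Trans (tr_dom t \<cdot>\<^bsub>C\<^esub> tr_dom s) (tr_cod t \<cdot>\<^bsub>C\<^esub> tr_cod s) (tr_cell t \<star>\<^bsub>E\<^esub> tr_cell s))"
    and cell_boundary [simp]: "t \<in> Cell2 C \<Longrightarrow> tr_dom t \<in> Cell1 C" "t \<in> Cell2 C \<Longrightarrow> tr_cod t \<in> Cell1 C"
      "t \<in> Cell2 C \<Longrightarrow> dom1 C (tr_cod t) = dom1 C (tr_dom t)"
      "t \<in> Cell2 C \<Longrightarrow> cod1 C (tr_cod t) = cod1 C (tr_dom t)"
    and cell_hom [simp]: "t \<in> Cell2 C \<Longrightarrow> tr_cell t \<in> hom2 E (U1 (tr_dom t)) (U1 (tr_cod t))"
    and id2_closed [simp]: "f \<in> Cell1 C \<Longrightarrow> Trans f f (id2 E (U1 f)) \<in> Cell2 C"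
    and vcomp_closed [simp]: "\<lbrakk>s \<in> Cell2 C; t \<in> Cell2 C; tr_dom t = tr_cod s\<rbrakk>
      \<Longrightarrow> Trans (tr_dom s) (tr_cod t) (tr_cell t \<bullet>\<^bsub>E\<^esub> tr_cell s) \<in> Cell2 C"
    and post_whisker_closed: "\<lbrakk>s \<in> Cell2 C; m \<in> Cell1 C; dom1 C m = cod1 C (tr_dom s)\<rbrakk>
      \<Longrightarrow> Trans (m \<cdot>\<^bsub>C\<^esub> tr_dom s) (m \<cdot>\<^bsub>C\<^esub> tr_cod s) (U1 m \<rhd>\<^bsub>E\<^esub> tr_cell s) \<in> Cell2 C"
    and pre_whisker_closed: "\<lbrakk>s \<in> Cell2 C; m \<in> Cell1 C; dom1 C (tr_dom s) = cod1 C m\<rbrakk>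
      \<Longrightarrow> Trans (tr_dom s \<cdot>\<^bsub>C\<^esub> m) (tr_cod s \<cdot>\<^bsub>C\<^esub> m) (tr_cell s \<lhd>\<^bsub>E\<^esub> U1 m) \<in> Cell2 C"
begin

lemma ident_simps [simp]:
  "A \<in> Obj C \<Longrightarrow> id1 C A \<in> Cell1 C" "A \<in> Obj C \<Longrightarrow> dom1 C (id1 C A) = A"
  "A \<in> Obj C \<Longrightarrow> cod1 C (id1 C A) = A"
  using ident_hom[of A] by (simp_all del: ident_hom)

lemma comp_simps [simp]:
  assumes "f \<in> Cell1 C" "g \<in> Cell1 C" "dom1 C g = cod1 C f"
  shows "g \<cdot>\<^bsub>C\<^esub> f \<in> Cell1 C" "dom1 C (g \<cdot>\<^bsub>C\<^esub> f) = dom1 C f" "cod1 C (g \<cdot>\<^bsub>C\<^esub> f) = cod1 C g"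
  using comp_hom[OF assms] by simp_all

lemma cell_simps [simp]:
  "t \<in> Cell2 C \<Longrightarrow> tr_cell t \<in> Cell2 E" "t \<in> Cell2 C \<Longrightarrow> dom2 E (tr_cell t) = U1 (tr_dom t)"
  "t \<in> Cell2 C \<Longrightarrow> cod2 E (tr_cell t) = U1 (tr_cod t)"
  using cell_hom[of t] by (simp_all del: cell_hom)

lemma hcomp_closed [simp]:
  assumes "s \<in> Cell2 C" "t \<in> Cell2 C" "dom1 C (tr_dom t) = cod1 C (tr_dom s)"
  shows "Trans (tr_dom t \<cdot>\<^bsub>C\<^esub> tr_dom s) (tr_cod t \<cdot>\<^bsub>C\<^esub> tr_cod s) (tr_cell t \<star>\<^bsub>E\<^esub> tr_cell s) \<in> Cell2 C"
  using vcomp_closed[OF post_whisker_closed[of s "tr_dom t"] pre_whisker_closed[of t "tr_cod s"]] assms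
  by (simp add: E.hcomp_whisker)

text \<open>Cells of \<open>C\<close> with the same boundary and the same underlying cell are equal,
  so each axiom on 2-cells is the axiom of \<open>E\<close> applied to
  \<open>tr_cell\<close>.\<close>

lemma lifted_two_category: "two_category C"
proof
  fix W X Y Z f g h f' g' h' \<rho> \<sigma> \<tau>
  show "\<lbrakk>f \<in> hom1 C W X; g \<in> hom1 C X Y; h \<in> hom1 C Y Z;
        \<rho> \<in> hom2 C f f'; \<sigma> \<in> hom2 C g g'; \<tau> \<in> hom2 C h h'\<rbrakk>
      \<Longrightarrow> (\<tau> \<star>\<^bsub>C\<^esub> \<sigma>) \<star>\<^bsub>C\<^esub> \<rho> = \<tau> \<star>\<^bsub>C\<^esub> (\<sigma> \<star>\<^bsub>C\<^esub> \<rho>)"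
    by (auto simp: E.hcomp_assoc')
next
  fix X Y Z f g f' f'' g' g'' \<sigma> \<sigma>' \<tau> \<tau>'
  show "\<lbrakk>f \<in> hom1 C X Y; g \<in> hom1 C Y Z;
        \<sigma> \<in> hom2 C f f'; \<sigma>' \<in> hom2 C f' f''; \<tau> \<in> hom2 C g g'; \<tau>' \<in> hom2 C g' g''\<rbrakk>
      \<Longrightarrow> (\<tau>' \<bullet>\<^bsub>C\<^esub> \<tau>) \<star>\<^bsub>C\<^esub> (\<sigma>' \<bullet>\<^bsub>C\<^esub> \<sigma>) = (\<tau>' \<star>\<^bsub>C\<^esub> \<sigma>') \<bullet>\<^bsub>C\<^esub> (\<tau> \<star>\<^bsub>C\<^esub> \<sigma>)"
    by (auto simp: E.interchange')
next
  fix X Y f f' \<sigma>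
  assume "f \<in> hom1 C X Y" "\<sigma> \<in> hom2 C f f'"
  then show "id2 C (id1 C Y) \<star>\<^bsub>C\<^esub> \<sigma> = \<sigma>"
    using E.post_whisker_id1[of "tr_cell \<sigma>" "U0 Y"]
    by (auto simp: post_whisker_def intro!: trans.expand)
  show "\<sigma> \<star>\<^bsub>C\<^esub> id2 C (id1 C X) = \<sigma>" if "f \<in> hom1 C X Y" "\<sigma> \<in> hom2 C f f'" for X Y f f' \<sigma>
    using E.pre_whisker_id1[of "tr_cell \<sigma>" "U0 X"] that
    by (auto simp: pre_whisker_def intro!: trans.expand)
next
  fix X Y Z f g
  assume "f \<in> hom1 C X Y" "g \<in> hom1 C Y Z"
  then show "id2 C g \<star>\<^bsub>C\<^esub> id2 C f = id2 C (g \<cdot>\<^bsub>C\<^esub> f)"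
    using E.hcomp_id2[of "U1 f" "U0 X" "U0 Y" "U1 g" "U0 Z"] by auto
qed (auto intro!: trans.expand simp del: ident_hom)

lemma forget_two_functor: "two_functor C E (TwoFun U0 U1 tr_cell)"
proof -
  interpret C: two_category C by (rule lifted_two_category)
  show ?thesis by unfold_locales auto
qed

end

section \<open>The 2-category of monads\<close>

context two_category
begin

text \<open>Stated through selectors, hence applicable to a monad that is not written as a
  constructor term; the next two lemmas do the same for morphisms and transformations.\<close>

lemma is_monad_iff:
  "is_monad C M \<longleftrightarrow> mnd_ob M \<in> Obj C \<and> mnd_end M \<in> hom1 C (mnd_ob M) (mnd_ob M) \<and>
     mnd_unit M \<in> hom2 C (id1 C (mnd_ob M)) (mnd_end M) \<and>
     mnd_mult M \<in> hom2 C (mnd_end M \<cdot> mnd_end M) (mnd_end M) \<and>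
     mnd_mult M \<bullet> (mnd_unit M \<lhd> mnd_end M) = id2 C (mnd_end M) \<and>
     mnd_mult M \<bullet> (mnd_end M \<rhd> mnd_unit M) = id2 C (mnd_end M) \<and>
     mnd_mult M \<bullet> (mnd_mult M \<lhd> mnd_end M) = mnd_mult M \<bullet> (mnd_end M \<rhd> mnd_mult M)"
  by (cases M) (simp add: is_monad_def)

lemma is_monad_mor_iff:
  "is_monad_mor C m \<longleftrightarrow> is_monad C (mm_dom m) \<and> is_monad C (mm_cod m) \<and>
     mm_cell m \<in> hom1 C (mnd_ob (mm_dom m)) (mnd_ob (mm_cod m)) \<and>
     mm_tau m \<in> hom2 C (mnd_end (mm_cod m) \<cdot> mm_cell m) (mm_cell m \<cdot> mnd_end (mm_dom m)) \<and>
     mm_tau m \<bullet> (mnd_unit (mm_cod m) \<lhd> mm_cell m) = mm_cell m \<rhd> mnd_unit (mm_dom m) \<and>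
     mm_tau m \<bullet> (mnd_mult (mm_cod m) \<lhd> mm_cell m) =
       (mm_cell m \<rhd> mnd_mult (mm_dom m)) \<bullet> (mm_tau m \<lhd> mnd_end (mm_dom m)) \<bullet> (mnd_end (mm_cod m) \<rhd> mm_tau m)"
  by (cases m; cases "mm_dom m"; cases "mm_cod m") (simp add: is_monad_mor_def)

lemma is_monad_trans_iff:
  "is_monad_trans C t \<longleftrightarrow> is_monad_mor C (tr_dom t) \<and> is_monad_mor C (tr_cod t) \<and>
     mm_dom (tr_cod t) = mm_dom (tr_dom t) \<and> mm_cod (tr_cod t) = mm_cod (tr_dom t) \<and>
     tr_cell t \<in> hom2 C (mm_cell (tr_dom t)) (mm_cell (tr_cod t)) \<and>
     mm_tau (tr_cod t) \<bullet> (mnd_end (mm_cod (tr_dom t)) \<rhd> tr_cell t) =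
       (tr_cell t \<lhd> mnd_end (mm_dom (tr_dom t))) \<bullet> mm_tau (tr_dom t)"
  by (cases t; cases "tr_dom t"; cases "tr_cod t") (simp add: is_monad_trans_def)

lemma Mnd_simps [simp]:
  "Obj (Mnd C) = {M. is_monad C M}" "Cell1 (Mnd C) = {m. is_monad_mor C m}"
  "Cell2 (Mnd C) = {t. is_monad_trans C t}"
  "dom1 (Mnd C) = mm_dom" "cod1 (Mnd C) = mm_cod" "dom2 (Mnd C) = tr_dom" "cod2 (Mnd C) = tr_cod"
  "id1 (Mnd C) = (\<lambda>M. MonadMor M M (id1 C (mnd_ob M)) (id2 C (mnd_end M)))"
  "id2 (Mnd C) = (\<lambda>m. Trans m m (id2 C (mm_cell m)))"
  "comp1 (Mnd C) = monad_mor_comp C"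
  "vcomp (Mnd C) = (\<lambda>t s. Trans (tr_dom s) (tr_cod t) (tr_cell t \<bullet> tr_cell s))"
  "hcomp (Mnd C) = (\<lambda>t s. Trans (monad_mor_comp C (tr_dom t) (tr_dom s))
                           (monad_mor_comp C (tr_cod t) (tr_cod s)) (tr_cell t \<star> tr_cell s))"
  by (simp_all add: Mnd_def)

lemma monad_simps [simp]:
  assumes "is_monad C M"
  shows "mnd_ob M \<in> Obj C" "mnd_end M \<in> Cell1 C" "dom1 C (mnd_end M) = mnd_ob M"
    "cod1 C (mnd_end M) = mnd_ob M" "mnd_unit M \<in> Cell2 C" "dom2 C (mnd_unit M) = id1 C (mnd_ob M)"
    "cod2 C (mnd_unit M) = mnd_end M" "mnd_mult M \<in> Cell2 C"
    "dom2 C (mnd_mult M) = mnd_end M \<cdot> mnd_end M" "cod2 C (mnd_mult M) = mnd_end M"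
  using assms by (simp_all add: is_monad_iff)

lemma monad_mor_simps [simp]:
  assumes "is_monad_mor C m"
  shows "is_monad C (mm_dom m)" "is_monad C (mm_cod m)"
    "mm_cell m \<in> Cell1 C" "dom1 C (mm_cell m) = mnd_ob (mm_dom m)"
    "cod1 C (mm_cell m) = mnd_ob (mm_cod m)"
    "mm_tau m \<in> Cell2 C" "dom2 C (mm_tau m) = mnd_end (mm_cod m) \<cdot> mm_cell m"
    "cod2 C (mm_tau m) = mm_cell m \<cdot> mnd_end (mm_dom m)"
  using assms by (simp_all add: is_monad_mor_iff)

lemma monad_trans_simps [simp]:
  assumes "is_monad_trans C t"
  shows "is_monad_mor C (tr_dom t)" "is_monad_mor C (tr_cod t)"
    "mm_dom (tr_cod t) = mm_dom (tr_dom t)" "mm_cod (tr_cod t) = mm_cod (tr_dom t)"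
    "tr_cell t \<in> Cell2 C" "dom2 C (tr_cell t) = mm_cell (tr_dom t)"
    "cod2 C (tr_cell t) = mm_cell (tr_cod t)"
  using assms by (simp_all add: is_monad_trans_iff)

text \<open>The chain of \<open>conjI\<close> makes every conjunct a separate premise, so that
  \<open>intro\<close> leaves one goal for each typing condition and each law.\<close>

lemmas is_monadI = is_monad_iff[THEN iffD2, OF conjI, OF _ conjI, OF _ _ conjI, OF _ _ _ conjI,
    OF _ _ _ _ conjI, OF _ _ _ _ _ conjI]

lemmas is_monad_morI = is_monad_mor_iff[THEN iffD2, OF conjI, OF _ conjI, OF _ _ conjI,
    OF _ _ _ conjI, OF _ _ _ _ conjI]

lemmas is_monad_transI = is_monad_trans_iff[THEN iffD2, OF conjI, OF _ conjI, OF _ _ conjI,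
    OF _ _ _ conjI, OF _ _ _ _ conjI]

lemma monad_laws:
  assumes "is_monad C M"
  shows "mnd_mult M \<bullet> (mnd_unit M \<lhd> mnd_end M) = id2 C (mnd_end M)"
    "mnd_mult M \<bullet> (mnd_end M \<rhd> mnd_unit M) = id2 C (mnd_end M)"
    "mnd_mult M \<bullet> (mnd_mult M \<lhd> mnd_end M) = mnd_mult M \<bullet> (mnd_end M \<rhd> mnd_mult M)"
  using assms unfolding is_monad_iff by blast+

lemma monad_mor_laws:
  assumes "is_monad_mor C m"
  shows "mm_tau m \<bullet> (mnd_unit (mm_cod m) \<lhd> mm_cell m) = mm_cell m \<rhd> mnd_unit (mm_dom m)"
    "mm_tau m \<bullet> (mnd_mult (mm_cod m) \<lhd> mm_cell m) =
       (mm_cell m \<rhd> mnd_mult (mm_dom m)) \<bullet> (mm_tau m \<lhd> mnd_end (mm_dom m)) \<bullet> (mnd_end (mm_cod m) \<rhd> mm_tau m)"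
  using assms unfolding is_monad_mor_iff by blast+

lemma monad_trans_law:
  assumes "is_monad_trans C t"
  shows "mm_tau (tr_cod t) \<bullet> (mnd_end (mm_cod (tr_dom t)) \<rhd> tr_cell t) =
     (tr_cell t \<lhd> mnd_end (mm_dom (tr_dom t))) \<bullet> mm_tau (tr_dom t)"
  using assms unfolding is_monad_trans_iff by blast

lemma monad_mor_comp_simps [simp]:
  "mm_dom (monad_mor_comp C n m) = mm_dom m" "mm_cod (monad_mor_comp C n m) = mm_cod n"
  "mm_cell (monad_mor_comp C n m) = mm_cell n \<cdot> mm_cell m"
  "mm_tau (monad_mor_comp C n m) = (mm_cell n \<rhd> mm_tau m) \<bullet> (mm_tau n \<lhd> mm_cell m)"
  by (simp_all add: monad_mor_comp_def)

text \<open>Pasting: the laws of \<open>n\<close> whiskered by the 1-cell of \<open>m\<close>, then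
  the laws of \<open>m\<close> whiskered by the 1-cell of \<open>n\<close>. Only in the
  multiplication law do the two cells have to pass each other.\<close>

lemma is_monad_mor_comp:
  assumes "is_monad_mor C m" "is_monad_mor C n" "mm_dom n = mm_cod m"
  shows "is_monad_mor C (monad_mor_comp C n m)"
proof -
  note [simp] = assms
  let ?F = "mm_cell m" and ?G = "mm_cell n" and ?\<tau> = "mm_tau m" and ?\<rho> = "mm_tau n"
  let ?M = "mm_dom m" and ?M' = "mm_cod m" and ?M'' = "mm_cod n"
  have m: "?\<tau> \<bullet> (mnd_unit ?M' \<lhd> ?F) = ?F \<rhd> mnd_unit ?M"
    "?\<tau> \<bullet> (mnd_mult ?M' \<lhd> ?F) = (?F \<rhd> mnd_mult ?M) \<bullet> (?\<tau> \<lhd> mnd_end ?M) \<bullet> (mnd_end ?M' \<rhd> ?\<tau>)"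
    and n: "?\<rho> \<bullet> (mnd_unit ?M'' \<lhd> ?G) = ?G \<rhd> mnd_unit ?M'"
    "?\<rho> \<bullet> (mnd_mult ?M'' \<lhd> ?G) = (?G \<rhd> mnd_mult ?M') \<bullet> (?\<rho> \<lhd> mnd_end ?M') \<bullet> (mnd_end ?M'' \<rhd> ?\<rho>)"
    using monad_mor_laws[OF assms(1)] monad_mor_laws[OF assms(2)] by simp_all
  have "((?G \<rhd> ?\<tau>) \<bullet> (?\<rho> \<lhd> ?F)) \<bullet> (mnd_unit ?M'' \<lhd> (?G \<cdot> ?F))
      = (?G \<rhd> ?\<tau>) \<bullet> ((?\<rho> \<bullet> (mnd_unit ?M'' \<lhd> ?G)) \<lhd> ?F)"
    by simp
  also have "\<dots> = ?G \<rhd> (?\<tau> \<bullet> (mnd_unit ?M' \<lhd> ?F))"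
    by (subst n) simp
  also have "\<dots> = (?G \<cdot> ?F) \<rhd> mnd_unit ?M"
    by (subst m) simp
  finally have unit: "((?G \<rhd> ?\<tau>) \<bullet> (?\<rho> \<lhd> ?F)) \<bullet> (mnd_unit ?M'' \<lhd> (?G \<cdot> ?F)) = (?G \<cdot> ?F) \<rhd> mnd_unit ?M" .
  have "((?G \<rhd> ?\<tau>) \<bullet> (?\<rho> \<lhd> ?F)) \<bullet> (mnd_mult ?M'' \<lhd> (?G \<cdot> ?F))
      = (?G \<rhd> ?\<tau>) \<bullet> ((?\<rho> \<bullet> (mnd_mult ?M'' \<lhd> ?G)) \<lhd> ?F)"
    by simp
  also have "\<dots> = (?G \<rhd> (?\<tau> \<bullet> (mnd_mult ?M' \<lhd> ?F))) \<bullet> (?\<rho> \<lhd> (mnd_end ?M' \<cdot> ?F)) \<bullet> (mnd_end ?M'' \<rhd> (?\<rho> \<lhd> ?F))"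
    by (subst n) simp
  also have "\<dots> = (?G \<rhd> ?F \<rhd> mnd_mult ?M) \<bullet> (?G \<rhd> (?\<tau> \<lhd> mnd_end ?M)) \<bullet>
      (((?G \<cdot> mnd_end ?M') \<rhd> ?\<tau>) \<bullet> (?\<rho> \<lhd> (mnd_end ?M' \<cdot> ?F))) \<bullet> (mnd_end ?M'' \<rhd> (?\<rho> \<lhd> ?F))"
    by (subst m) simp
  \<comment> \<open>Exchanging \<tau> and \<rho> groups the four cells into two copies of the
    composite cell, whiskered by the endomorphisms of the two outer monads.\<close>
  also have "((?G \<cdot> mnd_end ?M') \<rhd> ?\<tau>) \<bullet> (?\<rho> \<lhd> (mnd_end ?M' \<cdot> ?F))
      = (?\<rho> \<lhd> (?F \<cdot> mnd_end ?M)) \<bullet> ((mnd_end ?M'' \<cdot> ?G) \<rhd> ?\<tau>)"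
    by (rule whisker_swap[symmetric]) simp_all
  finally have "((?G \<rhd> ?\<tau>) \<bullet> (?\<rho> \<lhd> ?F)) \<bullet> (mnd_mult ?M'' \<lhd> (?G \<cdot> ?F)) =
      ((?G \<cdot> ?F) \<rhd> mnd_mult ?M) \<bullet> (((?G \<rhd> ?\<tau>) \<bullet> (?\<rho> \<lhd> ?F)) \<lhd> mnd_end ?M)
        \<bullet> (mnd_end ?M'' \<rhd> ((?G \<rhd> ?\<tau>) \<bullet> (?\<rho> \<lhd> ?F)))"
    by simp
  with unit show ?thesis by (intro is_monad_morI) simp_all
qed

lemma is_monad_trans_vcomp:
  assumes "is_monad_trans C s" "is_monad_trans C t" "tr_dom t = tr_cod s"
  shows "is_monad_trans C (Trans (tr_dom s) (tr_cod t) (tr_cell t \<bullet> tr_cell s))"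
proof -
  note [simp] = assms
  let ?M = "mm_dom (tr_dom s)" and ?N = "mm_cod (tr_dom s)"
  have s: "mm_tau (tr_cod s) \<bullet> (mnd_end ?N \<rhd> tr_cell s) = (tr_cell s \<lhd> mnd_end ?M) \<bullet> mm_tau (tr_dom s)"
    and t: "mm_tau (tr_cod t) \<bullet> (mnd_end ?N \<rhd> tr_cell t) = (tr_cell t \<lhd> mnd_end ?M) \<bullet> mm_tau (tr_cod s)"
    using monad_trans_law[OF assms(1)] monad_trans_law[OF assms(2)] by simp_all
  show ?thesis
    by (intro is_monad_transI) (simp_all add: vcomp_reassoc[OF t] s)
qed

text \<open>An interchange square for \<open>mm_tau m\<close>, pasted with the square of
  \<open>s\<close> under the 1-cell of \<open>m\<close>. For whiskering on the other side the two
  are used in the opposite order.\<close>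

lemma is_monad_trans_post_whisker:
  assumes "is_monad_trans C s" "is_monad_mor C m" "mm_dom m = mm_cod (tr_dom s)"
  shows "is_monad_trans C (Trans (monad_mor_comp C m (tr_dom s)) (monad_mor_comp C m (tr_cod s))
    (mm_cell m \<rhd> tr_cell s))"
proof -
  note [simp] = assms
  let ?M = "mm_dom (tr_dom s)" and ?N = "mm_cod (tr_dom s)" and ?G = "mm_cell m" and ?\<theta> = "mm_tau m"
  have s: "mm_tau (tr_cod s) \<bullet> (mnd_end ?N \<rhd> tr_cell s) = (tr_cell s \<lhd> mnd_end ?M) \<bullet> mm_tau (tr_dom s)"
    using monad_trans_law[OF assms(1)] by simp
  have "((?G \<rhd> mm_tau (tr_cod s)) \<bullet> (?\<theta> \<lhd> mm_cell (tr_cod s))) \<bullet> (mnd_end (mm_cod m) \<rhd> ?G \<rhd> tr_cell s)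
    = (?G \<rhd> mm_tau (tr_cod s)) \<bullet> ((?\<theta> \<lhd> mm_cell (tr_cod s)) \<bullet> ((mnd_end (mm_cod m) \<cdot> ?G) \<rhd> tr_cell s))"
    by simp
  also have "(?\<theta> \<lhd> mm_cell (tr_cod s)) \<bullet> ((mnd_end (mm_cod m) \<cdot> ?G) \<rhd> tr_cell s)
    = ((?G \<cdot> mnd_end ?N) \<rhd> tr_cell s) \<bullet> (?\<theta> \<lhd> mm_cell (tr_dom s))"
    by (rule whisker_swap) simp_all
  also have "(?G \<rhd> mm_tau (tr_cod s)) \<bullet> \<dots> = (?G \<rhd> (mm_tau (tr_cod s) \<bullet> (mnd_end ?N \<rhd> tr_cell s))) \<bullet> (?\<theta> \<lhd> mm_cell (tr_dom s))"
    by simp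
  also have "\<dots> = (?G \<rhd> (tr_cell s \<lhd> mnd_end ?M)) \<bullet> (?G \<rhd> mm_tau (tr_dom s)) \<bullet> (?\<theta> \<lhd> mm_cell (tr_dom s))"
    by (subst s) simp
  finally show ?thesis
    by (intro is_monad_transI) (simp_all add: is_monad_mor_comp)
qed

lemma is_monad_trans_pre_whisker:
  assumes "is_monad_trans C s" "is_monad_mor C m" "mm_dom (tr_dom s) = mm_cod m"
  shows "is_monad_trans C (Trans (monad_mor_comp C (tr_dom s) m) (monad_mor_comp C (tr_cod s) m)
    (tr_cell s \<lhd> mm_cell m))"
proof -
  note [simp] = assms
  let ?M = "mm_cod m" and ?N = "mm_cod (tr_dom s)" and ?H = "mm_cell m" and ?\<theta> = "mm_tau m"
  have s: "mm_tau (tr_cod s) \<bullet> (mnd_end ?N \<rhd> tr_cell s) = (tr_cell s \<lhd> mnd_end ?M) \<bullet> mm_tau (tr_dom s)"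
    using monad_trans_law[OF assms(1)] by simp
  have "((mm_cell (tr_cod s) \<rhd> ?\<theta>) \<bullet> (mm_tau (tr_cod s) \<lhd> ?H)) \<bullet> (mnd_end ?N \<rhd> (tr_cell s \<lhd> ?H))
    = (mm_cell (tr_cod s) \<rhd> ?\<theta>) \<bullet> ((mm_tau (tr_cod s) \<bullet> (mnd_end ?N \<rhd> tr_cell s)) \<lhd> ?H)"
    by simp
  also have "\<dots> = ((mm_cell (tr_cod s) \<rhd> ?\<theta>) \<bullet> (tr_cell s \<lhd> (mnd_end ?M \<cdot> ?H))) \<bullet> (mm_tau (tr_dom s) \<lhd> ?H)"
    by (subst s) simp
  also have "(mm_cell (tr_cod s) \<rhd> ?\<theta>) \<bullet> (tr_cell s \<lhd> (mnd_end ?M \<cdot> ?H))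
    = (tr_cell s \<lhd> (?H \<cdot> mnd_end (mm_dom m))) \<bullet> (mm_cell (tr_dom s) \<rhd> ?\<theta>)"
    by (rule whisker_swap[symmetric]) simp_all
  finally show ?thesis
    by (intro is_monad_transI) (simp_all add: is_monad_mor_comp)
qed

lemma is_monad_mor_id:
  "is_monad C M \<Longrightarrow> is_monad_mor C (MonadMor M M (id1 C (mnd_ob M)) (id2 C (mnd_end M)))"
  by (intro is_monad_morI) simp_all

lemma is_monad_trans_id: "is_monad_mor C m \<Longrightarrow> is_monad_trans C (Trans m m (id2 C (mm_cell m)))"
  by (intro is_monad_transI) simp_all

lemma structured_two_category_Mnd: "structured_two_category C (Mnd C) mnd_ob mm_cell"
  by unfold_locales
    (auto simp: is_monad_mor_comp is_monad_mor_id is_monad_trans_vcomp is_monad_trans_post_whisker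
      is_monad_trans_pre_whisker is_monad_trans_id intro!: monad_mor.expand)

lemma two_category_Mnd: "two_category (Mnd C)"
  by (rule structured_two_category.lifted_two_category[OF structured_two_category_Mnd])

lemma is_monad_identity: "A \<in> Obj C \<Longrightarrow> is_monad C (identity_monad C A)"
  by (intro is_monadI) (simp_all add: identity_monad_def)

lemma identity_monad_simps [simp]:
  "mnd_ob (identity_monad C A) = A" "mnd_end (identity_monad C A) = id1 C A"
  "mnd_unit (identity_monad C A) = id2 C (id1 C A)" "mnd_mult (identity_monad C A) = id2 C (id1 C A)"
  by (simp_all add: identity_monad_def)

lemma identity_monad_mor_simps [simp]:
  "mm_dom (identity_monad_mor C f) = identity_monad C (dom1 C f)"
  "mm_cod (identity_monad_mor C f) = identity_monad C (cod1 C f)"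
  "mm_cell (identity_monad_mor C f) = f" "mm_tau (identity_monad_mor C f) = id2 C f"
  by (simp_all add: identity_monad_mor_def)

lemma is_monad_mor_identity: "f \<in> Cell1 C \<Longrightarrow> is_monad_mor C (identity_monad_mor C f)"
  by (intro is_monad_morI) (simp_all add: is_monad_identity)

lemma is_monad_trans_identity:
  "\<sigma> \<in> Cell2 C \<Longrightarrow>
    is_monad_trans C (Trans (identity_monad_mor C (dom2 C \<sigma>)) (identity_monad_mor C (cod2 C \<sigma>)) \<sigma>)"
  by (intro is_monad_transI) (simp_all add: is_monad_mor_identity)

lemma iota_simps [simp]:
  "on0 (iota C) = identity_monad C" "on1 (iota C) = identity_monad_mor C"
  "on2 (iota C) = (\<lambda>\<sigma>. Trans (identity_monad_mor C (dom2 C \<sigma>)) (identity_monad_mor C (cod2 C \<sigma>)) \<sigma>)"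
  by (simp_all add: iota_def)

lemma two_functor_iota: "two_functor C (Mnd C) (iota C)"
proof -
  interpret Mnd: two_category "Mnd C" by (rule two_category_Mnd)
  show ?thesis
    by unfold_locales
      (auto simp: is_monad_identity is_monad_mor_identity is_monad_trans_identity hcomp_simps
        intro!: monad_mor.expand)
qed

end

section \<open>The action of a 2-functor on monads\<close>

context two_functor
begin

lemma Mnd_map_simps [simp]:
  "on0 (Mnd_map F) = Mnd_map0 F" "on1 (Mnd_map F) = Mnd_map1 F"
  "on2 (Mnd_map F) = (\<lambda>t. Trans (Mnd_map1 F (tr_dom t)) (Mnd_map1 F (tr_cod t)) (on2 F (tr_cell t)))"
  "mnd_ob (Mnd_map0 F M) = on0 F (mnd_ob M)" "mnd_end (Mnd_map0 F M) = on1 F (mnd_end M)"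
  "mnd_unit (Mnd_map0 F M) = on2 F (mnd_unit M)" "mnd_mult (Mnd_map0 F M) = on2 F (mnd_mult M)"
  "mm_dom (Mnd_map1 F m) = Mnd_map0 F (mm_dom m)" "mm_cod (Mnd_map1 F m) = Mnd_map0 F (mm_cod m)"
  "mm_cell (Mnd_map1 F m) = on1 F (mm_cell m)" "mm_tau (Mnd_map1 F m) = on2 F (mm_tau m)"
  by (simp_all add: Mnd_map_def Mnd_map0_def Mnd_map1_def)

text \<open>The laws are transported by applying \<open>on2 F\<close> to both sides; simp then
  distributes it over the composites.\<close>

lemma is_monad_map: 
  assumes "is_monad C M"
  shows "is_monad D (Mnd_map0 F M)"
proof -
  have "on2 F (mnd_mult M \<bullet>\<^bsub>C\<^esub> (mnd_unit M \<lhd>\<^bsub>C\<^esub> mnd_end M)) = on2 F (id2 C (mnd_end M))"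
    "on2 F (mnd_mult M \<bullet>\<^bsub>C\<^esub> (mnd_end M \<rhd>\<^bsub>C\<^esub> mnd_unit M)) = on2 F (id2 C (mnd_end M))"
    "on2 F (mnd_mult M \<bullet>\<^bsub>C\<^esub> (mnd_mult M \<lhd>\<^bsub>C\<^esub> mnd_end M)) =
     on2 F (mnd_mult M \<bullet>\<^bsub>C\<^esub> (mnd_end M \<rhd>\<^bsub>C\<^esub> mnd_mult M))"
    using source.monad_laws[OF assms] by simp_all
  with assms show ?thesis by (intro target.is_monadI) simp_all
qed

lemma is_monad_mor_map:
  assumes "is_monad_mor C m"
  shows "is_monad_mor D (Mnd_map1 F m)"
proof -
  have "on2 F (mm_tau m \<bullet>\<^bsub>C\<^esub> (mnd_unit (mm_cod m) \<lhd>\<^bsub>C\<^esub> mm_cell m)) =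
     on2 F (mm_cell m \<rhd>\<^bsub>C\<^esub> mnd_unit (mm_dom m))"
    "on2 F (mm_tau m \<bullet>\<^bsub>C\<^esub> (mnd_mult (mm_cod m) \<lhd>\<^bsub>C\<^esub> mm_cell m)) =
     on2 F ((mm_cell m \<rhd>\<^bsub>C\<^esub> mnd_mult (mm_dom m)) \<bullet>\<^bsub>C\<^esub> (mm_tau m \<lhd>\<^bsub>C\<^esub> mnd_end (mm_dom m))
       \<bullet>\<^bsub>C\<^esub> (mnd_end (mm_cod m) \<rhd>\<^bsub>C\<^esub> mm_tau m))"
    using source.monad_mor_laws[OF assms] by simp_all
  with assms show ?thesis by (intro target.is_monad_morI) (simp_all add: is_monad_map)
qed

lemma is_monad_trans_map:
  assumes "is_monad_trans C t"
  shows "is_monad_trans D (on2 (Mnd_map F) t)"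
proof -
  have "on2 F (mm_tau (tr_cod t) \<bullet>\<^bsub>C\<^esub> (mnd_end (mm_cod (tr_dom t)) \<rhd>\<^bsub>C\<^esub> tr_cell t)) =
       on2 F ((tr_cell t \<lhd>\<^bsub>C\<^esub> mnd_end (mm_dom (tr_dom t))) \<bullet>\<^bsub>C\<^esub> mm_tau (tr_dom t))"
    using source.monad_trans_law[OF assms] by simp
  with assms show ?thesis by (intro target.is_monad_transI) (simp_all add: is_monad_mor_map)
qed

lemma two_functor_Mnd_map: "two_functor (Mnd C) (Mnd D) (Mnd_map F)"
proof -
  interpret MC: two_category "Mnd C" by (rule source.two_category_Mnd)
  interpret MD: two_category "Mnd D" by (rule target.two_category_Mnd)
  show ?thesis
    using is_monad_trans_map
    by unfold_locales
      (auto simp: is_monad_map is_monad_mor_map on2_hcomp' intro!: monad_mor.expand)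
qed

text \<open>The compatibility of \<open>Mnd_map F\<close> with \<open>iota\<close> whose mate is the
  canonical comparison of EM objects.\<close>

lemma Mnd_map_iota:
  "A \<in> Obj C \<Longrightarrow> Mnd_map0 F (identity_monad C A) = identity_monad D (on0 F A)"
  "f \<in> Cell1 C \<Longrightarrow> Mnd_map1 F (identity_monad_mor C f) = identity_monad_mor D (on1 F f)"
  by (auto intro!: monad.expand monad_mor.expand)

end

section \<open>Universal arrows\<close>

text \<open>The value of a right 2-adjoint of \<open>L\<close> at the single object
  \<open>B\<close>: composition with \<open>e\<close> is an isomorphism from the hom-category of
  1-cells \<open>A\<close> to \<open>R\<close> onto that of 1-cells \<open>on0 L A\<close> to
  \<open>B\<close>.\<close>

locale universal_arrow = two_functor C D L
  for C :: "('o, 'f, 'c) twocat" and D :: "('p, 'g, 'd) twocat" (structure)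
    and L :: "('o, 'f, 'c, 'p, 'g, 'd) twofun" +
  fixes B :: 'p and R :: 'o and e :: 'g
  assumes R_Obj [simp]: "R \<in> Obj C"
    and e_hom: "e \<in> hom1 D (on0 L R) B"
    and ex1_factor: "\<lbrakk>A \<in> Obj C; f \<in> hom1 D (on0 L A) B\<rbrakk>
      \<Longrightarrow> \<exists>!g. g \<in> hom1 C A R \<and> e \<cdot> on1 L g = f"
    and ex1_factor2: "\<lbrakk>g \<in> hom1 C A R; h \<in> hom1 C A R; \<sigma> \<in> hom2 D (e \<cdot> on1 L g) (e \<cdot> on1 L h)\<rbrakk>
      \<Longrightarrow> \<exists>!\<rho>. \<rho> \<in> hom2 C g h \<and> e \<rhd> on2 L \<rho> = \<sigma>"
begin

lemma e_simps [simp]: "e \<in> Cell1 D" "dom1 D e = on0 L R" "cod1 D e = B"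
  using e_hom by simp_all

definition factor :: "'g \<Rightarrow> 'o \<Rightarrow> 'f" where
  "factor f A = (THE g. g \<in> hom1 C A R \<and> e \<cdot> on1 L g = f)"

lemma factor_simps [simp]:
  assumes "f \<in> Cell1 D" "dom1 D f = on0 L A" "cod1 D f = B" "A \<in> Obj C"
  shows "factor f A \<in> Cell1 C" "dom1 C (factor f A) = A" "cod1 C (factor f A) = R"
    "e \<cdot> on1 L (factor f A) = f"
  using theI'[OF ex1_factor[of A f]] assms by (simp_all add: factor_def)

lemma factor_eqI:
  assumes "e \<cdot> on1 L g = e \<cdot> on1 L h" "g \<in> Cell1 C" "h \<in> Cell1 C"
    "dom1 C g = dom1 C h" "cod1 C g = R" "cod1 C h = R"
  shows "g = h"
  using ex1_factor[of "dom1 C h" "e \<cdot> on1 L h"] assms by auto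

definition factor2 :: "'d \<Rightarrow> 'f \<Rightarrow> 'f \<Rightarrow> 'c" where
  "factor2 \<sigma> g h = (THE \<rho>. \<rho> \<in> hom2 C g h \<and> e \<rhd> on2 L \<rho> = \<sigma>)"

lemma factor2_simps [simp]:
  assumes "\<sigma> \<in> Cell2 D" "g \<in> Cell1 C" "h \<in> Cell1 C"  "dom1 C g = dom1 C h" "cod1 C g = R" "cod1 C h = R"
    "dom2 D \<sigma> = e \<cdot> on1 L g" "cod2 D \<sigma> = e \<cdot> on1 L h"
  shows "factor2 \<sigma> g h \<in> Cell2 C" "dom2 C (factor2 \<sigma> g h) = g" "cod2 C (factor2 \<sigma> g h) = h"
    "e \<rhd> on2 L (factor2 \<sigma> g h) = \<sigma>"
  using theI'[OF ex1_factor2[of g "dom1 C h" h \<sigma>]] assms by (simp_all add: factor2_def)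

lemma factor2_eqI:
  assumes "e \<rhd> on2 L \<rho> = e \<rhd> on2 L \<rho>'" "\<rho> \<in> Cell2 C" "\<rho>' \<in> Cell2 C"
    "dom2 C \<rho> = dom2 C \<rho>'" "cod2 C \<rho> = cod2 C \<rho>'" "cod1 C (dom2 C \<rho>') = R"
  shows "\<rho> = \<rho>'"
  using ex1_factor2[of "dom2 C \<rho>'" "dom1 C (dom2 C \<rho>')" "cod2 C \<rho>'" "e \<rhd> on2 L \<rho>'"] assms
  by auto

text \<open>Composition with \<open>k\<close> is bijective on 1-cells into \<open>R'\<close> and, by
  whiskering, on the 2-cells between them.\<close>

lemma comp_iso:
  assumes k: "k \<in> hom1 C R' R" "k' \<in> hom1 C R R'" "k \<cdot>\<^bsub>C\<^esub> k' = id1 C R" "k' \<cdot>\<^bsub>C\<^esub> k = id1 C R'"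
  shows "universal_arrow C D L B R' (e \<cdot> on1 L k)"
proof -
  have [simp]: "R' \<in> Obj C" "k \<in> Cell1 C" "dom1 C k = R'" "cod1 C k = R"
    "k' \<in> Cell1 C" "dom1 C k' = R" "cod1 C k' = R'"
    using k source.dom1_Obj[of k] by auto
  have cancel: "k \<cdot>\<^bsub>C\<^esub> (k' \<cdot>\<^bsub>C\<^esub> g) = g" if "g \<in> Cell1 C" "cod1 C g = R" for g
    using source.comp1_assoc'[of g k' k] that k by simp
  have cancel': "k' \<cdot>\<^bsub>C\<^esub> (k \<cdot>\<^bsub>C\<^esub> g) = g" if "g \<in> Cell1 C" "cod1 C g = R'" for g
    using source.comp1_assoc'[of g k k'] that k by simp
  have wcancel: "k \<rhd>\<^bsub>C\<^esub> (k' \<rhd>\<^bsub>C\<^esub> \<rho>) = \<rho>" if "\<rho> \<in> Cell2 C" "cod1 C (dom2 C \<rho>) = R" for \<rho>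
    using source.post_whisker_comp1[of k' k \<rho>] that k by simp
  have wcancel': "k' \<rhd>\<^bsub>C\<^esub> (k \<rhd>\<^bsub>C\<^esub> \<rho>) = \<rho>" if "\<rho> \<in> Cell2 C" "cod1 C (dom2 C \<rho>) = R'" for \<rho>
    using source.post_whisker_comp1[of k k' \<rho>] that k by simp
  show ?thesis
  proof
    show "R' \<in> Obj C" "e \<cdot> on1 L k \<in> hom1 D (on0 L R') B" by simp_all
    fix A f
    assume A: "A \<in> Obj C" "f \<in> hom1 D (on0 L A) B"
    show "\<exists>!g. g \<in> hom1 C A R' \<and> (e \<cdot> on1 L k) \<cdot> on1 L g = f"
    proof (rule ex1I)
      have "e \<cdot> on1 L (k \<cdot>\<^bsub>C\<^esub> (k' \<cdot>\<^bsub>C\<^esub> factor f A)) = f" using A by (subst cancel) auto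
      then show "k' \<cdot>\<^bsub>C\<^esub> factor f A \<in> hom1 C A R' \<and> (e \<cdot> on1 L k) \<cdot> on1 L (k' \<cdot>\<^bsub>C\<^esub> factor f A) = f"
        using A by simp
      fix g
      assume g: "g \<in> hom1 C A R' \<and> (e \<cdot> on1 L k) \<cdot> on1 L g = f"
      have "k \<cdot>\<^bsub>C\<^esub> g = factor f A"
        by (rule factor_eqI) (use A g in auto)
      then show "g = k' \<cdot>\<^bsub>C\<^esub> factor f A" using cancel'[of g] g by auto
    qed
  next
    fix A g h \<sigma>
    assume g: "g \<in> hom1 C A R'" "h \<in> hom1 C A R'"
      and s: "\<sigma> \<in> hom2 D ((e \<cdot> on1 L k) \<cdot> on1 L g) ((e \<cdot> on1 L k) \<cdot> on1 L h)"
    show "\<exists>!\<rho>. \<rho> \<in> hom2 C g h \<and> (e \<cdot> on1 L k) \<rhd> on2 L \<rho> = \<sigma>"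
    proof (rule ex1I)
      let ?r = "factor2 \<sigma> (k \<cdot>\<^bsub>C\<^esub> g) (k \<cdot>\<^bsub>C\<^esub> h)"
      have r: "?r \<in> Cell2 C" "dom2 C ?r = k \<cdot>\<^bsub>C\<^esub> g" "cod2 C ?r = k \<cdot>\<^bsub>C\<^esub> h" "e \<rhd> on2 L ?r = \<sigma>"
        by (rule factor2_simps; use g s in simp)+
      have "e \<rhd> on2 L (k \<rhd>\<^bsub>C\<^esub> k' \<rhd>\<^bsub>C\<^esub> ?r) = \<sigma>" using r g by (subst wcancel) auto
      then show "k' \<rhd>\<^bsub>C\<^esub> ?r \<in> hom2 C g h \<and> (e \<cdot> on1 L k) \<rhd> on2 L (k' \<rhd>\<^bsub>C\<^esub> ?r) = \<sigma>"
        using r g by (simp add: cancel')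
      fix \<rho>
      assume \<rho>: "\<rho> \<in> hom2 C g h \<and> (e \<cdot> on1 L k) \<rhd> on2 L \<rho> = \<sigma>"
      have "k \<rhd>\<^bsub>C\<^esub> \<rho> = ?r"
        by (rule factor2_eqI) (use r g \<rho> in auto)
      then show "\<rho> = k' \<rhd>\<^bsub>C\<^esub> ?r" using wcancel'[of \<rho>] \<rho> g by auto
    qed
  qed
qed

text \<open>Each arrow factors through the other; the two composites are identities because they
  leave the respective arrow unchanged.\<close>

lemma unique_up_to_iso:
  assumes "universal_arrow C D L B R' e'"
  obtains k k' where "k \<in> hom1 C R' R" "k' \<in> hom1 C R R'" "k \<cdot>\<^bsub>C\<^esub> k' = id1 C R" "k' \<cdot>\<^bsub>C\<^esub> k = id1 C R'"
    "e \<cdot> on1 L k = e'"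
proof -
  interpret U: universal_arrow C D L B R' e' by fact
  let ?k = "factor e' R'" and ?k' = "U.factor e R"
  have 1: "?k \<cdot>\<^bsub>C\<^esub> ?k' = id1 C R"
    using target.comp1_assoc'[of "on1 L ?k'" "on1 L ?k" e] by (intro factor_eqI) simp_all
  have 2: "?k' \<cdot>\<^bsub>C\<^esub> ?k = id1 C R'"
    using target.comp1_assoc'[of "on1 L ?k" "on1 L ?k'" e'] by (intro U.factor_eqI) simp_all
  from that[of ?k ?k'] 1 2 show thesis by simp
qed

end

section \<open>Universal arrows and 2-adjunctions\<close>

lemma twofun_simps [simp]:
  "on0 (twofun_comp G F) A = on0 G (on0 F A)" "on1 (twofun_comp G F) f = on1 G (on1 F f)"
  "on2 (twofun_comp G F) \<sigma> = on2 G (on2 F \<sigma>)"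
  "on0 twofun_id A = A" "on1 twofun_id f = f" "on2 twofun_id \<sigma> = \<sigma>"
  by (simp_all add: twofun_comp_def twofun_id_def)

lemma two_functor_comp:
  assumes "two_functor B C F" "two_functor C D G"
  shows "two_functor B D (twofun_comp G F)"
proof -
  interpret F: two_functor B C F by fact
  interpret G: two_functor C D G by fact
  show ?thesis by unfold_locales (auto simp: F.on2_hcomp' G.on2_hcomp')
qed

lemma two_functor_id: "two_category C \<Longrightarrow> two_functor C C twofun_id"
  by (simp add: two_functor_def two_functor_axioms_def)

context two_natural
begin

lemma component_simps [simp]:
  assumes "A \<in> Obj C"
  shows "\<theta> A \<in> Cell1 D" "dom1 D (\<theta> A) = on0 F A" "cod1 D (\<theta> A) = on0 G A"
  using component_hom[OF assms] by simp_all

lemma natural1': "f \<in> Cell1 C \<Longrightarrow> \<theta> (cod1 C f) \<cdot>\<^bsub>D\<^esub> on1 F f = on1 G f \<cdot>\<^bsub>D\<^esub> \<theta> (dom1 C f)"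
  by (rule natural1) simp

lemma natural2':
  "\<sigma> \<in> Cell2 C \<Longrightarrow> \<theta> (cod1 C (dom2 C \<sigma>)) \<rhd>\<^bsub>D\<^esub> on2 F \<sigma> = on2 G \<sigma> \<lhd>\<^bsub>D\<^esub> \<theta> (dom1 C (dom2 C \<sigma>))"
  by (rule natural2) simp_all

end

text \<open>The factorization of \<open>f\<close> is its transpose
  \<open>on1 R f \<cdot> u A\<close>. That it factors \<open>f\<close> rests on naturality of the
  counit and \<open>triangle_L\<close>; uniqueness rests on naturality of the unit and
  \<open>triangle_R\<close>. The same formulas serve for 2-cells.\<close>

lemma (in two_adjunction) universal_arrow_counit:
  assumes B: "B \<in> Obj D"
  shows "universal_arrow C D L B (on0 R B) (e B)"
proof
  note [simp] = B
  have e: "e B \<in> Cell1 D" "dom1 D (e B) = on0 L (on0 R B)" "cod1 D (e B) = B"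
    using counit.component_simps[OF B] by simp_all
  have u: "u A \<in> Cell1 C" "dom1 C (u A) = A" "cod1 C (u A) = on0 R (on0 L A)" if "A \<in> Obj C" for A
    using unit.component_simps[OF that] by simp_all
  note [simp] = e u
  \<comment> \<open>Transposing back recovers \<open>g\<close>, so \<open>g\<close> is determined by
    its composite with the counit.\<close>
  have uniq1: "on1 R (e B \<cdot>\<^bsub>D\<^esub> on1 L g) \<cdot>\<^bsub>C\<^esub> u (dom1 C g) = g"
    if "g \<in> Cell1 C" "cod1 C g = on0 R B" for g
  proof -
    have "on1 R (e B \<cdot>\<^bsub>D\<^esub> on1 L g) \<cdot>\<^bsub>C\<^esub> u (dom1 C g) = on1 R (e B) \<cdot>\<^bsub>C\<^esub> (u (cod1 C g) \<cdot>\<^bsub>C\<^esub> g)"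
      using that unit.natural1'[of g] by simp
    also have "\<dots> = (on1 R (e B) \<cdot>\<^bsub>C\<^esub> u (on0 R B)) \<cdot>\<^bsub>C\<^esub> g" using that by simp
    also have "\<dots> = g" using that by (subst triangle_R) simp_all
    finally show ?thesis .
  qed
  have uniq2: "on2 R (e B \<rhd>\<^bsub>D\<^esub> on2 L \<rho>) \<lhd>\<^bsub>C\<^esub> u (dom1 C (dom2 C \<rho>)) = \<rho>"
    if "\<rho> \<in> Cell2 C" "cod1 C (dom2 C \<rho>) = on0 R B" for \<rho>
  proof -
    have "on2 R (e B \<rhd>\<^bsub>D\<^esub> on2 L \<rho>) \<lhd>\<^bsub>C\<^esub> u (dom1 C (dom2 C \<rho>)) = on1 R (e B) \<rhd>\<^bsub>C\<^esub> (u (cod1 C (dom2 C \<rho>)) \<rhd>\<^bsub>C\<^esub> \<rho>)"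
      using that unit.natural2'[of \<rho>] by simp
    also have "\<dots> = (on1 R (e B) \<cdot>\<^bsub>C\<^esub> u (on0 R B)) \<rhd>\<^bsub>C\<^esub> \<rho>" using that by simp
    also have "\<dots> = \<rho>" using that by (subst triangle_R) simp_all
    finally show ?thesis .
  qed
  show "on0 R B \<in> Obj C" "e B \<in> hom1 D (on0 L (on0 R B)) B" by simp_all
  {
    fix A f
    assume A: "A \<in> Obj C" "f \<in> hom1 D (on0 L A) B"
    show "\<exists>!g. g \<in> hom1 C A (on0 R B) \<and> e B \<cdot>\<^bsub>D\<^esub> on1 L g = f"
    proof (rule ex1I)
      have "e B \<cdot>\<^bsub>D\<^esub> on1 L (on1 R f \<cdot>\<^bsub>C\<^esub> u A) = (e B \<cdot>\<^bsub>D\<^esub> on1 L (on1 R f)) \<cdot>\<^bsub>D\<^esub> on1 L (u A)"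
        using A by simp
      also have "\<dots> = f \<cdot>\<^bsub>D\<^esub> (e (on0 L A) \<cdot>\<^bsub>D\<^esub> on1 L (u A))"
        using A counit.natural1'[of f] counit.component_simps[of "on0 L A"] by simp
      also have "\<dots> = f" using A by (simp add: triangle_L)
      finally show "on1 R f \<cdot>\<^bsub>C\<^esub> u A \<in> hom1 C A (on0 R B) \<and> e B \<cdot>\<^bsub>D\<^esub> on1 L (on1 R f \<cdot>\<^bsub>C\<^esub> u A) = f"
        using A by simp
    qed (use uniq1 in auto)
  }
  fix A g h \<sigma>
  assume g: "g \<in> hom1 C A (on0 R B)" "h \<in> hom1 C A (on0 R B)"
    and s: "\<sigma> \<in> hom2 D (e B \<cdot>\<^bsub>D\<^esub> on1 L g) (e B \<cdot>\<^bsub>D\<^esub> on1 L h)"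
  show "\<exists>!\<rho>. \<rho> \<in> hom2 C g h \<and> e B \<rhd>\<^bsub>D\<^esub> on2 L \<rho> = \<sigma>"
  proof (rule ex1I)
    have A: "A \<in> Obj C" "dom1 C g = A" "dom1 C h = A" "cod1 C g = on0 R B" "cod1 C h = on0 R B" 
      "g \<in> Cell1 C" "h \<in> Cell1 C" "\<sigma> \<in> Cell2 D" "dom2 D \<sigma> = e B \<cdot>\<^bsub>D\<^esub> on1 L g"
      "cod2 D \<sigma> = e B \<cdot>\<^bsub>D\<^esub> on1 L h" using g s by auto
    \<comment> \<open>The transpose of \<sigma> has transposes of 1-cells as its boundary;
      \<open>uniq1\<close> identifies them with \<open>g\<close> and \<open>h\<close>.\<close>
    have t: "on1 R (e B) \<cdot>\<^bsub>C\<^esub> (on1 R (on1 L g) \<cdot>\<^bsub>C\<^esub> u A) = g"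
      "on1 R (e B) \<cdot>\<^bsub>C\<^esub> (on1 R (on1 L h) \<cdot>\<^bsub>C\<^esub> u A) = h"
      using uniq1[of g] uniq1[of h] A by simp_all
    have "e B \<rhd>\<^bsub>D\<^esub> on2 L (on2 R \<sigma> \<lhd>\<^bsub>C\<^esub> u A) = (e B \<rhd>\<^bsub>D\<^esub> on2 L (on2 R \<sigma>)) \<lhd>\<^bsub>D\<^esub> on1 L (u A)"
      using A by simp
    also have "\<dots> = \<sigma> \<lhd>\<^bsub>D\<^esub> (e (on0 L A) \<cdot>\<^bsub>D\<^esub> on1 L (u A))"
      using A counit.natural2'[of \<sigma>] counit.component_simps[of "on0 L A"] by simp
    also have "\<dots> = \<sigma>" using A by (simp add: triangle_L)
    finally show "on2 R \<sigma> \<lhd>\<^bsub>C\<^esub> u A \<in> hom2 C g h \<and> e B \<rhd>\<^bsub>D\<^esub> on2 L (on2 R \<sigma> \<lhd>\<^bsub>C\<^esub> u A) = \<sigma>"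
      using A by (simp add: t)
  qed (use uniq2 g in auto)
qed

text \<open>The given arrows \<open>e\<close> themselves become the counit. Equations between
  factored cells are verified after composition with \<open>e\<close>, which reflects equality by
  \<open>eqI1\<close> and \<open>eqI2\<close>.\<close>

lemma two_adjunction_if_universal_arrows:
  fixes C :: "('o, 'f, 'c) twocat" and D :: "('p, 'g, 'd) twocat" (structure)
  assumes L: "two_functor C D L"
    and univ: "\<And>B. B \<in> Obj D \<Longrightarrow> universal_arrow C D L B (R0 B) (e B)"
  shows "\<exists>R u. two_adjunction C D L R u e"
proof -
  interpret L: two_functor C D L by fact
  \<comment> \<open>\<open>R1 f\<close> and \<open>R2 \<sigma>\<close> are forced by naturality of
    \<open>e\<close>, and \<open>u A\<close> is forced by the first triangle identity.\<close>
  define R1 where "R1 f = universal_arrow.factor C D L (R0 (cod1 D f)) (e (cod1 D f))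
    (f \<cdot> e (dom1 D f)) (R0 (dom1 D f))" for f
  define R2 where "R2 \<sigma> = universal_arrow.factor2 C D L (e (cod1 D (dom2 D \<sigma>)))
    (\<sigma> \<lhd> e (dom1 D (dom2 D \<sigma>))) (R1 (dom2 D \<sigma>)) (R1 (cod2 D \<sigma>))" for \<sigma>
  define u where "u A = universal_arrow.factor C D L (R0 (on0 L A)) (e (on0 L A)) (id1 D (on0 L A)) A" for A
  have R0 [simp]: "R0 B \<in> Obj C" if "B \<in> Obj D" for B
    by (rule universal_arrow.R_Obj[OF univ[OF that]])
  have e [simp]: "e B \<in> Cell1 D" "dom1 D (e B) = on0 L (R0 B)" "cod1 D (e B) = B" if "B \<in> Obj D" for B
    using universal_arrow.e_simps[OF univ[OF that]] .
  have R1 [simp]: "R1 f \<in> Cell1 C" "dom1 C (R1 f) = R0 (dom1 D f)" "cod1 C (R1 f) = R0 (cod1 D f)"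
    and R1_eq: "e (cod1 D f) \<cdot> on1 L (R1 f) = f \<cdot> e (dom1 D f)" if "f \<in> Cell1 D" for f
    unfolding R1_def
    by (rule universal_arrow.factor_simps[OF univ]; use that in simp)+
  have R2 [simp]: "R2 \<sigma> \<in> Cell2 C" "dom2 C (R2 \<sigma>) = R1 (dom2 D \<sigma>)" "cod2 C (R2 \<sigma>) = R1 (cod2 D \<sigma>)"
    and R2_eq: "e (cod1 D (dom2 D \<sigma>)) \<rhd> on2 L (R2 \<sigma>) = \<sigma> \<lhd> e (dom1 D (dom2 D \<sigma>))"
    if "\<sigma> \<in> Cell2 D" for \<sigma>
    unfolding R2_def
    by (rule universal_arrow.factor2_simps[OF univ];
        use that R1_eq[of "dom2 D \<sigma>"] R1_eq[of "cod2 D \<sigma>"] in simp)+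
  have u [simp]: "u A \<in> Cell1 C" "dom1 C (u A) = A" "cod1 C (u A) = R0 (on0 L A)"
    and u_eq: "e (on0 L A) \<cdot> on1 L (u A) = id1 D (on0 L A)" if "A \<in> Obj C" for A
    unfolding u_def
    by (rule universal_arrow.factor_simps[OF univ]; use that in simp)+
  note eqI1 = universal_arrow.factor_eqI[OF univ] and eqI2 = universal_arrow.factor2_eqI[OF univ]
  \<comment> \<open>The characterizing equations again, now with a further factor on the right, as
    composites are normalized to the right.\<close>
  have R1_eq': "e (cod1 D f) \<cdot> (on1 L (R1 f) \<cdot> g) = f \<cdot> (e (dom1 D f) \<cdot> g)"
    if "f \<in> Cell1 D" "g \<in> Cell1 D" "cod1 D g = on0 L (R0 (dom1 D f))" for f g
    using L.target.comp1_assoc'[of g "on1 L (R1 f)" "e (cod1 D f)"] R1_eq[of f] that by simp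
  have u_eq': "e (on0 L A) \<cdot> (on1 L (u A) \<cdot> g) = g"
    if "A \<in> Obj C" "g \<in> Cell1 D" "cod1 D g = on0 L A" for A g
    using L.target.comp1_assoc'[of g "on1 L (u A)" "e (on0 L A)"] u_eq[of A] that by simp
  have R2_eq': "e (cod1 D (dom2 D \<sigma>)) \<rhd> (on2 L (R2 \<sigma>) \<lhd> g) = \<sigma> \<lhd> (e (dom1 D (dom2 D \<sigma>)) \<cdot> g)"
    if "\<sigma> \<in> Cell2 D" "g \<in> Cell1 D" "cod1 D g = on0 L (R0 (dom1 D (dom2 D \<sigma>)))" for \<sigma> g
    using L.target.post_pre_whisker[of "e (cod1 D (dom2 D \<sigma>))" g "on2 L (R2 \<sigma>)"] R2_eq[of \<sigma>] that by simp
  have R1_eq2: "e (cod1 D f) \<rhd> (on1 L (R1 f) \<rhd> \<rho>) = f \<rhd> (e (dom1 D f) \<rhd> \<rho>)"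
    if "f \<in> Cell1 D" "\<rho> \<in> Cell2 D" "cod1 D (dom2 D \<rho>) = on0 L (R0 (dom1 D f))" for f \<rho>
    using L.target.post_whisker_comp1[of "on1 L (R1 f)" "e (cod1 D f)" \<rho>] R1_eq[of f] that by simp
  have u_eq2: "e (on0 L A) \<rhd> (on1 L (u A) \<rhd> \<rho>) = \<rho>"
    if "A \<in> Obj C" "\<rho> \<in> Cell2 D" "cod1 D (dom2 D \<rho>) = on0 L A" for A \<rho>
    using L.target.post_whisker_comp1[of "on1 L (u A)" "e (on0 L A)" \<rho>] u_eq[of A] that by simp
  have R1_comp: "R1 (g \<cdot> f) = R1 g \<cdot>\<^bsub>C\<^esub> R1 f"
    if "f \<in> Cell1 D" "g \<in> Cell1 D" "dom1 D g = cod1 D f" for f g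
    by (rule eqI1[of "cod1 D g"])
      (use that R1_eq[of f] R1_eq[of "g \<cdot> f"] R1_eq'[of g "on1 L (R1 f)"] in auto)
  have R: "two_functor D C (TwoFun R0 R1 R2)"
  proof
    fix A assume "A \<in> Obj D"
    then show "on1 (TwoFun R0 R1 R2) (id1 D A) = id1 C (on0 (TwoFun R0 R1 R2) A)"
      using R1_eq[of "id1 D A"] by (auto intro!: eqI1)
  next
    fix X Y Z f g assume "f \<in> hom1 D X Y" "g \<in> hom1 D Y Z"
    then show "on1 (TwoFun R0 R1 R2) (g \<cdot> f) = on1 (TwoFun R0 R1 R2) g \<cdot>\<^bsub>C\<^esub> on1 (TwoFun R0 R1 R2) f"
      using R1_comp[of f g] by simp
  next
    fix f assume "f \<in> Cell1 D"
    then show "on2 (TwoFun R0 R1 R2) (id2 D f) = id2 C (on1 (TwoFun R0 R1 R2) f)"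
      using R2_eq[of "id2 D f"] R1_eq[of f] by (auto intro!: eqI2)
  next
    fix \<sigma> f g \<tau> h assume "\<sigma> \<in> hom2 D f g" "\<tau> \<in> hom2 D g h"
    then show "on2 (TwoFun R0 R1 R2) (\<tau> \<bullet> \<sigma>) = on2 (TwoFun R0 R1 R2) \<tau> \<bullet>\<^bsub>C\<^esub> on2 (TwoFun R0 R1 R2) \<sigma>"
      using R2_eq[of \<sigma>] R2_eq[of \<tau>] R2_eq[of "\<tau> \<bullet> \<sigma>"]
      by (auto intro!: eqI2)
  next
    fix X Y Z f g f' g' \<sigma> \<tau>
    assume "f \<in> hom1 D X Y" "g \<in> hom1 D Y Z" "\<sigma> \<in> hom2 D f f'" "\<tau> \<in> hom2 D g g'"
    then show "on2 (TwoFun R0 R1 R2) (\<tau> \<star> \<sigma>) = on2 (TwoFun R0 R1 R2) \<tau> \<star>\<^bsub>C\<^esub> on2 (TwoFun R0 R1 R2) \<sigma>"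
      using R2_eq[of \<sigma>] R2_eq[of \<tau>] R2_eq[of "\<tau> \<star> \<sigma>"] R1_eq[of f] R1_eq[of f']
        R2_eq'[of \<tau> "on1 L (R1 f')"] R1_eq2[of g "on2 L (R2 \<sigma>)"]
      by (auto simp: L.target.hcomp_simps L.source.hcomp_simps R1_comp L.target.hcomp_whisker L.source.hcomp_whisker intro!: eqI2)
  qed auto
  interpret R: two_functor D C "TwoFun R0 R1 R2" by (rule R)
  \<comment> \<open>Proved in advance because 2-dimensional naturality also needs it, to see that
    both of its sides have the same boundary.\<close>
  have u_nat: "u B \<cdot>\<^bsub>C\<^esub> f = R1 (on1 L f) \<cdot>\<^bsub>C\<^esub> u A" if "f \<in> hom1 C A B" for f A B
    by (rule eqI1[of "on0 L B"])
      (use that u_eq[of A] u_eq'[of B "on1 L f"] R1_eq'[of "on1 L f" "on1 L (u A)"] in auto)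
  have "two_adjunction C D L (TwoFun R0 R1 R2) u e"
    unfolding two_adjunction_def two_natural_def two_natural_axioms_def two_adjunction_axioms_def
  proof (intro conjI allI impI)
    fix f A B assume f: "f \<in> hom1 C A B"
    show "u B \<cdot>\<^bsub>C\<^esub> on1 twofun_id f = on1 (twofun_comp (TwoFun R0 R1 R2) L) f \<cdot>\<^bsub>C\<^esub> u A"
      using u_nat[OF f] by simp
    fix \<sigma> g assume s: "\<sigma> \<in> hom2 C f g"
    show "u B \<rhd>\<^bsub>C\<^esub> on2 twofun_id \<sigma> = on2 (twofun_comp (TwoFun R0 R1 R2) L) \<sigma> \<lhd>\<^bsub>C\<^esub> u A"
      unfolding twofun_simps twofun.sel
      by (rule eqI2[of "on0 L B"])
        (use f s u_eq[of A] u_eq2[of B "on2 L \<sigma>"] R2_eq'[of "on2 L \<sigma>" "on1 L (u A)"] u_nat[of f A B] u_nat[of g A B] in auto)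
  next
    fix B assume B: "B \<in> Obj D"
    have "R1 (e B) \<cdot>\<^bsub>C\<^esub> u (R0 B) = id1 C (R0 B)"
      by (rule eqI1[OF B])
        (use B R1_eq'[of "e B" "on1 L (u (R0 B))"] u_eq[of "R0 B"] in simp_all)
    then show "on1 (TwoFun R0 R1 R2) (e B) \<cdot>\<^bsub>C\<^esub> u (on0 (TwoFun R0 R1 R2) B) = id1 C (on0 (TwoFun R0 R1 R2) B)"
      by simp
  qed (use R L R1_eq R2_eq u_eq L.source.two_category_axioms L.target.two_category_axioms in
      \<open>auto intro!: two_functor_comp two_functor_id\<close>)
  then show ?thesis by blast
qed

text \<open>Inverses of natural components are natural: insert
  \<open>\<theta> A \<cdot> \<psi> A\<close>, apply naturality of \<theta>, cancel
  \<open>\<psi> B \<cdot> \<theta> B\<close>. Invertibility may therefore be checked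
  objectwise.\<close>

lemma (in two_natural) two_natural_isoI:
  assumes \<psi>: "\<And>A. A \<in> Obj C \<Longrightarrow> \<psi> A \<in> hom1 D (on0 G A) (on0 F A)"
    and inv: "\<And>A. A \<in> Obj C \<Longrightarrow> \<psi> A \<cdot>\<^bsub>D\<^esub> \<theta> A = id1 D (on0 F A)"
      "\<And>A. A \<in> Obj C \<Longrightarrow> \<theta> A \<cdot>\<^bsub>D\<^esub> \<psi> A = id1 D (on0 G A)"
  shows "two_natural_iso C D F G \<theta>"
proof -
  have [simp]: "\<psi> A \<in> Cell1 D" "dom1 D (\<psi> A) = on0 G A" "cod1 D (\<psi> A) = on0 F A" if "A \<in> Obj C" for A
    using \<psi>[OF that] by simp_all
  have "two_natural C D G F \<psi>"
  proof
    fix f A B assume "f \<in> hom1 C A B"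
    then have f: "f \<in> Cell1 C" "dom1 C f = A" "cod1 C f = B" "A \<in> Obj C" "B \<in> Obj C" by auto
    have "\<psi> B \<cdot>\<^bsub>D\<^esub> on1 G f = \<psi> B \<cdot>\<^bsub>D\<^esub> (on1 G f \<cdot>\<^bsub>D\<^esub> (\<theta> A \<cdot>\<^bsub>D\<^esub> \<psi> A))"
      using f by (simp add: inv)
    also have "\<dots> = \<psi> B \<cdot>\<^bsub>D\<^esub> ((on1 G f \<cdot>\<^bsub>D\<^esub> \<theta> A) \<cdot>\<^bsub>D\<^esub> \<psi> A)" using f by simp
    also have "\<dots> = (\<psi> B \<cdot>\<^bsub>D\<^esub> \<theta> B) \<cdot>\<^bsub>D\<^esub> (on1 F f \<cdot>\<^bsub>D\<^esub> \<psi> A)"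
      using f natural1'[of f, symmetric] by simp
    also have "\<dots> = on1 F f \<cdot>\<^bsub>D\<^esub> \<psi> A" using f by (simp add: inv del: F.target.comp1_assoc')
    finally show "\<psi> B \<cdot>\<^bsub>D\<^esub> on1 G f = on1 F f \<cdot>\<^bsub>D\<^esub> \<psi> A" .
  next
    fix f A B \<sigma> g assume "f \<in> hom1 C A B" "\<sigma> \<in> hom2 C f g"
    then have f: "\<sigma> \<in> Cell2 C" "dom2 C \<sigma> = f" "f \<in> Cell1 C" "dom1 C f = A" "cod1 C f = B" "A \<in> Obj C" "B \<in> Obj C" by auto
    have "\<psi> B \<rhd>\<^bsub>D\<^esub> on2 G \<sigma> = \<psi> B \<rhd>\<^bsub>D\<^esub> (on2 G \<sigma> \<lhd>\<^bsub>D\<^esub> (\<theta> A \<cdot>\<^bsub>D\<^esub> \<psi> A))"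
      using f by (simp add: inv)
    also have "\<dots> = \<psi> B \<rhd>\<^bsub>D\<^esub> ((on2 G \<sigma> \<lhd>\<^bsub>D\<^esub> \<theta> A) \<lhd>\<^bsub>D\<^esub> \<psi> A)" using f by simp
    also have "\<dots> = (\<psi> B \<cdot>\<^bsub>D\<^esub> \<theta> B) \<rhd>\<^bsub>D\<^esub> (on2 F \<sigma> \<lhd>\<^bsub>D\<^esub> \<psi> A)"
      using f natural2'[of \<sigma>, symmetric] by simp
    also have "\<dots> = on2 F \<sigma> \<lhd>\<^bsub>D\<^esub> \<psi> A" using f by (simp add: inv del: F.target.post_whisker_comp1)
    finally show "\<psi> B \<rhd>\<^bsub>D\<^esub> on2 G \<sigma> = on2 F \<sigma> \<lhd>\<^bsub>D\<^esub> \<psi> A" .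
  qed simp
  then show ?thesis
    using inv two_natural_axioms unfolding two_natural_iso_def by blast
qed

section \<open>Standardness of Eilenberg-Moore objects\<close>

text \<open>Any other universal arrow is \<open>e\<close> composed with \<open>iota C\<close> of an
  isomorphism \<open>k\<close>. Since \<open>Mnd_map G\<close> turns this into \<open>iota E\<close>
  of the isomorphism \<open>on1 G k\<close>, universality of the image does not depend on the chosen
  arrow.\<close>

lemma universal_arrow_map:
  assumes G: "two_functor C E G" and M: "M \<in> Obj (Mnd C)"
    and e: "universal_arrow C (Mnd C) (iota C) M R e"
    and std: "universal_arrow E (Mnd E) (iota E) (on0 (Mnd_map G) M) (on0 G R) (on1 (Mnd_map G) e)"
    and e': "universal_arrow C (Mnd C) (iota C) M R' e'"
  shows "universal_arrow E (Mnd E) (iota E) (on0 (Mnd_map G) M) (on0 G R') (on1 (Mnd_map G) e')"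
proof -
  interpret G: two_functor C E G by fact
  interpret MG: two_functor "Mnd C" "Mnd E" "Mnd_map G" by (rule G.two_functor_Mnd_map)
  interpret e: universal_arrow C "Mnd C" "iota C" M R e by fact
  interpret std: universal_arrow E "Mnd E" "iota E" "on0 (Mnd_map G) M" "on0 G R" "on1 (Mnd_map G) e" by fact
  \<comment> \<open>With these rules composition in the 2-categories of monads would be rewritten to
    \<open>monad_mor_comp\<close>, and the general facts on universal arrows would no longer
    match.\<close>
  note [simp del] = G.source.Mnd_simps G.target.Mnd_simps
  obtain k k' where k: "k \<in> hom1 C R' R" "k' \<in> hom1 C R R'" "k \<cdot>\<^bsub>C\<^esub> k' = id1 C R" "k' \<cdot>\<^bsub>C\<^esub> k = id1 C R'"
    "e \<cdot>\<^bsub>Mnd C\<^esub> on1 (iota C) k = e'"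
    by (rule e.unique_up_to_iso[OF e'])
  have R': "R' \<in> Obj C" by (rule universal_arrow.R_Obj[OF e'])
  have "on1 (Mnd_map G) e' = on1 (Mnd_map G) e \<cdot>\<^bsub>Mnd E\<^esub> on1 (Mnd_map G) (on1 (iota C) k)"
    using k by (subst k(5)[symmetric], subst MG.on1_comp') (simp_all del: G.source.iota_simps G.Mnd_map_simps)
  also have "on1 (Mnd_map G) (on1 (iota C) k) = on1 (iota E) (on1 G k)"
    using k by (simp add: G.Mnd_map_iota)
  finally have eq: "on1 (Mnd_map G) e' = on1 (Mnd_map G) e \<cdot>\<^bsub>Mnd E\<^esub> on1 (iota E) (on1 G k)" .
  have "on1 G k \<cdot>\<^bsub>E\<^esub> on1 G k' = id1 E (on0 G R)"
    "on1 G k' \<cdot>\<^bsub>E\<^esub> on1 G k = id1 E (on0 G R')"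
    using k R' by (simp_all flip: G.on1_comp' G.on1_id)
  then show ?thesis
    unfolding eq by (intro std.comp_iso) (use k in simp_all)
qed

text \<open>Composed with the counit of the second adjunction, the component of the mate at
  \<open>M\<close> becomes the image of \<open>e\<^sub>C M\<close> under \<open>Mnd_map G\<close>.
  It is thus the comparison between two universal arrows to the same monad, hence
  invertible.\<close>

lemma two_natural_iso_EM_mate:
  assumes G: "two_functor C E G"
    and adj: "two_adjunction C (Mnd C) (iota C) R\<^sub>C u\<^sub>C e\<^sub>C"
    and adj': "two_adjunction E (Mnd E) (iota E) R\<^sub>E u\<^sub>E e\<^sub>E"
    and std: "\<And>M. M \<in> Obj (Mnd C) \<Longrightarrow>
      universal_arrow E (Mnd E) (iota E) (on0 (Mnd_map G) M) (on0 G (on0 R\<^sub>C M)) (on1 (Mnd_map G) (e\<^sub>C M))"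
  shows "two_natural_iso (Mnd C) E (twofun_comp G R\<^sub>C) (twofun_comp R\<^sub>E (Mnd_map G))
    (EM_mate E G R\<^sub>C e\<^sub>C R\<^sub>E u\<^sub>E)"
proof -
  interpret G: two_functor C E G by fact
  interpret A: two_adjunction C "Mnd C" "iota C" R\<^sub>C u\<^sub>C e\<^sub>C by fact
  interpret B: two_adjunction E "Mnd E" "iota E" R\<^sub>E u\<^sub>E e\<^sub>E by fact
  interpret MG: two_functor "Mnd C" "Mnd E" "Mnd_map G" by (rule G.two_functor_Mnd_map)
  have Mi0: "on0 (Mnd_map G) (on0 (iota C) X) = on0 (iota E) (on0 G X)" if "X \<in> Obj C" for X
    using that by (simp add: G.Mnd_map_iota)
  have Mi1: "on1 (Mnd_map G) (on1 (iota C) f) = on1 (iota E) (on1 G f)" if "f \<in> Cell1 C" for f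
    using that by (simp add: G.Mnd_map_iota)
  have Mi2: "on2 (Mnd_map G) (on2 (iota C) \<sigma>) = on2 (iota E) (on2 G \<sigma>)" if "\<sigma> \<in> Cell2 C" for \<sigma>
    using that by (simp add: G.Mnd_map_iota)
  note [simp del] = G.source.Mnd_simps G.target.Mnd_simps G.source.iota_simps G.target.iota_simps
    G.Mnd_map_simps
  note [simp] = Mi0 Mi1 Mi2
  have e [simp]: "e\<^sub>C M \<in> Cell1 (Mnd C)" "dom1 (Mnd C) (e\<^sub>C M) = on0 (iota C) (on0 R\<^sub>C M)" "cod1 (Mnd C) (e\<^sub>C M) = M"
    if "M \<in> Obj (Mnd C)" for M using A.counit.component_simps[OF that] by simp_all
  have e' [simp]: "e\<^sub>E M \<in> Cell1 (Mnd E)" "dom1 (Mnd E) (e\<^sub>E M) = on0 (iota E) (on0 R\<^sub>E M)" "cod1 (Mnd E) (e\<^sub>E M) = M"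
    if "M \<in> Obj (Mnd E)" for M using B.counit.component_simps[OF that] by simp_all
  have u [simp]: "u\<^sub>E X \<in> Cell1 E" "dom1 E (u\<^sub>E X) = X" "cod1 E (u\<^sub>E X) = on0 R\<^sub>E (on0 (iota E) X)"
    if "X \<in> Obj E" for X using B.unit.component_simps[OF that] by simp_all
  define \<theta> where "\<theta> = EM_mate E G R\<^sub>C e\<^sub>C R\<^sub>E u\<^sub>E"
  have \<theta>: "\<theta> M = on1 R\<^sub>E (on1 (Mnd_map G) (e\<^sub>C M)) \<cdot>\<^bsub>E\<^esub> u\<^sub>E (on0 G (on0 R\<^sub>C M))" for M
    by (simp add: \<theta>_def EM_mate_def)
  interpret \<theta>: two_natural "Mnd C" E "twofun_comp G R\<^sub>C" "twofun_comp R\<^sub>E (Mnd_map G)" \<theta>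
  proof (intro two_natural.intro two_natural_axioms.intro two_functor_comp[OF A.R.two_functor_axioms G]
      two_functor_comp[OF MG.two_functor_axioms B.R.two_functor_axioms])
    fix M assume "M \<in> Obj (Mnd C)"
    then show "\<theta> M \<in> hom1 E (on0 (twofun_comp G R\<^sub>C) M) (on0 (twofun_comp R\<^sub>E (Mnd_map G)) M)"
      by (simp add: \<theta>)
  next
    fix f M N assume "f \<in> hom1 (Mnd C) M N"
    then have f [simp]: "f \<in> Cell1 (Mnd C)" "dom1 (Mnd C) f = M" "cod1 (Mnd C) f = N"
      "M \<in> Obj (Mnd C)" "N \<in> Obj (Mnd C)" by auto
    have "\<theta> N \<cdot>\<^bsub>E\<^esub> on1 G (on1 R\<^sub>C f) = on1 R\<^sub>E (on1 (Mnd_map G) (e\<^sub>C N \<cdot>\<^bsub>Mnd C\<^esub> on1 (iota C) (on1 R\<^sub>C f))) \<cdot>\<^bsub>E\<^esub> u\<^sub>E (on0 G (on0 R\<^sub>C M))"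
      using B.unit.natural1'[of "on1 G (on1 R\<^sub>C f)"] by (simp add: \<theta>)
    also have "\<dots> = on1 R\<^sub>E (on1 (Mnd_map G) f) \<cdot>\<^bsub>E\<^esub> \<theta> M"
      using A.counit.natural1'[of f] by (simp add: \<theta>)
    finally show "\<theta> N \<cdot>\<^bsub>E\<^esub> on1 (twofun_comp G R\<^sub>C) f = on1 (twofun_comp R\<^sub>E (Mnd_map G)) f \<cdot>\<^bsub>E\<^esub> \<theta> M"
      by simp
  next
    fix f M N \<sigma> g assume "f \<in> hom1 (Mnd C) M N" "\<sigma> \<in> hom2 (Mnd C) f g"
    then have f [simp]: "\<sigma> \<in> Cell2 (Mnd C)" "dom2 (Mnd C) \<sigma> = f" "dom1 (Mnd C) f = M" "cod1 (Mnd C) f = N"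
      "f \<in> Cell1 (Mnd C)" "M \<in> Obj (Mnd C)" "N \<in> Obj (Mnd C)" by auto
    have "\<theta> N \<rhd>\<^bsub>E\<^esub> on2 G (on2 R\<^sub>C \<sigma>) = on2 R\<^sub>E (on2 (Mnd_map G) (e\<^sub>C N \<rhd>\<^bsub>Mnd C\<^esub> on2 (iota C) (on2 R\<^sub>C \<sigma>))) \<lhd>\<^bsub>E\<^esub> u\<^sub>E (on0 G (on0 R\<^sub>C M))"
      using B.unit.natural2'[of "on2 G (on2 R\<^sub>C \<sigma>)"] by (simp add: \<theta>)
    also have "\<dots> = on2 R\<^sub>E (on2 (Mnd_map G) \<sigma>) \<lhd>\<^bsub>E\<^esub> \<theta> M"
      using A.counit.natural2'[of \<sigma>] by (simp add: \<theta>)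
    finally show "\<theta> N \<rhd>\<^bsub>E\<^esub> on2 (twofun_comp G R\<^sub>C) \<sigma> = on2 (twofun_comp R\<^sub>E (Mnd_map G)) \<sigma> \<lhd>\<^bsub>E\<^esub> \<theta> M"
      by simp
  qed
  have "\<exists>\<psi>. \<psi> \<in> hom1 E (on0 R\<^sub>E (on0 (Mnd_map G) M)) (on0 G (on0 R\<^sub>C M))
      \<and> \<psi> \<cdot>\<^bsub>E\<^esub> \<theta> M = id1 E (on0 G (on0 R\<^sub>C M))
      \<and> \<theta> M \<cdot>\<^bsub>E\<^esub> \<psi> = id1 E (on0 R\<^sub>E (on0 (Mnd_map G) M))" if M [simp]: "M \<in> Obj (Mnd C)" for M
  proof -
    let ?N = "on0 (Mnd_map G) M"
    interpret U: universal_arrow E "Mnd E" "iota E" ?N "on0 R\<^sub>E ?N" "e\<^sub>E ?N"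
      by (rule B.universal_arrow_counit) simp
    obtain k k' where k: "k \<in> hom1 E (on0 G (on0 R\<^sub>C M)) (on0 R\<^sub>E ?N)" "k' \<in> hom1 E (on0 R\<^sub>E ?N) (on0 G (on0 R\<^sub>C M))"
      "k \<cdot>\<^bsub>E\<^esub> k' = id1 E (on0 R\<^sub>E ?N)" "k' \<cdot>\<^bsub>E\<^esub> k = id1 E (on0 G (on0 R\<^sub>C M))"
      "e\<^sub>E ?N \<cdot>\<^bsub>Mnd E\<^esub> on1 (iota E) k = on1 (Mnd_map G) (e\<^sub>C M)"
      by (rule U.unique_up_to_iso[OF std[OF M]])
    let ?m = "on1 (Mnd_map G) (e\<^sub>C M)" and ?u = "u\<^sub>E (on0 G (on0 R\<^sub>C M))"
    \<comment> \<open>Naturality of the counit moves it past \<open>on1 R\<^sub>E ?m\<close>; what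
      then remains is a triangle identity.\<close>
    have "e\<^sub>E ?N \<cdot>\<^bsub>Mnd E\<^esub> on1 (iota E) (\<theta> M) = (e\<^sub>E ?N \<cdot>\<^bsub>Mnd E\<^esub> on1 (iota E) (on1 R\<^sub>E ?m)) \<cdot>\<^bsub>Mnd E\<^esub> on1 (iota E) ?u"
      by (simp add: \<theta>)
    also have "\<dots> = ?m \<cdot>\<^bsub>Mnd E\<^esub> (e\<^sub>E (on0 (iota E) (on0 G (on0 R\<^sub>C M))) \<cdot>\<^bsub>Mnd E\<^esub> on1 (iota E) ?u)"
      using B.counit.natural1'[of ?m] by simp
    also have "\<dots> = ?m" by (simp add: B.triangle_L)
    finally have "\<theta> M = k"
      by (intro U.factor_eqI) (use k in \<open>simp_all add: \<theta>\<close>)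
    with k show ?thesis by blast
  qed
  then obtain \<psi> where "\<And>M. M \<in> Obj (Mnd C) \<Longrightarrow> \<psi> M \<in> hom1 E (on0 R\<^sub>E (on0 (Mnd_map G) M)) (on0 G (on0 R\<^sub>C M))
      \<and> \<psi> M \<cdot>\<^bsub>E\<^esub> \<theta> M = id1 E (on0 G (on0 R\<^sub>C M))
      \<and> \<theta> M \<cdot>\<^bsub>E\<^esub> \<psi> M = id1 E (on0 R\<^sub>E (on0 (Mnd_map G) M))"
    by metis
  then show ?thesis
    unfolding \<theta>_def[symmetric] by (intro \<theta>.two_natural_isoI[of \<psi>]) auto
qed

text \<open>\<open>standard_EM\<close> quantifies over all pairs of adjunctions, but by
  \<open>universal_arrow_map\<close> and \<open>two_natural_iso_EM_mate\<close> it can be tested on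
  a single universal arrow for each monad.\<close>

lemma standard_EM_if_universal_arrows:
  fixes C :: "('p, 'g, 'd) twocat" and E :: "('o, 'f, 'c) twocat"
  assumes G: "two_functor C E G" and EM: "admits_EM E"
    and univ: "\<And>M. M \<in> Obj (Mnd C) \<Longrightarrow> \<exists>R e. universal_arrow C (Mnd C) (iota C) M R e \<and>
      universal_arrow E (Mnd E) (iota E) (on0 (Mnd_map G) M) (on0 G R) (on1 (Mnd_map G) e)"
  shows "admits_EM C \<and> standard_EM C E G"
proof -
  interpret G: two_functor C E G by fact
  obtain R e where Re: "\<And>M. M \<in> Obj (Mnd C) \<Longrightarrow> universal_arrow C (Mnd C) (iota C) M (R M) (e M)"
    "\<And>M. M \<in> Obj (Mnd C) \<Longrightarrow>
      universal_arrow E (Mnd E) (iota E) (on0 (Mnd_map G) M) (on0 G (R M)) (on1 (Mnd_map G) (e M))"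
    using univ by metis
  have "admits_EM C"
    using two_adjunction_if_universal_arrows[OF G.source.two_functor_iota Re(1)]
    unfolding admits_EM_def by blast
  moreover have "standard_EM C E G"
    unfolding standard_EM_def
  proof (intro conjI allI impI)
    fix R\<^sub>C u\<^sub>C e\<^sub>C R\<^sub>E u\<^sub>E e\<^sub>E
    assume adj: "two_adjunction C (Mnd C) (iota C) R\<^sub>C u\<^sub>C e\<^sub>C"
      "two_adjunction E (Mnd E) (iota E) R\<^sub>E u\<^sub>E e\<^sub>E"
    show "two_natural_iso (Mnd C) E (twofun_comp G R\<^sub>C) (twofun_comp R\<^sub>E (Mnd_map G))
        (EM_mate E G R\<^sub>C e\<^sub>C R\<^sub>E u\<^sub>E)"
      by (intro two_natural_iso_EM_mate[OF G adj] universal_arrow_map[OF G _ Re]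
          two_adjunction.universal_arrow_counit[OF adj(1)])
  qed fact+
  ultimately show ?thesis by blast
qed

section \<open>Calculus of finite products\<close>

context two_category_with_products
begin

abbreviation pair (\<open>\<langle>_,/ _\<rangle>\<close>) where "\<langle>f, g\<rangle> \<equiv> pair1 D P f g"

abbreviation pairc (\<open>\<llangle>_,/ _\<rrangle>\<close>) where "\<llangle>\<sigma>, \<tau>\<rrangle> \<equiv> pair2 D P \<sigma> \<tau>"

abbreviation bng (\<open>!\<^sub>_\<close> [1000] 1000) where "!\<^sub>X \<equiv> bang D P X"

declare prd_Obj [simp] one_Obj [simp]

lemma pr_simps [simp]:
  assumes "A \<in> Obj D" "B \<in> Obj D"
  shows "pr1 P A B \<in> Cell1 D" "dom1 D (pr1 P A B) = prd P A B" "cod1 D (pr1 P A B) = A"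
    "pr2 P A B \<in> Cell1 D" "dom1 D (pr2 P A B) = prd P A B" "cod1 D (pr2 P A B) = B"
  using pr1_hom[OF assms] pr2_hom[OF assms] by simp_all

lemma bang_simps [simp]:
  assumes "X \<in> Obj D"
  shows "!\<^sub>X \<in> Cell1 D" "dom1 D !\<^sub>X = X" "cod1 D !\<^sub>X = one P"
  using theI'[OF one_universal1[OF assms]] by (simp_all add: bang_def)

lemma one_eqI:
  assumes "f \<in> Cell1 D" "g \<in> Cell1 D" "dom1 D f = dom1 D g" "cod1 D f = one P" "cod1 D g = one P"
  shows "f = g"
  using one_universal1[of "dom1 D g"] assms by auto

lemma bang_comp [simp]: "f \<in> Cell1 D \<Longrightarrow> cod1 D f = X \<Longrightarrow> !\<^sub>X \<cdot> f = !\<^sub>(dom1 D f)"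
  by (rule one_eqI) auto

lemma bang_one [simp]: "!\<^sub>(one P) = id1 D (one P)"
  by (rule one_eqI) auto

lemma one_eqI2:
  assumes "\<sigma> \<in> Cell2 D" "\<tau> \<in> Cell2 D" "dom2 D \<sigma> = dom2 D \<tau>" "cod2 D \<sigma> = cod2 D \<tau>" "cod1 D (dom2 D \<tau>) = one P"
  shows "\<sigma> = \<tau>"
  using one_universal2[of "dom2 D \<tau>" "dom1 D (dom2 D \<tau>)" "cod2 D \<tau>"] assms by auto

lemma pair_simps:
  assumes "f \<in> Cell1 D" "g \<in> Cell1 D" "dom1 D g = dom1 D f"
  shows "\<langle>f, g\<rangle> \<in> Cell1 D" "dom1 D \<langle>f, g\<rangle> = dom1 D f" "cod1 D \<langle>f, g\<rangle> = prd P (cod1 D f) (cod1 D g)"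
    "pr1 P (cod1 D f) (cod1 D g) \<cdot> \<langle>f, g\<rangle> = f" "pr2 P (cod1 D f) (cod1 D g) \<cdot> \<langle>f, g\<rangle> = g"
  using theI'[OF prd_universal1[of f "dom1 D f" "cod1 D f" g "cod1 D g"]] assms
  by (simp_all add: pair1_def)

declare pair_simps(1-3) [simp]

lemma pr_pair [simp]:
  assumes "f \<in> Cell1 D" "g \<in> Cell1 D" "dom1 D g = dom1 D f" "cod1 D f = A" "cod1 D g = B"
  shows "pr1 P A B \<cdot> \<langle>f, g\<rangle> = f" "pr2 P A B \<cdot> \<langle>f, g\<rangle> = g"
  using pair_simps[of f g] assms by simp_all

lemma pair_eqI:
  assumes "pr1 P A B \<cdot> h = pr1 P A B \<cdot> k" "pr2 P A B \<cdot> h = pr2 P A B \<cdot> k"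
    "h \<in> Cell1 D" "k \<in> Cell1 D" "dom1 D h = dom1 D k" "cod1 D h = prd P A B" "cod1 D k = prd P A B"
    "A \<in> Obj D" "B \<in> Obj D"
  shows "h = k"
  using prd_universal1[of "pr1 P A B \<cdot> k" "dom1 D k" A "pr2 P A B \<cdot> k" B] assms by auto

text \<open>Oriented so that precomposition moves into pairs: 1-cells into products become tuples,
  and whiskering by a tuple acts as substitution for the projections.\<close>

lemma pair_comp [simp]:
  assumes "f \<in> Cell1 D" "g \<in> Cell1 D" "h \<in> Cell1 D" "dom1 D f = cod1 D h" "dom1 D g = cod1 D h"
  shows "\<langle>f, g\<rangle> \<cdot> h = \<langle>f \<cdot> h, g \<cdot> h\<rangle>"
proof (rule pair_eqI)
  show "pr1 P (cod1 D f) (cod1 D g) \<cdot> (\<langle>f, g\<rangle> \<cdot> h) = pr1 P (cod1 D f) (cod1 D g) \<cdot> \<langle>f \<cdot> h, g \<cdot> h\<rangle>"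
    "pr2 P (cod1 D f) (cod1 D g) \<cdot> (\<langle>f, g\<rangle> \<cdot> h) = pr2 P (cod1 D f) (cod1 D g) \<cdot> \<langle>f \<cdot> h, g \<cdot> h\<rangle>"
    using assms comp1_assoc'[of h "\<langle>f, g\<rangle>", symmetric] by (simp_all del: comp1_assoc')
qed (use assms in simp_all)

lemma pair_pr [simp]: "A \<in> Obj D \<Longrightarrow> B \<in> Obj D \<Longrightarrow> \<langle>pr1 P A B, pr2 P A B\<rangle> = id1 D (prd P A B)"
  by (rule pair_eqI[of A B]) simp_all

lemma pair_pr_comp [simp]:
  assumes "A \<in> Obj D" "B \<in> Obj D" "h \<in> Cell1 D" "cod1 D h = prd P A B"
  shows "\<langle>pr1 P A B \<cdot> h, pr2 P A B \<cdot> h\<rangle> = h"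
  using pair_comp[of "pr1 P A B" "pr2 P A B" h] assms by (simp del: pair_comp)

lemma pairc_simps:
  assumes "\<sigma> \<in> Cell2 D" "\<tau> \<in> Cell2 D" "dom1 D (dom2 D \<tau>) = dom1 D (dom2 D \<sigma>)"
  defines "A \<equiv> cod1 D (dom2 D \<sigma>)" and "B \<equiv> cod1 D (dom2 D \<tau>)"
  shows "\<llangle>\<sigma>, \<tau>\<rrangle> \<in> Cell2 D" "dom2 D \<llangle>\<sigma>, \<tau>\<rrangle> = \<langle>dom2 D \<sigma>, dom2 D \<tau>\<rangle>" "cod2 D \<llangle>\<sigma>, \<tau>\<rrangle> = \<langle>cod2 D \<sigma>, cod2 D \<tau>\<rangle>"
    "pr1 P A B \<rhd> \<llangle>\<sigma>, \<tau>\<rrangle> = \<sigma>" "pr2 P A B \<rhd> \<llangle>\<sigma>, \<tau>\<rrangle> = \<tau>"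
  using theI'[OF prd_universal2[of A B "\<langle>dom2 D \<sigma>, dom2 D \<tau>\<rangle>" "dom1 D (dom2 D \<sigma>)" "\<langle>cod2 D \<sigma>, cod2 D \<tau>\<rangle>" \<sigma> \<tau>]]
    assms by (simp_all add: pair2_def Let_def)

declare pairc_simps(1-3) [simp]

lemma pr_pairc [simp]:
  assumes "\<sigma> \<in> Cell2 D" "\<tau> \<in> Cell2 D" "dom1 D (dom2 D \<tau>) = dom1 D (dom2 D \<sigma>)"
    "cod1 D (dom2 D \<sigma>) = A" "cod1 D (dom2 D \<tau>) = B"
  shows "pr1 P A B \<rhd> \<llangle>\<sigma>, \<tau>\<rrangle> = \<sigma>" "pr2 P A B \<rhd> \<llangle>\<sigma>, \<tau>\<rrangle> = \<tau>"
  using pairc_simps[of \<sigma> \<tau>] assms by simp_all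

lemma pairc_eqI:
  assumes "pr1 P A B \<rhd> \<rho> = pr1 P A B \<rhd> \<rho>'" "pr2 P A B \<rhd> \<rho> = pr2 P A B \<rhd> \<rho>'"
    "\<rho> \<in> Cell2 D" "\<rho>' \<in> Cell2 D" "dom2 D \<rho> = dom2 D \<rho>'" "cod2 D \<rho> = cod2 D \<rho>'"
    "cod1 D (dom2 D \<rho>') = prd P A B" "A \<in> Obj D" "B \<in> Obj D"
  shows "\<rho> = \<rho>'"
  using prd_universal2[of A B "dom2 D \<rho>'" "dom1 D (dom2 D \<rho>')" "cod2 D \<rho>'" "pr1 P A B \<rhd> \<rho>'" "pr2 P A B \<rhd> \<rho>'"] assms
  by auto

lemma pairc_pre_whisker [simp]:
  assumes "\<sigma> \<in> Cell2 D" "\<tau> \<in> Cell2 D" "h \<in> Cell1 D" "dom1 D (dom2 D \<sigma>) = cod1 D h" "dom1 D (dom2 D \<tau>) = cod1 D h"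
  shows "\<llangle>\<sigma>, \<tau>\<rrangle> \<lhd> h = \<llangle>\<sigma> \<lhd> h, \<tau> \<lhd> h\<rrangle>"
proof (rule pairc_eqI)
  let ?A = "cod1 D (dom2 D \<sigma>)" and ?B = "cod1 D (dom2 D \<tau>)"
  show "pr1 P ?A ?B \<rhd> (\<llangle>\<sigma>, \<tau>\<rrangle> \<lhd> h) = pr1 P ?A ?B \<rhd> \<llangle>\<sigma> \<lhd> h, \<tau> \<lhd> h\<rrangle>"
    "pr2 P ?A ?B \<rhd> (\<llangle>\<sigma>, \<tau>\<rrangle> \<lhd> h) = pr2 P ?A ?B \<rhd> \<llangle>\<sigma> \<lhd> h, \<tau> \<lhd> h\<rrangle>"
    using assms by (simp_all del: post_pre_whisker add: post_pre_whisker[symmetric])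
qed (use assms in simp_all)

lemma pairc_vcomp [simp]:
  assumes "\<sigma> \<in> Cell2 D" "\<tau> \<in> Cell2 D" "\<sigma>' \<in> Cell2 D" "\<tau>' \<in> Cell2 D" "dom2 D \<sigma>' = cod2 D \<sigma>"
    "dom2 D \<tau>' = cod2 D \<tau>" "dom1 D (dom2 D \<tau>) = dom1 D (dom2 D \<sigma>)"
  shows "\<llangle>\<sigma>', \<tau>'\<rrangle> \<bullet> \<llangle>\<sigma>, \<tau>\<rrangle> = \<llangle>\<sigma>' \<bullet> \<sigma>, \<tau>' \<bullet> \<tau>\<rrangle>"
  by (rule pairc_eqI[where A = "cod1 D (dom2 D \<sigma>)" and B = "cod1 D (dom2 D \<tau>)"]) (use assms in simp_all)

lemma pairc_id2 [simp]:
  assumes "f \<in> Cell1 D" "g \<in> Cell1 D" "dom1 D g = dom1 D f"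
  shows "\<llangle>id2 D f, id2 D g\<rrangle> = id2 D \<langle>f, g\<rangle>"
  by (rule pairc_eqI[where A = "cod1 D f" and B = "cod1 D g"]) (use assms in simp_all)

lemma pair_post_whisker [simp]:
  assumes "f \<in> Cell1 D" "g \<in> Cell1 D" "\<rho> \<in> Cell2 D" "dom1 D f = cod1 D (dom2 D \<rho>)" "dom1 D g = cod1 D (dom2 D \<rho>)"
  shows "\<langle>f, g\<rangle> \<rhd> \<rho> = \<llangle>f \<rhd> \<rho>, g \<rhd> \<rho>\<rrangle>"
proof (rule pairc_eqI)
  show "pr1 P (cod1 D f) (cod1 D g) \<rhd> (\<langle>f, g\<rangle> \<rhd> \<rho>) = pr1 P (cod1 D f) (cod1 D g) \<rhd> \<llangle>f \<rhd> \<rho>, g \<rhd> \<rho>\<rrangle>"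
    "pr2 P (cod1 D f) (cod1 D g) \<rhd> (\<langle>f, g\<rangle> \<rhd> \<rho>) = pr2 P (cod1 D f) (cod1 D g) \<rhd> \<llangle>f \<rhd> \<rho>, g \<rhd> \<rho>\<rrangle>"
    using assms post_whisker_comp1[of "\<langle>f, g\<rangle>" _ \<rho>, symmetric] by (simp_all del: post_whisker_comp1)
qed (use assms in simp_all)

section \<open>Monoidal objects\<close>

text \<open>The components of \<open>pow3_proj\<close>, kept folded so that simp evaluates them on
  triples by \<open>q_tuple\<close>.\<close>

definition "q1 A = pr1 P A (prd P A A)"
definition "q2 A = pr1 P A A \<cdot> pr2 P A (prd P A A)"
definition "q3 A = pr2 P A A \<cdot> pr2 P A (prd P A A)"

lemmas q_defs = q1_def q2_def q3_def

lemma q_simps [simp]: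
  assumes "A \<in> Obj D"
  shows "q1 A \<in> Cell1 D" "dom1 D (q1 A) = prd P A (prd P A A)" "cod1 D (q1 A) = A"
    "q2 A \<in> Cell1 D" "dom1 D (q2 A) = prd P A (prd P A A)" "cod1 D (q2 A) = A"
    "q3 A \<in> Cell1 D" "dom1 D (q3 A) = prd P A (prd P A A)" "cod1 D (q3 A) = A"
  using assms by (simp_all add: q_defs)

lemma q_tuple [simp]:
  assumes "f \<in> Cell1 D" "g \<in> Cell1 D" "h \<in> Cell1 D" "cod1 D f = A" "cod1 D g = A" "cod1 D h = A"
    "dom1 D g = dom1 D f" "dom1 D h = dom1 D f"
  shows "q1 A \<cdot> \<langle>f, \<langle>g, h\<rangle>\<rangle> = f" "q2 A \<cdot> \<langle>f, \<langle>g, h\<rangle>\<rangle> = g" "q3 A \<cdot> \<langle>f, \<langle>g, h\<rangle>\<rangle> = h"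
  using assms cod1_Obj[of f] by (simp_all add: q_defs)

definition "p1 A = pr1 P A (prd P A (prd P A A))"
definition "p2 A = q1 A \<cdot> pr2 P A (prd P A (prd P A A))"
definition "p3 A = q2 A \<cdot> pr2 P A (prd P A (prd P A A))"
definition "p4 A = q3 A \<cdot> pr2 P A (prd P A (prd P A A))"

lemmas p_defs = p1_def p2_def p3_def p4_def

lemma p_simps [simp]:
  assumes "A \<in> Obj D"
  shows "p1 A \<in> Cell1 D" "dom1 D (p1 A) = prd P A (prd P A (prd P A A))" "cod1 D (p1 A) = A"
    "p2 A \<in> Cell1 D" "dom1 D (p2 A) = prd P A (prd P A (prd P A A))" "cod1 D (p2 A) = A"
    "p3 A \<in> Cell1 D" "dom1 D (p3 A) = prd P A (prd P A (prd P A A))" "cod1 D (p3 A) = A"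
    "p4 A \<in> Cell1 D" "dom1 D (p4 A) = prd P A (prd P A (prd P A A))" "cod1 D (p4 A) = A"
  using assms by (simp_all add: p_defs)

lemma p_tuple [simp]:
  assumes "f \<in> Cell1 D" "g \<in> Cell1 D" "h \<in> Cell1 D" "k \<in> Cell1 D" "cod1 D f = A" "cod1 D g = A" "cod1 D h = A"
    "cod1 D k = A" "dom1 D g = dom1 D f" "dom1 D h = dom1 D f" "dom1 D k = dom1 D f"
  shows "p1 A \<cdot> \<langle>f, \<langle>g, \<langle>h, k\<rangle>\<rangle>\<rangle> = f" "p2 A \<cdot> \<langle>f, \<langle>g, \<langle>h, k\<rangle>\<rangle>\<rangle> = g"
    "p3 A \<cdot> \<langle>f, \<langle>g, \<langle>h, k\<rangle>\<rangle>\<rangle> = h" "p4 A \<cdot> \<langle>f, \<langle>g, \<langle>h, k\<rangle>\<rangle>\<rangle> = k"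
  using assms cod1_Obj[of f] by (simp_all add: p_defs)

text \<open>A 1-cell into the object \<open>A\<close> of \<open>M\<close> is regarded as a generalized element of \<open>A\<close>. The following
  operations turn the hom-category of generalized elements defined on \<open>X\<close> into a monoidal category.\<close>

definition tens :: "'f \<Rightarrow> ('o, 'f, 'c) monoidal \<Rightarrow> 'f \<Rightarrow> 'f"  (\<open>_ \<otimes>\<^bsub>_\<^esub> _\<close> [75, 0, 75] 74) where
  "f \<otimes>\<^bsub>M\<^esub> g = mo_tensor M \<cdot> \<langle>f, g\<rangle>"

definition tensc :: "'c \<Rightarrow> ('o, 'f, 'c) monoidal \<Rightarrow> 'c \<Rightarrow> 'c"  (\<open>_ \<odot>\<^bsub>_\<^esub> _\<close> [71, 0, 71] 70) where
  "\<sigma> \<odot>\<^bsub>M\<^esub> \<tau> = mo_tensor M \<rhd> \<llangle>\<sigma>, \<tau>\<rrangle>"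

definition unit_at :: "('o, 'f, 'c) monoidal \<Rightarrow> 'o \<Rightarrow> 'f" where
  "unit_at M X = mo_unit M \<cdot> !\<^sub>X"

definition assoc_at :: "('o, 'f, 'c) monoidal \<Rightarrow> 'f \<Rightarrow> 'f \<Rightarrow> 'f \<Rightarrow> 'c" where
  "assoc_at M f g h = mo_assoc M \<lhd> \<langle>f, \<langle>g, h\<rangle>\<rangle>"

definition lunit_at :: "('o, 'f, 'c) monoidal \<Rightarrow> 'f \<Rightarrow> 'c" where
  "lunit_at M f = mo_lunit M \<lhd> f"

definition runit_at :: "('o, 'f, 'c) monoidal \<Rightarrow> 'f \<Rightarrow> 'c" where
  "runit_at M f = mo_runit M \<lhd> f"

definition phi_at :: "('o, 'f, 'c) oplax_mor \<Rightarrow> 'f \<Rightarrow> 'f \<Rightarrow> 'c" where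
  "phi_at m f g = om_phi m \<lhd> \<langle>f, g\<rangle>"

definition phi0_at :: "('o, 'f, 'c) oplax_mor \<Rightarrow> 'o \<Rightarrow> 'c" where
  "phi0_at m X = om_phi0 m \<lhd> !\<^sub>X"

text \<open>The typing part of the axioms, separated so that the calculus of generalized elements is available
  while the coherence axioms are still to be shown.\<close>

definition monoidal_data :: "('o, 'f, 'c) monoidal \<Rightarrow> bool" where
  "monoidal_data M \<longleftrightarrow>
     (let A = mo_ob M in
      A \<in> Obj D \<and> mo_tensor M \<in> hom1 D (prd P A A) A \<and> mo_unit M \<in> hom1 D (one P) A \<and>
      mo_assoc M \<in> hom2 D (q1 A \<otimes>\<^bsub>M\<^esub> (q2 A \<otimes>\<^bsub>M\<^esub> q3 A)) ((q1 A \<otimes>\<^bsub>M\<^esub> q2 A) \<otimes>\<^bsub>M\<^esub> q3 A) \<and>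
      mo_lunit M \<in> hom2 D (unit_at M A \<otimes>\<^bsub>M\<^esub> id1 D A) (id1 D A) \<and>
      mo_runit M \<in> hom2 D (id1 D A \<otimes>\<^bsub>M\<^esub> unit_at M A) (id1 D A))"

lemma monoidal_data_simps [simp]:
  assumes "monoidal_data M"
  shows "mo_ob M \<in> Obj D" "mo_tensor M \<in> Cell1 D" "dom1 D (mo_tensor M) = prd P (mo_ob M) (mo_ob M)"
    "cod1 D (mo_tensor M) = mo_ob M" "mo_unit M \<in> Cell1 D" "dom1 D (mo_unit M) = one P"
    "cod1 D (mo_unit M) = mo_ob M"
    "mo_assoc M \<in> Cell2 D"
    "dom2 D (mo_assoc M) = q1 (mo_ob M) \<otimes>\<^bsub>M\<^esub> (q2 (mo_ob M) \<otimes>\<^bsub>M\<^esub> q3 (mo_ob M))"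
    "cod2 D (mo_assoc M) = (q1 (mo_ob M) \<otimes>\<^bsub>M\<^esub> q2 (mo_ob M)) \<otimes>\<^bsub>M\<^esub> q3 (mo_ob M)"
    "mo_lunit M \<in> Cell2 D" "dom2 D (mo_lunit M) = unit_at M (mo_ob M) \<otimes>\<^bsub>M\<^esub> id1 D (mo_ob M)"
    "cod2 D (mo_lunit M) = id1 D (mo_ob M)"
    "mo_runit M \<in> Cell2 D" "dom2 D (mo_runit M) = id1 D (mo_ob M) \<otimes>\<^bsub>M\<^esub> unit_at M (mo_ob M)"
    "cod2 D (mo_runit M) = id1 D (mo_ob M)"
  using assms unfolding monoidal_data_def Let_def by simp_all

lemma is_monoidal_iff:
  "is_monoidal D P M \<longleftrightarrow> monoidal_data M \<and>
      invertible2 D (mo_assoc M) \<and> invertible2 D (mo_lunit M) \<and> invertible2 D (mo_runit M) \<and>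
      pentagon D P (mo_ob M) (mo_tensor M) (mo_assoc M) \<and>
      triangle D P (mo_ob M) (mo_tensor M) (mo_unit M) (mo_assoc M) (mo_lunit M) (mo_runit M)"
  by (cases M) (auto simp add: is_monoidal_def monoidal_data_def pow3_proj_def q_defs tens_def unit_at_def Let_def)

lemma is_monoidal_data [simp]: "is_monoidal D P M \<Longrightarrow> monoidal_data M"
  unfolding is_monoidal_iff by blast

lemma tens_simps [simp]:
  assumes "monoidal_data M" "f \<in> Cell1 D" "g \<in> Cell1 D" "cod1 D f = mo_ob M" "cod1 D g = mo_ob M" "dom1 D g = dom1 D f"
  shows "f \<otimes>\<^bsub>M\<^esub> g \<in> Cell1 D" "dom1 D (f \<otimes>\<^bsub>M\<^esub> g) = dom1 D f" "cod1 D (f \<otimes>\<^bsub>M\<^esub> g) = mo_ob M"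
  using assms by (simp_all add: tens_def)

lemma tens_comp [simp]:
  assumes "monoidal_data M" "f \<in> Cell1 D" "g \<in> Cell1 D" "cod1 D f = mo_ob M" "cod1 D g = mo_ob M"
    "h \<in> Cell1 D" "dom1 D f = cod1 D h" "dom1 D g = cod1 D h"
  shows "(f \<otimes>\<^bsub>M\<^esub> g) \<cdot> h = f \<cdot> h \<otimes>\<^bsub>M\<^esub> g \<cdot> h"
  using assms by (simp add: tens_def)

lemma tens_pr: "monoidal_data M \<Longrightarrow> A = mo_ob M \<Longrightarrow> pr1 P A A \<otimes>\<^bsub>M\<^esub> pr2 P A A = mo_tensor M"
  by (simp add: tens_def)

lemma tensc_simps [simp]:
  assumes "monoidal_data M" "\<sigma> \<in> Cell2 D" "\<tau> \<in> Cell2 D" "cod1 D (dom2 D \<sigma>) = mo_ob M"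
    "cod1 D (dom2 D \<tau>) = mo_ob M" "dom1 D (dom2 D \<tau>) = dom1 D (dom2 D \<sigma>)"
  shows "\<sigma> \<odot>\<^bsub>M\<^esub> \<tau> \<in> Cell2 D" "dom2 D (\<sigma> \<odot>\<^bsub>M\<^esub> \<tau>) = dom2 D \<sigma> \<otimes>\<^bsub>M\<^esub> dom2 D \<tau>"
    "cod2 D (\<sigma> \<odot>\<^bsub>M\<^esub> \<tau>) = cod2 D \<sigma> \<otimes>\<^bsub>M\<^esub> cod2 D \<tau>"
  using assms by (simp_all add: tens_def tensc_def)

lemma tensc_id2 [simp]:
  assumes "monoidal_data M" "f \<in> Cell1 D" "g \<in> Cell1 D" "cod1 D f = mo_ob M" "cod1 D g = mo_ob M" "dom1 D g = dom1 D f"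
  shows "id2 D f \<odot>\<^bsub>M\<^esub> id2 D g = id2 D (f \<otimes>\<^bsub>M\<^esub> g)"
  using assms by (simp add: tens_def tensc_def)

lemma tensc_vcomp [simp]:
  assumes "monoidal_data M" "\<sigma> \<in> Cell2 D" "\<tau> \<in> Cell2 D" "cod1 D (dom2 D \<sigma>) = mo_ob M"
    "cod1 D (dom2 D \<tau>) = mo_ob M" "dom1 D (dom2 D \<tau>) = dom1 D (dom2 D \<sigma>)"
    "\<sigma>' \<in> Cell2 D" "\<tau>' \<in> Cell2 D" "dom2 D \<sigma>' = cod2 D \<sigma>" "dom2 D \<tau>' = cod2 D \<tau>"
  shows "(\<sigma>' \<odot>\<^bsub>M\<^esub> \<tau>') \<bullet> (\<sigma> \<odot>\<^bsub>M\<^esub> \<tau>) = (\<sigma>' \<bullet> \<sigma>) \<odot>\<^bsub>M\<^esub> (\<tau>' \<bullet> \<tau>)"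
  using assms post_whisker_vcomp[of "mo_tensor M" "\<llangle>\<sigma>, \<tau>\<rrangle>" "\<llangle>\<sigma>', \<tau>'\<rrangle>"]
  by (simp add: tensc_def del: post_whisker_vcomp)

text \<open>Adjacent tensor products are merged into one tensor product of composites; this is the
  form of \<open>tensc_vcomp\<close> that still applies when another factor follows.\<close>

lemma tensc_vcomp_reassoc [simp]:
  assumes "monoidal_data M" "\<sigma> \<in> Cell2 D" "\<tau> \<in> Cell2 D" "cod1 D (dom2 D \<sigma>) = mo_ob M"
    "cod1 D (dom2 D \<tau>) = mo_ob M" "dom1 D (dom2 D \<tau>) = dom1 D (dom2 D \<sigma>)"
    "\<sigma>' \<in> Cell2 D" "\<tau>' \<in> Cell2 D" "dom2 D \<sigma>' = cod2 D \<sigma>" "dom2 D \<tau>' = cod2 D \<tau>"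
    "\<rho> \<in> Cell2 D" "cod2 D \<rho> = dom2 D \<sigma> \<otimes>\<^bsub>M\<^esub> dom2 D \<tau>"
  shows "(\<sigma>' \<odot>\<^bsub>M\<^esub> \<tau>') \<bullet> (\<sigma> \<odot>\<^bsub>M\<^esub> \<tau>) \<bullet> \<rho> = ((\<sigma>' \<bullet> \<sigma>) \<odot>\<^bsub>M\<^esub> (\<tau>' \<bullet> \<tau>)) \<bullet> \<rho>"
  by (rule vcomp_reassoc[OF tensc_vcomp]) (use assms in simp_all)

lemma tensc_pre_whisker [simp]:
  assumes "monoidal_data M" "\<sigma> \<in> Cell2 D" "\<tau> \<in> Cell2 D" "cod1 D (dom2 D \<sigma>) = mo_ob M"
    "cod1 D (dom2 D \<tau>) = mo_ob M" "h \<in> Cell1 D" "dom1 D (dom2 D \<sigma>) = cod1 D h" "dom1 D (dom2 D \<tau>) = cod1 D h"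
  shows "(\<sigma> \<odot>\<^bsub>M\<^esub> \<tau>) \<lhd> h = (\<sigma> \<lhd> h) \<odot>\<^bsub>M\<^esub> (\<tau> \<lhd> h)"
  using assms by (simp add: tensc_def)

lemma tens_post_whisker [simp]:
  assumes "monoidal_data M" "f \<in> Cell1 D" "g \<in> Cell1 D" "cod1 D f = mo_ob M" "cod1 D g = mo_ob M"
    "\<rho> \<in> Cell2 D" "dom1 D f = cod1 D (dom2 D \<rho>)" "dom1 D g = cod1 D (dom2 D \<rho>)"
  shows "(f \<otimes>\<^bsub>M\<^esub> g) \<rhd> \<rho> = (f \<rhd> \<rho>) \<odot>\<^bsub>M\<^esub> (g \<rhd> \<rho>)"
  using assms by (simp add: tens_def tensc_def)

lemma unit_at_simps [simp]:
  assumes "monoidal_data M" "X \<in> Obj D"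
  shows "unit_at M X \<in> Cell1 D" "dom1 D (unit_at M X) = X" "cod1 D (unit_at M X) = mo_ob M"
  using assms by (simp_all add: unit_at_def)

lemma unit_at_comp [simp]:
  assumes "monoidal_data M" "f \<in> Cell1 D" "cod1 D f = X"
  shows "unit_at M X \<cdot> f = unit_at M (dom1 D f)"
  using assms by (auto simp: unit_at_def)

lemma unit_at_one: "monoidal_data M \<Longrightarrow> unit_at M (one P) = mo_unit M"
  by (simp add: unit_at_def)

lemma assoc_at_simps [simp]:
  assumes "monoidal_data M" "f \<in> Cell1 D" "g \<in> Cell1 D" "h \<in> Cell1 D" "cod1 D f = mo_ob M" "cod1 D g = mo_ob M"
    "cod1 D h = mo_ob M" "dom1 D g = dom1 D f" "dom1 D h = dom1 D f"
  shows "assoc_at M f g h \<in> Cell2 D" "dom2 D (assoc_at M f g h) = f \<otimes>\<^bsub>M\<^esub> (g \<otimes>\<^bsub>M\<^esub> h)"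
    "cod2 D (assoc_at M f g h) = (f \<otimes>\<^bsub>M\<^esub> g) \<otimes>\<^bsub>M\<^esub> h"
  using assms by (simp_all add: assoc_at_def tens_def)

lemma assoc_at_pre_whisker [simp]:
  assumes "monoidal_data M" "f \<in> Cell1 D" "g \<in> Cell1 D" "h \<in> Cell1 D" "cod1 D f = mo_ob M" "cod1 D g = mo_ob M"
    "cod1 D h = mo_ob M" "k \<in> Cell1 D" "dom1 D f = cod1 D k" "dom1 D g = cod1 D k" "dom1 D h = cod1 D k"
  shows "assoc_at M f g h \<lhd> k = assoc_at M (f \<cdot> k) (g \<cdot> k) (h \<cdot> k)"
  using assms by (simp add: assoc_at_def)

lemma lunit_at_simps [simp]:
  assumes "monoidal_data M" "f \<in> Cell1 D" "cod1 D f = mo_ob M"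
  shows "lunit_at M f \<in> Cell2 D" "dom2 D (lunit_at M f) = unit_at M (dom1 D f) \<otimes>\<^bsub>M\<^esub> f"
    "cod2 D (lunit_at M f) = f"
    "runit_at M f \<in> Cell2 D" "dom2 D (runit_at M f) = f \<otimes>\<^bsub>M\<^esub> unit_at M (dom1 D f)"
    "cod2 D (runit_at M f) = f"
  using assms by (simp_all add: tens_def unit_at_def lunit_at_def runit_at_def)

lemma lunit_at_pre_whisker [simp]:
  assumes "monoidal_data M" "f \<in> Cell1 D" "cod1 D f = mo_ob M" "k \<in> Cell1 D" "dom1 D f = cod1 D k"
  shows "lunit_at M f \<lhd> k = lunit_at M (f \<cdot> k)" "runit_at M f \<lhd> k = runit_at M (f \<cdot> k)"
  using assms by (simp_all add: lunit_at_def runit_at_def)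

text \<open>The coherence axioms are imposed at the projections from the powers of the object. Whiskering
  with a tuple of 1-cells yields them at arbitrary generalized elements.\<close>

lemma pentagon_iff:
  "pentagon D P (mo_ob M) (mo_tensor M) (mo_assoc M) \<longleftrightarrow>
    (let A = mo_ob M in
     (assoc_at M (p1 A) (p2 A) (p3 A) \<odot>\<^bsub>M\<^esub> id2 D (p4 A))
       \<bullet> assoc_at M (p1 A) (p2 A \<otimes>\<^bsub>M\<^esub> p3 A) (p4 A) \<bullet> (id2 D (p1 A) \<odot>\<^bsub>M\<^esub> assoc_at M (p2 A) (p3 A) (p4 A))
     = assoc_at M (p1 A \<otimes>\<^bsub>M\<^esub> p2 A) (p3 A) (p4 A) \<bullet> assoc_at M (p1 A) (p2 A) (p3 A \<otimes>\<^bsub>M\<^esub> p4 A))"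
  unfolding pentagon_def tens_def tensc_def assoc_at_def Let_def pow4_proj_def pow3_proj_def pow3_def
    p_defs q_defs prod.case ..

lemma triangle_iff:
  "triangle D P (mo_ob M) (mo_tensor M) (mo_unit M) (mo_assoc M) (mo_lunit M) (mo_runit M) \<longleftrightarrow>
    (let A = mo_ob M; p = pr1 P A A; p' = pr2 P A A in
     (runit_at M p \<odot>\<^bsub>M\<^esub> id2 D p') \<bullet> assoc_at M p (unit_at M (prd P A A)) p' = id2 D p \<odot>\<^bsub>M\<^esub> lunit_at M p')"
  unfolding triangle_def tens_def tensc_def assoc_at_def unit_at_def lunit_at_def runit_at_def Let_def ..

lemma pentagon_at:
  assumes M: "is_monoidal D P M"
    and f: "f \<in> hom1 D X (mo_ob M)" "g \<in> hom1 D X (mo_ob M)" "h \<in> hom1 D X (mo_ob M)" "k \<in> hom1 D X (mo_ob M)"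
  shows "(assoc_at M f g h \<odot>\<^bsub>M\<^esub> id2 D k) \<bullet> assoc_at M f (g \<otimes>\<^bsub>M\<^esub> h) k \<bullet> (id2 D f \<odot>\<^bsub>M\<^esub> assoc_at M g h k)
     = assoc_at M (f \<otimes>\<^bsub>M\<^esub> g) h k \<bullet> assoc_at M f g (h \<otimes>\<^bsub>M\<^esub> k)"
proof -
  have "pentagon D P (mo_ob M) (mo_tensor M) (mo_assoc M)" using M unfolding is_monoidal_iff Let_def by blast
  then show ?thesis
    unfolding pentagon_iff Let_def
    using M f by (drule_tac arg_cong[where f = "\<lambda>\<rho>. \<rho> \<lhd> \<langle>f, \<langle>g, \<langle>h, k\<rangle>\<rangle>\<rangle>"]) simp
qed

lemma triangle_at:
  assumes M: "is_monoidal D P M" and f: "f \<in> hom1 D X (mo_ob M)" "g \<in> hom1 D X (mo_ob M)"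
  shows "(runit_at M f \<odot>\<^bsub>M\<^esub> id2 D g) \<bullet> assoc_at M f (unit_at M X) g = id2 D f \<odot>\<^bsub>M\<^esub> lunit_at M g"
proof -
  have "triangle D P (mo_ob M) (mo_tensor M) (mo_unit M) (mo_assoc M) (mo_lunit M) (mo_runit M)"
    using M unfolding is_monoidal_iff Let_def by blast
  then show ?thesis
    unfolding triangle_iff Let_def
    using M f by (drule_tac arg_cong[where f = "\<lambda>\<rho>. \<rho> \<lhd> \<langle>f, g\<rangle>"]) auto
qed

section \<open>Oplax monoidal morphisms\<close>

text \<open>The typing part of \<open>is_oplax_mor\<close>, split off for the same reason as
  \<open>monoidal_data\<close>: a lifted morphism has to be computed with before its axioms are
  known.\<close>

definition oplax_data :: "('o, 'f, 'c) oplax_mor \<Rightarrow> bool" where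
  "oplax_data m \<longleftrightarrow> (let M = om_dom m; N = om_cod m; A = mo_ob M; F = om_cell m in
     monoidal_data M \<and> monoidal_data N \<and>
     F \<in> hom1 D A (mo_ob N) \<and>
     om_phi m \<in> hom2 D (F \<cdot> mo_tensor M) (F \<cdot> pr1 P A A \<otimes>\<^bsub>N\<^esub> F \<cdot> pr2 P A A) \<and>
     om_phi0 m \<in> hom2 D (F \<cdot> mo_unit M) (mo_unit N))"

lemma is_oplax_mor_iff:
  "is_oplax_mor D P m \<longleftrightarrow>
     (let M = om_dom m; N = om_cod m; A = mo_ob M; F = om_cell m in
       is_monoidal D P M \<and> is_monoidal D P N \<and> oplax_data m \<and>
       assoc_at N (F \<cdot> q1 A) (F \<cdot> q2 A) (F \<cdot> q3 A)
         \<bullet> (id2 D (F \<cdot> q1 A) \<odot>\<^bsub>N\<^esub> phi_at m (q2 A) (q3 A)) \<bullet> phi_at m (q1 A) (q2 A \<otimes>\<^bsub>M\<^esub> q3 A)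
       = (phi_at m (q1 A) (q2 A) \<odot>\<^bsub>N\<^esub> id2 D (F \<cdot> q3 A)) \<bullet> phi_at m (q1 A \<otimes>\<^bsub>M\<^esub> q2 A) (q3 A) \<bullet> (F \<rhd> mo_assoc M) \<and>
       runit_at N F \<bullet> (id2 D F \<odot>\<^bsub>N\<^esub> phi0_at m A) \<bullet> phi_at m (id1 D A) (unit_at M A) = F \<rhd> mo_runit M \<and>
       lunit_at N F \<bullet> (phi0_at m A \<odot>\<^bsub>N\<^esub> id2 D F) \<bullet> phi_at m (unit_at M A) (id1 D A) = F \<rhd> mo_lunit M)"
  by (cases m; cases "om_dom m"; cases "om_cod m")
    (auto simp: is_oplax_mor_def oplax_data_def pow3_proj_def q_defs tens_def tensc_def unit_at_def assoc_at_def
      phi_at_def phi0_at_def lunit_at_def runit_at_def Let_def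
      simp del: vcomp_assoc' comp1_assoc' pair_pr_comp)

lemma oplax_data_simps [simp]:
  assumes "oplax_data m"
  shows "monoidal_data (om_dom m)" "monoidal_data (om_cod m)"
    "om_cell m \<in> Cell1 D" "dom1 D (om_cell m) = mo_ob (om_dom m)" "cod1 D (om_cell m) = mo_ob (om_cod m)"
    "om_phi m \<in> Cell2 D" "dom2 D (om_phi m) = om_cell m \<cdot> mo_tensor (om_dom m)"
    "cod2 D (om_phi m) = om_cell m \<cdot> pr1 P (mo_ob (om_dom m)) (mo_ob (om_dom m))
      \<otimes>\<^bsub>om_cod m\<^esub> om_cell m \<cdot> pr2 P (mo_ob (om_dom m)) (mo_ob (om_dom m))"
    "om_phi0 m \<in> Cell2 D" "dom2 D (om_phi0 m) = om_cell m \<cdot> mo_unit (om_dom m)"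
    "cod2 D (om_phi0 m) = mo_unit (om_cod m)"
  using assms unfolding oplax_data_def Let_def by simp_all

lemma oplax_mor_simps [simp]:
  assumes "is_oplax_mor D P m"
  shows "oplax_data m" "is_monoidal D P (om_dom m)" "is_monoidal D P (om_cod m)"
  using assms unfolding is_oplax_mor_iff Let_def by simp_all

lemma phi_at_simps [simp]:
  assumes "oplax_data m" "f \<in> Cell1 D" "g \<in> Cell1 D" "cod1 D f = mo_ob (om_dom m)" "cod1 D g = mo_ob (om_dom m)"
    "dom1 D g = dom1 D f"
  shows "phi_at m f g \<in> Cell2 D" "dom2 D (phi_at m f g) = om_cell m \<cdot> (f \<otimes>\<^bsub>om_dom m\<^esub> g)"
    "cod2 D (phi_at m f g) = om_cell m \<cdot> f \<otimes>\<^bsub>om_cod m\<^esub> om_cell m \<cdot> g"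
  using assms by (simp_all add: phi_at_def tens_def)

lemma phi_at_pre_whisker [simp]:
  assumes "oplax_data m" "f \<in> Cell1 D" "g \<in> Cell1 D" "cod1 D f = mo_ob (om_dom m)" "cod1 D g = mo_ob (om_dom m)"
    "k \<in> Cell1 D" "dom1 D f = cod1 D k" "dom1 D g = cod1 D k"
  shows "phi_at m f g \<lhd> k = phi_at m (f \<cdot> k) (g \<cdot> k)"
  using assms by (simp add: phi_at_def)

lemma phi_at_pr: "oplax_data m \<Longrightarrow> A = mo_ob (om_dom m) \<Longrightarrow> phi_at m (pr1 P A A) (pr2 P A A) = om_phi m"
  by (simp add: phi_at_def)

lemma phi0_at_simps [simp]:
  assumes "oplax_data m" "X \<in> Obj D"
  shows "phi0_at m X \<in> Cell2 D" "dom2 D (phi0_at m X) = om_cell m \<cdot> unit_at (om_dom m) X"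
    "cod2 D (phi0_at m X) = unit_at (om_cod m) X"
  using assms by (simp_all add: phi0_at_def unit_at_def)

lemma phi0_at_pre_whisker [simp]:
  assumes "oplax_data m" "k \<in> Cell1 D" "cod1 D k = X"
  shows "phi0_at m X \<lhd> k = phi0_at m (dom1 D k)"
  using assms by (auto simp: phi0_at_def)

lemma phi0_at_one: "oplax_data m \<Longrightarrow> phi0_at m (one P) = om_phi0 m"
  by (simp add: phi0_at_def)

lemma oplax_assoc_at:
  assumes m: "is_oplax_mor D P m"
    and f: "f \<in> hom1 D X (mo_ob (om_dom m))" "g \<in> hom1 D X (mo_ob (om_dom m))" "h \<in> hom1 D X (mo_ob (om_dom m))"
  defines "F \<equiv> om_cell m" and "M \<equiv> om_dom m" and "N \<equiv> om_cod m"
  shows "assoc_at N (F \<cdot> f) (F \<cdot> g) (F \<cdot> h) \<bullet> (id2 D (F \<cdot> f) \<odot>\<^bsub>N\<^esub> phi_at m g h) \<bullet> phi_at m f (g \<otimes>\<^bsub>M\<^esub> h)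
    = (phi_at m f g \<odot>\<^bsub>N\<^esub> id2 D (F \<cdot> h)) \<bullet> phi_at m (f \<otimes>\<^bsub>M\<^esub> g) h \<bullet> (F \<rhd> assoc_at M f g h)"
proof -
  let ?A = "mo_ob M"
  have "assoc_at N (F \<cdot> q1 ?A) (F \<cdot> q2 ?A) (F \<cdot> q3 ?A)
         \<bullet> (id2 D (F \<cdot> q1 ?A) \<odot>\<^bsub>N\<^esub> phi_at m (q2 ?A) (q3 ?A)) \<bullet> phi_at m (q1 ?A) (q2 ?A \<otimes>\<^bsub>M\<^esub> q3 ?A)
       = (phi_at m (q1 ?A) (q2 ?A) \<odot>\<^bsub>N\<^esub> id2 D (F \<cdot> q3 ?A)) \<bullet> phi_at m (q1 ?A \<otimes>\<^bsub>M\<^esub> q2 ?A) (q3 ?A) \<bullet> (F \<rhd> mo_assoc M)"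
    using m unfolding is_oplax_mor_iff Let_def F_def M_def N_def by blast
  then show ?thesis
    using m f by (drule_tac arg_cong[where f = "\<lambda>\<rho>. \<rho> \<lhd> \<langle>f, \<langle>g, h\<rangle>\<rangle>"]) (simp add: F_def M_def N_def flip: assoc_at_def)
qed

lemma oplax_runit_at:
  assumes m: "is_oplax_mor D P m" and f: "f \<in> hom1 D X (mo_ob (om_dom m))"
  defines "F \<equiv> om_cell m" and "M \<equiv> om_dom m" and "N \<equiv> om_cod m"
  shows "runit_at N (F \<cdot> f) \<bullet> (id2 D (F \<cdot> f) \<odot>\<^bsub>N\<^esub> phi0_at m X) \<bullet> phi_at m f (unit_at M X) = F \<rhd> runit_at M f"
proof -
  have "runit_at N F \<bullet> (id2 D F \<odot>\<^bsub>N\<^esub> phi0_at m (mo_ob M)) \<bullet> phi_at m (id1 D (mo_ob M)) (unit_at M (mo_ob M)) = F \<rhd> mo_runit M"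
    using m unfolding is_oplax_mor_iff Let_def F_def M_def N_def by blast
  then show ?thesis
    using m f by (drule_tac arg_cong[where f = "\<lambda>\<rho>. \<rho> \<lhd> f"]) (auto simp: F_def M_def N_def simp flip: lunit_at_def runit_at_def)
qed

lemma oplax_lunit_at:
  assumes m: "is_oplax_mor D P m" and f: "f \<in> hom1 D X (mo_ob (om_dom m))"
  defines "F \<equiv> om_cell m" and "M \<equiv> om_dom m" and "N \<equiv> om_cod m"
  shows "lunit_at N (F \<cdot> f) \<bullet> (phi0_at m X \<odot>\<^bsub>N\<^esub> id2 D (F \<cdot> f)) \<bullet> phi_at m (unit_at M X) f = F \<rhd> lunit_at M f"
proof -
  have "lunit_at N F \<bullet> (phi0_at m (mo_ob M) \<odot>\<^bsub>N\<^esub> id2 D F) \<bullet> phi_at m (unit_at M (mo_ob M)) (id1 D (mo_ob M)) = F \<rhd> mo_lunit M"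
    using m unfolding is_oplax_mor_iff Let_def F_def M_def N_def by blast
  then show ?thesis
    using m f by (drule_tac arg_cong[where f = "\<lambda>\<rho>. \<rho> \<lhd> f"]) (auto simp: F_def M_def N_def simp flip: lunit_at_def runit_at_def)
qed

text \<open>Interchange of \<open>om_phi m\<close> with the pair of \<sigma> and \<tau>. On
  generalized elements this is naturality in both arguments; the associator and the unitors are
  treated alike below.\<close>

lemma phi_natural:
  assumes m: "is_oplax_mor D P m" and \<sigma>: "\<sigma> \<in> hom2 D f f'" "\<tau> \<in> hom2 D g g'"
    and f: "f \<in> hom1 D X (mo_ob (om_dom m))" "g \<in> hom1 D X (mo_ob (om_dom m))"
  shows "phi_at m f' g' \<bullet> (om_cell m \<rhd> (\<sigma> \<odot>\<^bsub>om_dom m\<^esub> \<tau>))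
    = ((om_cell m \<rhd> \<sigma>) \<odot>\<^bsub>om_cod m\<^esub> (om_cell m \<rhd> \<tau>)) \<bullet> phi_at m f g"
proof -
  have "dom1 D f' = X" "cod1 D f' = mo_ob (om_dom m)" "dom1 D g' = X" "cod1 D g' = mo_ob (om_dom m)" "f' \<in> Cell1 D" "g' \<in> Cell1 D"
    using globular[of \<sigma>] globular[of \<tau>] \<sigma> f by auto
  note f' = this
  let ?F = "om_cell m" and ?M = "om_dom m" and ?N = "om_cod m"
  let ?p1 = "pr1 P (mo_ob ?M) (mo_ob ?M)" and ?p2 = "pr2 P (mo_ob ?M) (mo_ob ?M)"
  have "(om_phi m \<lhd> \<langle>f', g'\<rangle>) \<bullet> ((?F \<cdot> mo_tensor ?M) \<rhd> \<llangle>\<sigma>, \<tau>\<rrangle>)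
    = ((?F \<cdot> ?p1 \<otimes>\<^bsub>?N\<^esub> ?F \<cdot> ?p2) \<rhd> \<llangle>\<sigma>, \<tau>\<rrangle>) \<bullet> (om_phi m \<lhd> \<langle>f, g\<rangle>)"
    by (rule whisker_swap) (use m \<sigma> f f' in simp_all)
  then show ?thesis
    using m \<sigma> f f' by (simp flip: phi_at_def tensc_def)
qed

lemma assoc_natural:
  assumes M: "is_monoidal D P M" and \<sigma>: "\<rho> \<in> hom2 D f f'" "\<sigma> \<in> hom2 D g g'" "\<tau> \<in> hom2 D h h'"
    and f: "f \<in> hom1 D X (mo_ob M)" "g \<in> hom1 D X (mo_ob M)" "h \<in> hom1 D X (mo_ob M)"
  shows "assoc_at M f' g' h' \<bullet> (\<rho> \<odot>\<^bsub>M\<^esub> (\<sigma> \<odot>\<^bsub>M\<^esub> \<tau>)) = ((\<rho> \<odot>\<^bsub>M\<^esub> \<sigma>) \<odot>\<^bsub>M\<^esub> \<tau>) \<bullet> assoc_at M f g h"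
proof -
  have f': "dom1 D f' = X" "cod1 D f' = mo_ob M" "dom1 D g' = X" "cod1 D g' = mo_ob M" "dom1 D h' = X" "cod1 D h' = mo_ob M"
    "f' \<in> Cell1 D" "g' \<in> Cell1 D" "h' \<in> Cell1 D"
    using globular[of \<rho>] globular[of \<sigma>] globular[of \<tau>] \<sigma> f by auto
  have q: "q1 (mo_ob M) \<rhd> \<llangle>\<rho>, \<llangle>\<sigma>, \<tau>\<rrangle>\<rrangle> = \<rho>" "q2 (mo_ob M) \<rhd> \<llangle>\<rho>, \<llangle>\<sigma>, \<tau>\<rrangle>\<rrangle> = \<sigma>" "q3 (mo_ob M) \<rhd> \<llangle>\<rho>, \<llangle>\<sigma>, \<tau>\<rrangle>\<rrangle> = \<tau>"
    using M \<sigma> f by (simp_all add: q_defs)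
  have "(mo_assoc M \<lhd> \<langle>f', \<langle>g', h'\<rangle>\<rangle>) \<bullet> ((q1 (mo_ob M) \<otimes>\<^bsub>M\<^esub> (q2 (mo_ob M) \<otimes>\<^bsub>M\<^esub> q3 (mo_ob M))) \<rhd> \<llangle>\<rho>, \<llangle>\<sigma>, \<tau>\<rrangle>\<rrangle>)
    = (((q1 (mo_ob M) \<otimes>\<^bsub>M\<^esub> q2 (mo_ob M)) \<otimes>\<^bsub>M\<^esub> q3 (mo_ob M)) \<rhd> \<llangle>\<rho>, \<llangle>\<sigma>, \<tau>\<rrangle>\<rrangle>) \<bullet> (mo_assoc M \<lhd> \<langle>f, \<langle>g, h\<rangle>\<rangle>)"
    by (rule whisker_swap) (use M \<sigma> f f' in \<open>simp_all add: tens_def\<close>)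
  then show ?thesis
    unfolding assoc_at_def using M \<sigma> f by (simp add: q)
qed

lemma lunit_natural:
  assumes M: "is_monoidal D P M" and \<sigma>: "\<sigma> \<in> hom2 D f f'" and f: "f \<in> hom1 D X (mo_ob M)"
  shows "lunit_at M f' \<bullet> (id2 D (unit_at M X) \<odot>\<^bsub>M\<^esub> \<sigma>) = \<sigma> \<bullet> lunit_at M f"
    and "runit_at M f' \<bullet> (\<sigma> \<odot>\<^bsub>M\<^esub> id2 D (unit_at M X)) = \<sigma> \<bullet> runit_at M f"
proof -
  let ?A = "mo_ob M" 
  have f': "dom1 D f' = X" "cod1 D f' = mo_ob M" "f' \<in> Cell1 D" and X: "X \<in> Obj D"
    using globular[of \<sigma>] \<sigma> f by auto
  \<comment> \<open>2-cells between equal 1-cells into the terminal object are identities, so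
    \<sigma> has no effect on the unit as a generalized element.\<close>
  have "!\<^sub>?A \<rhd> \<sigma> = id2 D !\<^sub>X"
    by (rule one_eqI2) (use M \<sigma> f f' X in simp_all)
  then have u: "unit_at M ?A \<rhd> \<sigma> = id2 D (unit_at M X)"
    using M \<sigma> f X by (simp add: unit_at_def)
  have "(mo_lunit M \<lhd> f') \<bullet> ((unit_at M ?A \<otimes>\<^bsub>M\<^esub> id1 D ?A) \<rhd> \<sigma>) = (id1 D ?A \<rhd> \<sigma>) \<bullet> (mo_lunit M \<lhd> f)"
    by (rule whisker_swap) (use M \<sigma> f f' in simp_all)
  then show "lunit_at M f' \<bullet> (id2 D (unit_at M X) \<odot>\<^bsub>M\<^esub> \<sigma>) = \<sigma> \<bullet> lunit_at M f"
    using M \<sigma> f f' by (simp add: u flip: lunit_at_def runit_at_def)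
  have "(mo_runit M \<lhd> f') \<bullet> ((id1 D ?A \<otimes>\<^bsub>M\<^esub> unit_at M ?A) \<rhd> \<sigma>) = (id1 D ?A \<rhd> \<sigma>) \<bullet> (mo_runit M \<lhd> f)"
    by (rule whisker_swap) (use M \<sigma> f f' in simp_all)
  then show "runit_at M f' \<bullet> (\<sigma> \<odot>\<^bsub>M\<^esub> id2 D (unit_at M X)) = \<sigma> \<bullet> runit_at M f"
    using M \<sigma> f f' by (simp add: u flip: lunit_at_def runit_at_def)
qed

text \<open>The converse of \<open>oplax_assoc_at\<close>, \<open>oplax_runit_at\<close> and
  \<open>oplax_lunit_at\<close>. Proofs about composites and lifts deliver the axioms at all
  generalized elements; the original axioms are the instance at the universal ones.\<close>

lemma is_oplax_morI:
  assumes "is_monoidal D P (om_dom m)" "is_monoidal D P (om_cod m)"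
    and "om_cell m \<in> hom1 D (mo_ob (om_dom m)) (mo_ob (om_cod m))"
    and "\<And>A. A = mo_ob (om_dom m) \<Longrightarrow> om_phi m \<in> hom2 D (om_cell m \<cdot> mo_tensor (om_dom m))
      (om_cell m \<cdot> pr1 P A A \<otimes>\<^bsub>om_cod m\<^esub> om_cell m \<cdot> pr2 P A A)"
    and "om_phi0 m \<in> hom2 D (om_cell m \<cdot> mo_unit (om_dom m)) (mo_unit (om_cod m))"
    and assoc: "\<And>X f g h. \<lbrakk>f \<in> hom1 D X (mo_ob (om_dom m)); g \<in> hom1 D X (mo_ob (om_dom m)); h \<in> hom1 D X (mo_ob (om_dom m))\<rbrakk> \<Longrightarrow>
      assoc_at (om_cod m) (om_cell m \<cdot> f) (om_cell m \<cdot> g) (om_cell m \<cdot> h)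
        \<bullet> (id2 D (om_cell m \<cdot> f) \<odot>\<^bsub>om_cod m\<^esub> phi_at m g h) \<bullet> phi_at m f (g \<otimes>\<^bsub>om_dom m\<^esub> h)
      = (phi_at m f g \<odot>\<^bsub>om_cod m\<^esub> id2 D (om_cell m \<cdot> h)) \<bullet> phi_at m (f \<otimes>\<^bsub>om_dom m\<^esub> g) h
        \<bullet> (om_cell m \<rhd> assoc_at (om_dom m) f g h)"
    and runit: "\<And>X f. f \<in> hom1 D X (mo_ob (om_dom m)) \<Longrightarrow>
      runit_at (om_cod m) (om_cell m \<cdot> f) \<bullet> (id2 D (om_cell m \<cdot> f) \<odot>\<^bsub>om_cod m\<^esub> phi0_at m X)
        \<bullet> phi_at m f (unit_at (om_dom m) X) = om_cell m \<rhd> runit_at (om_dom m) f"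
    and lunit: "\<And>X f. f \<in> hom1 D X (mo_ob (om_dom m)) \<Longrightarrow>
      lunit_at (om_cod m) (om_cell m \<cdot> f) \<bullet> (phi0_at m X \<odot>\<^bsub>om_cod m\<^esub> id2 D (om_cell m \<cdot> f))
        \<bullet> phi_at m (unit_at (om_dom m) X) f = om_cell m \<rhd> lunit_at (om_dom m) f"
  shows "is_oplax_mor D P m"
proof -
  let ?A = "mo_ob (om_dom m)"
  \<comment> \<open>The tuple of projections is the identity, so whiskering by it leaves the
    associator unchanged.\<close>
  have q: "\<langle>q1 ?A, \<langle>q2 ?A, q3 ?A\<rangle>\<rangle> = id1 D (prd P ?A (prd P ?A ?A))"
    using assms(1) by (simp add: q_defs)
  have "assoc_at (om_dom m) (q1 ?A) (q2 ?A) (q3 ?A) = mo_assoc (om_dom m)"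
    using assms(1) unfolding assoc_at_def q by simp
  moreover have "runit_at (om_dom m) (id1 D ?A) = mo_runit (om_dom m)"
    "lunit_at (om_dom m) (id1 D ?A) = mo_lunit (om_dom m)"
    using assms(1) by (simp_all add: runit_at_def lunit_at_def)
  ultimately show ?thesis
    using assms(1-5) assoc[of "q1 ?A" "prd P ?A (prd P ?A ?A)" "q2 ?A" "q3 ?A"]
      runit[of "id1 D ?A" ?A] lunit[of "id1 D ?A" ?A]
    unfolding is_oplax_mor_iff oplax_data_def Let_def by simp
qed

lemma is_oplax_trans_iff:
  "is_oplax_trans D P t \<longleftrightarrow> (let m = tr_dom t; m' = tr_cod t; M = om_dom m; N = om_cod m; A = mo_ob M; \<sigma> = tr_cell t in
     is_oplax_mor D P m \<and> is_oplax_mor D P m' \<and> om_dom m' = M \<and> om_cod m' = N \<and>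
     \<sigma> \<in> hom2 D (om_cell m) (om_cell m') \<and>
     om_phi m' \<bullet> (\<sigma> \<lhd> mo_tensor M) = ((\<sigma> \<lhd> pr1 P A A) \<odot>\<^bsub>N\<^esub> (\<sigma> \<lhd> pr2 P A A)) \<bullet> om_phi m \<and>
     om_phi0 m' \<bullet> (\<sigma> \<lhd> mo_unit M) = om_phi0 m)"
  by (cases t; cases "tr_dom t"; cases "tr_cod t") (simp add: is_oplax_trans_def tensc_def Let_def)

lemma oplax_trans_simps [simp]:
  assumes "is_oplax_trans D P t"
  shows "is_oplax_mor D P (tr_dom t)" "is_oplax_mor D P (tr_cod t)"
    "om_dom (tr_cod t) = om_dom (tr_dom t)" "om_cod (tr_cod t) = om_cod (tr_dom t)"
    "tr_cell t \<in> Cell2 D" "dom2 D (tr_cell t) = om_cell (tr_dom t)" "cod2 D (tr_cell t) = om_cell (tr_cod t)"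
  using assms unfolding is_oplax_trans_iff Let_def by simp_all

lemma oplax_trans_phi_at:
  assumes t: "is_oplax_trans D P t"
    and f: "f \<in> hom1 D X (mo_ob (om_dom (tr_dom t)))" "g \<in> hom1 D X (mo_ob (om_dom (tr_dom t)))"
  shows "phi_at (tr_cod t) f g \<bullet> (tr_cell t \<lhd> (f \<otimes>\<^bsub>om_dom (tr_dom t)\<^esub> g))
    = ((tr_cell t \<lhd> f) \<odot>\<^bsub>om_cod (tr_dom t)\<^esub> (tr_cell t \<lhd> g)) \<bullet> phi_at (tr_dom t) f g"
proof -
  let ?A = "mo_ob (om_dom (tr_dom t))"
  have "om_phi (tr_cod t) \<bullet> (tr_cell t \<lhd> mo_tensor (om_dom (tr_dom t)))
    = ((tr_cell t \<lhd> pr1 P ?A ?A) \<odot>\<^bsub>om_cod (tr_dom t)\<^esub> (tr_cell t \<lhd> pr2 P ?A ?A)) \<bullet> om_phi (tr_dom t)"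
    using t unfolding is_oplax_trans_iff Let_def by blast
  then show ?thesis
    using t f by (drule_tac arg_cong[where f = "\<lambda>\<rho>. \<rho> \<lhd> \<langle>f, g\<rangle>"]) (simp flip: phi_at_def tens_def)
qed

lemma oplax_trans_phi0_at:
  assumes t: "is_oplax_trans D P t" and X: "X \<in> Obj D"
  shows "phi0_at (tr_cod t) X \<bullet> (tr_cell t \<lhd> unit_at (om_dom (tr_dom t)) X) = phi0_at (tr_dom t) X"
proof -
  have "om_phi0 (tr_cod t) \<bullet> (tr_cell t \<lhd> mo_unit (om_dom (tr_dom t))) = om_phi0 (tr_dom t)"
    using t unfolding is_oplax_trans_iff Let_def by blast
  then show ?thesis
    using t X by (drule_tac arg_cong[where f = "\<lambda>\<rho>. \<rho> \<lhd> !\<^sub>X"]) (simp flip: phi0_at_def unit_at_def)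
qed

text \<open>The universal instances here are the two projections from the square and, for the unit,
  the object \<open>one P\<close>, whose map to the terminal object is the identity.\<close>

lemma is_oplax_transI:
  assumes m: "is_oplax_mor D P (tr_dom t)" "is_oplax_mor D P (tr_cod t)"
    "om_dom (tr_cod t) = om_dom (tr_dom t)" "om_cod (tr_cod t) = om_cod (tr_dom t)"
    and \<sigma>: "tr_cell t \<in> hom2 D (om_cell (tr_dom t)) (om_cell (tr_cod t))"
    and phi: "\<And>X f g. \<lbrakk>f \<in> hom1 D X (mo_ob (om_dom (tr_dom t))); g \<in> hom1 D X (mo_ob (om_dom (tr_dom t)))\<rbrakk> \<Longrightarrow>
      phi_at (tr_cod t) f g \<bullet> (tr_cell t \<lhd> (f \<otimes>\<^bsub>om_dom (tr_dom t)\<^esub> g))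
      = ((tr_cell t \<lhd> f) \<odot>\<^bsub>om_cod (tr_dom t)\<^esub> (tr_cell t \<lhd> g)) \<bullet> phi_at (tr_dom t) f g"
    and phi0: "\<And>X. X \<in> Obj D \<Longrightarrow>
      phi0_at (tr_cod t) X \<bullet> (tr_cell t \<lhd> unit_at (om_dom (tr_dom t)) X) = phi0_at (tr_dom t) X"
  shows "is_oplax_trans D P t"
proof -
  let ?A = "mo_ob (om_dom (tr_dom t))"
  show ?thesis
    using m \<sigma> phi[of "pr1 P ?A ?A" "prd P ?A ?A" "pr2 P ?A ?A"] phi0[of "one P"]
    unfolding is_oplax_trans_iff Let_def
    by (simp add: tens_pr phi_at_pr phi0_at_one unit_at_one)
qed

section \<open>Composition of oplax morphisms and whiskering of their transformations\<close>

abbreviation oplax_comp (infixr \<open>\<diamondop>\<close> 75) where "n \<diamondop> m \<equiv> oplax_mor_comp D P n m"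

lemma oplax_mor_comp_simps [simp]:
  "om_dom (n \<diamondop> m) = om_dom m" "om_cod (n \<diamondop> m) = om_cod n"
  "om_cell (n \<diamondop> m) = om_cell n \<cdot> om_cell m"
  "om_phi0 (n \<diamondop> m) = om_phi0 n \<bullet> (om_cell n \<rhd> om_phi0 m)"
  by (simp_all add: oplax_mor_comp_def Let_def)

lemma om_phi_comp:
  "om_phi (n \<diamondop> m) =
    phi_at n (om_cell m \<cdot> pr1 P (mo_ob (om_dom m)) (mo_ob (om_dom m))) (om_cell m \<cdot> pr2 P (mo_ob (om_dom m)) (mo_ob (om_dom m)))
      \<bullet> (om_cell n \<rhd> om_phi m)"
  by (simp add: oplax_mor_comp_def Let_def phi_at_def)

lemma phi_at_comp [simp]:
  assumes "is_oplax_mor D P m" "is_oplax_mor D P n" "om_dom n = om_cod m"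
    "f \<in> Cell1 D" "g \<in> Cell1 D" "cod1 D f = mo_ob (om_dom m)" "cod1 D g = mo_ob (om_dom m)" "dom1 D g = dom1 D f"
  shows "phi_at (n \<diamondop> m) f g = phi_at n (om_cell m \<cdot> f) (om_cell m \<cdot> g) \<bullet> (om_cell n \<rhd> phi_at m f g)"
  unfolding phi_at_def[of "(n \<diamondop> m)"] om_phi_comp using assms by (simp flip: phi_at_def)

lemma phi0_at_comp [simp]:
  assumes "is_oplax_mor D P m" "is_oplax_mor D P n" "om_dom n = om_cod m" "X \<in> Obj D"
  shows "phi0_at (n \<diamondop> m) X = phi0_at n X \<bullet> (om_cell n \<rhd> phi0_at m X)"
  using assms by (simp add: phi0_at_def)

text \<open>The axiom of \<open>n\<close> at the images of the elements and the axiom of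
  \<open>m\<close> under \<open>om_cell n\<close> are joined by naturality of the structure cell of
  \<open>n\<close>, applied to the structure cells of \<open>m\<close>. The unit axioms follow the
  same scheme, with \<open>phi0_at m X\<close> in that naturality square.\<close>

lemma is_oplax_mor_comp:
  assumes [simp]: "is_oplax_mor D P m" "is_oplax_mor D P n" "om_dom n = om_cod m"
  shows "is_oplax_mor D P (n \<diamondop> m)"
proof (rule is_oplax_morI)
  let ?c = "(n \<diamondop> m)"
  let ?F = "om_cell m" and ?G = "om_cell n"
  let ?M = "om_dom m" and ?M' = "om_cod m" and ?M'' = "om_cod n"
  show "is_monoidal D P (om_dom ?c)" "is_monoidal D P (om_cod ?c)"
    "om_cell ?c \<in> hom1 D (mo_ob (om_dom ?c)) (mo_ob (om_cod ?c))"
    "om_phi0 ?c \<in> hom2 D (om_cell ?c \<cdot> mo_unit (om_dom ?c)) (mo_unit (om_cod ?c))"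
    by simp_all
  show "om_phi ?c \<in> hom2 D (om_cell ?c \<cdot> mo_tensor (om_dom ?c))
      (om_cell ?c \<cdot> pr1 P A A \<otimes>\<^bsub>om_cod ?c\<^esub> om_cell ?c \<cdot> pr2 P A A)"
    if "A = mo_ob (om_dom ?c)" for A
    using that by (simp add: om_phi_comp)
  {
    fix X f g h
    assume "f \<in> hom1 D X (mo_ob (om_dom ?c))" "g \<in> hom1 D X (mo_ob (om_dom ?c))"
      "h \<in> hom1 D X (mo_ob (om_dom ?c))"
    note [simp] = hom1D[OF this(1)] hom1D[OF this(2)] hom1D[OF this(3)]
    let ?f = "?F \<cdot> f" and ?g = "?F \<cdot> g" and ?h = "?F \<cdot> h"
    let ?\<phi> = "phi_at m" and ?\<psi> = "phi_at n"
    have n: "assoc_at ?M'' (?G \<cdot> ?f) (?G \<cdot> ?g) (?G \<cdot> ?h) \<bullet> (id2 D (?G \<cdot> ?f) \<odot>\<^bsub>?M''\<^esub> ?\<psi> ?g ?h)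
        \<bullet> ?\<psi> ?f (?g \<otimes>\<^bsub>?M'\<^esub> ?h)
      = (?\<psi> ?f ?g \<odot>\<^bsub>?M''\<^esub> id2 D (?G \<cdot> ?h)) \<bullet> ?\<psi> (?f \<otimes>\<^bsub>?M'\<^esub> ?g) ?h
        \<bullet> (?G \<rhd> assoc_at ?M' ?f ?g ?h)"
      using oplax_assoc_at[of n "?f" X "?g" "?h"] by simp
    have m: "assoc_at ?M' ?f ?g ?h \<bullet> (id2 D ?f \<odot>\<^bsub>?M'\<^esub> ?\<phi> g h) \<bullet> ?\<phi> f (g \<otimes>\<^bsub>?M\<^esub> h)
      = (?\<phi> f g \<odot>\<^bsub>?M'\<^esub> id2 D ?h) \<bullet> ?\<phi> (f \<otimes>\<^bsub>?M\<^esub> g) h \<bullet> (?F \<rhd> assoc_at ?M f g h)"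
      using oplax_assoc_at[of m f X g h] by simp
    have nat: "(id2 D (?G \<cdot> ?f) \<odot>\<^bsub>?M''\<^esub> (?G \<rhd> ?\<phi> g h)) \<bullet> ?\<psi> ?f (?F \<cdot> (g \<otimes>\<^bsub>?M\<^esub> h))
      = ?\<psi> ?f (?g \<otimes>\<^bsub>?M'\<^esub> ?h) \<bullet> (?G \<rhd> (id2 D ?f \<odot>\<^bsub>?M'\<^esub> ?\<phi> g h))"
      using phi_natural[of n "id2 D ?f" "?f" "?f" "?\<phi> g h" "?F \<cdot> (g \<otimes>\<^bsub>?M\<^esub> h)" "?g \<otimes>\<^bsub>?M'\<^esub> ?h" X]
      by simp
    have nat': "?\<psi> (?f \<otimes>\<^bsub>?M'\<^esub> ?g) ?h \<bullet> (?G \<rhd> (?\<phi> f g \<odot>\<^bsub>?M'\<^esub> id2 D ?h))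
      = ((?G \<rhd> ?\<phi> f g) \<odot>\<^bsub>?M''\<^esub> id2 D (?G \<cdot> ?h)) \<bullet> ?\<psi> (?F \<cdot> (f \<otimes>\<^bsub>?M\<^esub> g)) ?h"
      using phi_natural[of n "?\<phi> f g" "?F \<cdot> (f \<otimes>\<^bsub>?M\<^esub> g)" "?f \<otimes>\<^bsub>?M'\<^esub> ?g" "id2 D ?h" "?h" "?h" X]
      by simp
    let ?a = "assoc_at ?M'' (?G \<cdot> ?f) (?G \<cdot> ?g) (?G \<cdot> ?h)"
    let ?b = "id2 D (?G \<cdot> ?f) \<odot>\<^bsub>?M''\<^esub> ?\<psi> ?g ?h"
    let ?d = "?\<psi> ?f ?g \<odot>\<^bsub>?M''\<^esub> id2 D (?G \<cdot> ?h)"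
    have "?a \<bullet> (id2 D (?G \<cdot> ?f) \<odot>\<^bsub>?M''\<^esub> (?\<psi> ?g ?h \<bullet> (?G \<rhd> ?\<phi> g h)))
        \<bullet> ?\<psi> ?f (?F \<cdot> (g \<otimes>\<^bsub>?M\<^esub> h)) \<bullet> (?G \<rhd> ?\<phi> f (g \<otimes>\<^bsub>?M\<^esub> h))
      = ?a \<bullet> ?b \<bullet> ((id2 D (?G \<cdot> ?f) \<odot>\<^bsub>?M''\<^esub> (?G \<rhd> ?\<phi> g h)) \<bullet> ?\<psi> ?f (?F \<cdot> (g \<otimes>\<^bsub>?M\<^esub> h)))
        \<bullet> (?G \<rhd> ?\<phi> f (g \<otimes>\<^bsub>?M\<^esub> h))"
      by simp
    also have "\<dots> = (?a \<bullet> ?b \<bullet> ?\<psi> ?f (?g \<otimes>\<^bsub>?M'\<^esub> ?h))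
        \<bullet> (?G \<rhd> (id2 D ?f \<odot>\<^bsub>?M'\<^esub> ?\<phi> g h)) \<bullet> (?G \<rhd> ?\<phi> f (g \<otimes>\<^bsub>?M\<^esub> h))"
      unfolding nat by simp
    also have "\<dots> = ?d \<bullet> ?\<psi> (?f \<otimes>\<^bsub>?M'\<^esub> ?g) ?h
        \<bullet> (?G \<rhd> (assoc_at ?M' ?f ?g ?h \<bullet> (id2 D ?f \<odot>\<^bsub>?M'\<^esub> ?\<phi> g h) \<bullet> ?\<phi> f (g \<otimes>\<^bsub>?M\<^esub> h)))"
      unfolding n by simp
    also have "\<dots> = ?d \<bullet> (?\<psi> (?f \<otimes>\<^bsub>?M'\<^esub> ?g) ?h \<bullet> (?G \<rhd> (?\<phi> f g \<odot>\<^bsub>?M'\<^esub> id2 D ?h)))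
        \<bullet> (?G \<rhd> ?\<phi> (f \<otimes>\<^bsub>?M\<^esub> g) h) \<bullet> (?G \<rhd> ?F \<rhd> assoc_at ?M f g h)"
      unfolding m by simp
    also have "\<dots> = ((?\<psi> ?f ?g \<bullet> (?G \<rhd> ?\<phi> f g)) \<odot>\<^bsub>?M''\<^esub> id2 D (?G \<cdot> ?h))
        \<bullet> ?\<psi> (?F \<cdot> (f \<otimes>\<^bsub>?M\<^esub> g)) ?h \<bullet> (?G \<rhd> ?\<phi> (f \<otimes>\<^bsub>?M\<^esub> g) h) \<bullet> (?G \<rhd> ?F \<rhd> assoc_at ?M f g h)"
      unfolding nat' by simp
    finally show "assoc_at (om_cod ?c) (om_cell ?c \<cdot> f) (om_cell ?c \<cdot> g)
       (om_cell ?c \<cdot> h) \<bullet>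
      (id2 D (om_cell ?c \<cdot> f) \<odot>\<^bsub>om_cod ?c\<^esub> phi_at ?c g h) \<bullet>
      phi_at ?c f (g \<otimes>\<^bsub>om_dom ?c\<^esub> h)
      = (phi_at ?c f g \<odot>\<^bsub>om_cod ?c\<^esub> id2 D (om_cell ?c \<cdot> h)) \<bullet>
      phi_at ?c (f \<otimes>\<^bsub>om_dom ?c\<^esub> g) h \<bullet>
      (om_cell ?c \<rhd> assoc_at (om_dom ?c) f g h)"
      by simp
  }
  fix X f
  assume "f \<in> hom1 D X (mo_ob (om_dom ?c))"
  note [simp] = hom1D[OF this]
  let ?f = "?F \<cdot> f"
  let ?I = "unit_at ?M X" and ?I' = "unit_at ?M' X" and ?\<phi> = "phi_at m" and ?\<psi> = "phi_at n"
    and ?i = "phi0_at m X" and ?j = "phi0_at n X"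
  have n: "runit_at ?M'' (?G \<cdot> ?f) \<bullet> (id2 D (?G \<cdot> ?f) \<odot>\<^bsub>?M''\<^esub> ?j) \<bullet> ?\<psi> ?f ?I' = ?G \<rhd> runit_at ?M' ?f"
    using oplax_runit_at[of n "?f" X] by simp
  have m: "runit_at ?M' ?f \<bullet> (id2 D ?f \<odot>\<^bsub>?M'\<^esub> ?i) \<bullet> ?\<phi> f ?I = ?F \<rhd> runit_at ?M f"
    using oplax_runit_at[of m f X] by simp
  have nat: "(id2 D (?G \<cdot> ?f) \<odot>\<^bsub>?M''\<^esub> (?G \<rhd> ?i)) \<bullet> ?\<psi> ?f (?F \<cdot> ?I)
    = ?\<psi> ?f ?I' \<bullet> (?G \<rhd> (id2 D ?f \<odot>\<^bsub>?M'\<^esub> ?i))"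
    using phi_natural[of n "id2 D ?f" "?f" "?f" ?i "?F \<cdot> ?I" ?I' X] by simp
  have "runit_at ?M'' (?G \<cdot> ?f) \<bullet> (id2 D (?G \<cdot> ?f) \<odot>\<^bsub>?M''\<^esub> (?j \<bullet> (?G \<rhd> ?i)))
      \<bullet> ?\<psi> ?f (?F \<cdot> ?I) \<bullet> (?G \<rhd> ?\<phi> f ?I)
    = runit_at ?M'' (?G \<cdot> ?f) \<bullet> (id2 D (?G \<cdot> ?f) \<odot>\<^bsub>?M''\<^esub> ?j)
      \<bullet> ((id2 D (?G \<cdot> ?f) \<odot>\<^bsub>?M''\<^esub> (?G \<rhd> ?i)) \<bullet> ?\<psi> ?f (?F \<cdot> ?I)) \<bullet> (?G \<rhd> ?\<phi> f ?I)"
    by simp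
  also have "\<dots> = (runit_at ?M'' (?G \<cdot> ?f) \<bullet> (id2 D (?G \<cdot> ?f) \<odot>\<^bsub>?M''\<^esub> ?j) \<bullet> ?\<psi> ?f ?I')
      \<bullet> (?G \<rhd> (id2 D ?f \<odot>\<^bsub>?M'\<^esub> ?i)) \<bullet> (?G \<rhd> ?\<phi> f ?I)"
    unfolding nat by simp
  also have "\<dots> = ?G \<rhd> (runit_at ?M' ?f \<bullet> (id2 D ?f \<odot>\<^bsub>?M'\<^esub> ?i) \<bullet> ?\<phi> f ?I)"
    unfolding n by simp
  also have "\<dots> = ?G \<rhd> ?F \<rhd> runit_at ?M f"
    unfolding m ..
  finally show "runit_at (om_cod ?c) (om_cell ?c \<cdot> f) \<bullet>
      (id2 D (om_cell ?c \<cdot> f) \<odot>\<^bsub>om_cod ?c\<^esub> phi0_at ?c X) \<bullet>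
      phi_at ?c f (unit_at (om_dom ?c) X)
     = om_cell ?c \<rhd> runit_at (om_dom ?c) f"
    by simp
  have n: "lunit_at ?M'' (?G \<cdot> ?f) \<bullet> (?j \<odot>\<^bsub>?M''\<^esub> id2 D (?G \<cdot> ?f)) \<bullet> ?\<psi> ?I' ?f = ?G \<rhd> lunit_at ?M' ?f"
    using oplax_lunit_at[of n "?f" X] by simp
  have m: "lunit_at ?M' ?f \<bullet> (?i \<odot>\<^bsub>?M'\<^esub> id2 D ?f) \<bullet> ?\<phi> ?I f = ?F \<rhd> lunit_at ?M f"
    using oplax_lunit_at[of m f X] by simp
  have nat: "((?G \<rhd> ?i) \<odot>\<^bsub>?M''\<^esub> id2 D (?G \<cdot> ?f)) \<bullet> ?\<psi> (?F \<cdot> ?I) ?f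
    = ?\<psi> ?I' ?f \<bullet> (?G \<rhd> (?i \<odot>\<^bsub>?M'\<^esub> id2 D ?f))"
    using phi_natural[of n ?i "?F \<cdot> ?I" ?I' "id2 D ?f" "?f" "?f" X] by simp
  have "lunit_at ?M'' (?G \<cdot> ?f) \<bullet> ((?j \<bullet> (?G \<rhd> ?i)) \<odot>\<^bsub>?M''\<^esub> id2 D (?G \<cdot> ?f))
      \<bullet> ?\<psi> (?F \<cdot> ?I) ?f \<bullet> (?G \<rhd> ?\<phi> ?I f)
    = lunit_at ?M'' (?G \<cdot> ?f) \<bullet> (?j \<odot>\<^bsub>?M''\<^esub> id2 D (?G \<cdot> ?f))
      \<bullet> (((?G \<rhd> ?i) \<odot>\<^bsub>?M''\<^esub> id2 D (?G \<cdot> ?f)) \<bullet> ?\<psi> (?F \<cdot> ?I) ?f) \<bullet> (?G \<rhd> ?\<phi> ?I f)"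
    by simp
  also have "\<dots> = (lunit_at ?M'' (?G \<cdot> ?f) \<bullet> (?j \<odot>\<^bsub>?M''\<^esub> id2 D (?G \<cdot> ?f)) \<bullet> ?\<psi> ?I' ?f)
      \<bullet> (?G \<rhd> (?i \<odot>\<^bsub>?M'\<^esub> id2 D ?f)) \<bullet> (?G \<rhd> ?\<phi> ?I f)"
    unfolding nat by simp
  also have "\<dots> = ?G \<rhd> (lunit_at ?M' ?f \<bullet> (?i \<odot>\<^bsub>?M'\<^esub> id2 D ?f) \<bullet> ?\<phi> ?I f)"
    unfolding n by simp
  also have "\<dots> = ?G \<rhd> ?F \<rhd> lunit_at ?M f"
    unfolding m ..
  finally show "lunit_at (om_cod ?c) (om_cell ?c \<cdot> f) \<bullet>
      (phi0_at ?c X \<odot>\<^bsub>om_cod ?c\<^esub> id2 D (om_cell ?c \<cdot> f)) \<bullet>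
      phi_at ?c (unit_at (om_dom ?c) X) f
     = om_cell ?c \<rhd> lunit_at (om_dom ?c) f"
    by simp
qed

lemma is_oplax_trans_vcomp:
  assumes [simp]: "is_oplax_trans D P s" "is_oplax_trans D P t" "tr_dom t = tr_cod s"
  shows "is_oplax_trans D P (Trans (tr_dom s) (tr_cod t) (tr_cell t \<bullet> tr_cell s))"
    (is "is_oplax_trans D P ?t")
proof (rule is_oplax_transI)
  let ?M = "om_dom (tr_dom s)" and ?N = "om_cod (tr_dom s)"
  fix X f g
  assume "f \<in> hom1 D X (mo_ob (om_dom (tr_dom ?t)))"
    "g \<in> hom1 D X (mo_ob (om_dom (tr_dom ?t)))"
  note [simp] = hom1D[OF this(1)] hom1D[OF this(2)]
  have s: "phi_at (tr_cod s) f g \<bullet> (tr_cell s \<lhd> (f \<otimes>\<^bsub>?M\<^esub> g)) = ((tr_cell s \<lhd> f) \<odot>\<^bsub>?N\<^esub> (tr_cell s \<lhd> g)) \<bullet> phi_at (tr_dom s) f g"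
    and t: "phi_at (tr_cod t) f g \<bullet> (tr_cell t \<lhd> (f \<otimes>\<^bsub>?M\<^esub> g)) = ((tr_cell t \<lhd> f) \<odot>\<^bsub>?N\<^esub> (tr_cell t \<lhd> g)) \<bullet> phi_at (tr_cod s) f g"
    using oplax_trans_phi_at[of s f X g] oplax_trans_phi_at[of t f X g] by simp_all
  show "phi_at (tr_cod ?t) f g \<bullet>
     (tr_cell ?t \<lhd> (f \<otimes>\<^bsub>om_dom (tr_dom ?t)\<^esub> g)) =
    ((tr_cell ?t \<lhd> f) \<odot>\<^bsub>om_cod (tr_dom ?t)\<^esub>
      (tr_cell ?t \<lhd> g)) \<bullet> phi_at (tr_dom ?t) f g"
    by (simp add: vcomp_reassoc[OF t] s)
next
  let ?M = "om_dom (tr_dom s)"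
  fix X assume [simp]: "X \<in> Obj D"
  have s: "phi0_at (tr_cod s) X \<bullet> (tr_cell s \<lhd> unit_at ?M X) = phi0_at (tr_dom s) X"
    and t: "phi0_at (tr_cod t) X \<bullet> (tr_cell t \<lhd> unit_at ?M X) = phi0_at (tr_cod s) X"
    using oplax_trans_phi0_at[of s X] oplax_trans_phi0_at[of t X] by simp_all
  show "phi0_at (tr_cod ?t) X \<bullet>
     (tr_cell ?t \<lhd> unit_at (om_dom (tr_dom ?t)) X)
    = phi0_at (tr_dom ?t) X"
    by (simp add: vcomp_reassoc[OF t] s)
qed simp_all

text \<open>Naturality of \<open>phi_at n\<close> in the cells \<open>tr_cell s \<lhd> f\<close> and
  \<open>tr_cell s \<lhd> g\<close> extends the axiom of \<open>s\<close>, taken under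
  \<open>om_cell n\<close>, to the composite structure cell.\<close>

lemma is_oplax_trans_post_whisker:
  assumes [simp]: "is_oplax_trans D P s" "is_oplax_mor D P n" "om_dom n = om_cod (tr_dom s)"
  shows "is_oplax_trans D P (Trans (n \<diamondop> (tr_dom s)) (n \<diamondop> (tr_cod s)) (om_cell n \<rhd> tr_cell s))"
    (is "is_oplax_trans D P ?t")
proof (rule is_oplax_transI)
  let ?M = "om_dom (tr_dom s)" and ?N = "om_cod (tr_dom s)" and ?N' = "om_cod n" and ?\<sigma> = "tr_cell s"
  let ?F = "om_cell (tr_dom s)" and ?F' = "om_cell (tr_cod s)" and ?G = "om_cell n"
  fix X f g
  assume "f \<in> hom1 D X (mo_ob (om_dom (tr_dom ?t)))" "g \<in> hom1 D X (mo_ob (om_dom (tr_dom ?t)))"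
  note [simp] = hom1D[OF this(1)] hom1D[OF this(2)]
  have s: "phi_at (tr_cod s) f g \<bullet> (?\<sigma> \<lhd> (f \<otimes>\<^bsub>?M\<^esub> g)) = ((?\<sigma> \<lhd> f) \<odot>\<^bsub>?N\<^esub> (?\<sigma> \<lhd> g)) \<bullet> phi_at (tr_dom s) f g"
    using oplax_trans_phi_at[of s f X g] by simp
  have nat: "phi_at n (?F' \<cdot> f) (?F' \<cdot> g) \<bullet> (?G \<rhd> ((?\<sigma> \<lhd> f) \<odot>\<^bsub>?N\<^esub> (?\<sigma> \<lhd> g)))
    = ((?G \<rhd> (?\<sigma> \<lhd> f)) \<odot>\<^bsub>?N'\<^esub> (?G \<rhd> (?\<sigma> \<lhd> g))) \<bullet> phi_at n (?F \<cdot> f) (?F \<cdot> g)"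
    using phi_natural[of n "?\<sigma> \<lhd> f" "?F \<cdot> f" "?F' \<cdot> f" "?\<sigma> \<lhd> g" "?F \<cdot> g" "?F' \<cdot> g" X] by simp
  have "phi_at n (?F' \<cdot> f) (?F' \<cdot> g) \<bullet> (?G \<rhd> phi_at (tr_cod s) f g) \<bullet> (?G \<rhd> (?\<sigma> \<lhd> (f \<otimes>\<^bsub>?M\<^esub> g)))
    = phi_at n (?F' \<cdot> f) (?F' \<cdot> g) \<bullet> (?G \<rhd> (phi_at (tr_cod s) f g \<bullet> (?\<sigma> \<lhd> (f \<otimes>\<^bsub>?M\<^esub> g))))"
    by simp
  also have "\<dots> = ((?G \<rhd> (?\<sigma> \<lhd> f)) \<odot>\<^bsub>?N'\<^esub> (?G \<rhd> (?\<sigma> \<lhd> g))) \<bullet> phi_at n (?F \<cdot> f) (?F \<cdot> g) \<bullet> (?G \<rhd> phi_at (tr_dom s) f g)"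
    unfolding s by (simp add: vcomp_reassoc[OF nat])
  finally show "phi_at (tr_cod ?t) f g \<bullet> (tr_cell ?t \<lhd> (f \<otimes>\<^bsub>om_dom (tr_dom ?t)\<^esub> g))
    = ((tr_cell ?t \<lhd> f) \<odot>\<^bsub>om_cod (tr_dom ?t)\<^esub> (tr_cell ?t \<lhd> g)) \<bullet> phi_at (tr_dom ?t) f g"
    by simp
next
  fix X assume [simp]: "X \<in> Obj D"
  have s: "phi0_at (tr_cod s) X \<bullet> (tr_cell s \<lhd> unit_at (om_dom (tr_dom s)) X) = phi0_at (tr_dom s) X"
    using oplax_trans_phi0_at[of s X] by simp
  show "phi0_at (tr_cod ?t) X \<bullet> (tr_cell ?t \<lhd> unit_at (om_dom (tr_dom ?t)) X) = phi0_at (tr_dom ?t) X"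
    by (simp flip: s)
qed (simp_all add: is_oplax_mor_comp)

text \<open>\<open>tr_cell s\<close> is first interchanged with the structure cells of
  \<open>m\<close>; the axiom of \<open>s\<close> is then used at the images under
  \<open>om_cell m\<close>.\<close>

lemma is_oplax_trans_pre_whisker:
  assumes [simp]: "is_oplax_trans D P s" "is_oplax_mor D P m" "om_dom (tr_dom s) = om_cod m"
  shows "is_oplax_trans D P (Trans (((tr_dom s) \<diamondop> m)) (((tr_cod s) \<diamondop> m)) (tr_cell s \<lhd> om_cell m))"
    (is "is_oplax_trans D P ?t")
proof (rule is_oplax_transI)
  let ?M = "om_cod m" and ?N = "om_cod (tr_dom s)" and ?M' = "om_dom m" and ?\<sigma> = "tr_cell s"
  let ?F = "om_cell (tr_dom s)" and ?F' = "om_cell (tr_cod s)" and ?H = "om_cell m"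
  fix X f g
  assume "f \<in> hom1 D X (mo_ob (om_dom (tr_dom ?t)))" "g \<in> hom1 D X (mo_ob (om_dom (tr_dom ?t)))"
  note [simp] = hom1D[OF this(1)] hom1D[OF this(2)]
  have s: "phi_at (tr_cod s) (?H \<cdot> f) (?H \<cdot> g) \<bullet> (?\<sigma> \<lhd> (?H \<cdot> f \<otimes>\<^bsub>?M\<^esub> ?H \<cdot> g))
    = ((?\<sigma> \<lhd> (?H \<cdot> f)) \<odot>\<^bsub>?N\<^esub> (?\<sigma> \<lhd> (?H \<cdot> g))) \<bullet> phi_at (tr_dom s) (?H \<cdot> f) (?H \<cdot> g)"
    using oplax_trans_phi_at[of s "?H \<cdot> f" X "?H \<cdot> g"] by simp
  have nat: "(?F' \<rhd> phi_at m f g) \<bullet> (?\<sigma> \<lhd> (?H \<cdot> (f \<otimes>\<^bsub>?M'\<^esub> g))) = (?\<sigma> \<lhd> (?H \<cdot> f \<otimes>\<^bsub>?M\<^esub> ?H \<cdot> g)) \<bullet> (?F \<rhd> phi_at m f g)"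
    by (rule whisker_swap[symmetric]) simp_all
  have "phi_at (tr_cod s) (?H \<cdot> f) (?H \<cdot> g) \<bullet> (?F' \<rhd> phi_at m f g) \<bullet> (?\<sigma> \<lhd> (?H \<cdot> (f \<otimes>\<^bsub>?M'\<^esub> g)))
    = ((?\<sigma> \<lhd> (?H \<cdot> f)) \<odot>\<^bsub>?N\<^esub> (?\<sigma> \<lhd> (?H \<cdot> g))) \<bullet> phi_at (tr_dom s) (?H \<cdot> f) (?H \<cdot> g) \<bullet> (?F \<rhd> phi_at m f g)"
    unfolding nat by (simp add: vcomp_reassoc[OF s])
  then show "phi_at (tr_cod ?t) f g \<bullet> (tr_cell ?t \<lhd> (f \<otimes>\<^bsub>om_dom (tr_dom ?t)\<^esub> g))
    = ((tr_cell ?t \<lhd> f) \<odot>\<^bsub>om_cod (tr_dom ?t)\<^esub> (tr_cell ?t \<lhd> g)) \<bullet> phi_at (tr_dom ?t) f g"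
    by simp
next
  fix X assume [simp]: "X \<in> Obj D"
  let ?M = "om_cod m" and ?M' = "om_dom m" and ?\<sigma> = "tr_cell s"
  let ?F = "om_cell (tr_dom s)" and ?F' = "om_cell (tr_cod s)" and ?H = "om_cell m"
  have s: "phi0_at (tr_cod s) X \<bullet> (?\<sigma> \<lhd> unit_at ?M X) = phi0_at (tr_dom s) X"
    using oplax_trans_phi0_at[of s X] by simp
  have nat: "(?F' \<rhd> phi0_at m X) \<bullet> (?\<sigma> \<lhd> (?H \<cdot> unit_at ?M' X)) = (?\<sigma> \<lhd> unit_at ?M X) \<bullet> (?F \<rhd> phi0_at m X)"
    by (rule whisker_swap[symmetric]) simp_all
  show "phi0_at (tr_cod ?t) X \<bullet> (tr_cell ?t \<lhd> unit_at (om_dom (tr_dom ?t)) X) = phi0_at (tr_dom ?t) X"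
    by (simp add: nat vcomp_reassoc[OF s])
qed (simp_all add: is_oplax_mor_comp)

abbreviation "oplax_id M \<equiv> OplaxMor M M (id1 D (mo_ob M)) (id2 D (mo_tensor M)) (id2 D (mo_unit M))"

lemma phi_at_strict:
  assumes "om_phi m = id2 D (om_cell m \<cdot> mo_tensor (om_dom m))" "is_monoidal D P (om_dom m)"
    "om_cell m \<in> Cell1 D" "dom1 D (om_cell m) = mo_ob (om_dom m)"
    "f \<in> Cell1 D" "g \<in> Cell1 D" "cod1 D f = mo_ob (om_dom m)" "cod1 D g = mo_ob (om_dom m)" "dom1 D g = dom1 D f"
  shows "phi_at m f g = id2 D (om_cell m \<cdot> (f \<otimes>\<^bsub>om_dom m\<^esub> g))"
  using assms by (simp add: phi_at_def tens_def)

lemma phi0_at_strict: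
  assumes "om_phi0 m = id2 D (om_cell m \<cdot> mo_unit (om_dom m))" "is_monoidal D P (om_dom m)"
    "om_cell m \<in> Cell1 D" "dom1 D (om_cell m) = mo_ob (om_dom m)" "X \<in> Obj D"
  shows "phi0_at m X = id2 D (om_cell m \<cdot> unit_at (om_dom m) X)"
  using assms by (simp add: phi0_at_def unit_at_def)

text \<open>With identity structure cells the axioms say that \<open>F\<close> preserves everything
  up to equality. This serves the identity morphisms and the forgetful morphism of the lifted EM
  object.\<close>

lemma is_oplax_mor_strict:
  assumes M [simp]: "is_monoidal D P M" "is_monoidal D P N"
    and F [simp]: "F \<in> Cell1 D" "dom1 D F = mo_ob M" "cod1 D F = mo_ob N"
    and tens: "\<And>X f g. \<lbrakk>f \<in> hom1 D X (mo_ob M); g \<in> hom1 D X (mo_ob M)\<rbrakk> \<Longrightarrow> F \<cdot> (f \<otimes>\<^bsub>M\<^esub> g) = F \<cdot> f \<otimes>\<^bsub>N\<^esub> F \<cdot> g"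
    and unit: "\<And>X. X \<in> Obj D \<Longrightarrow> F \<cdot> unit_at M X = unit_at N X"
    and assoc: "\<And>X f g h. \<lbrakk>f \<in> hom1 D X (mo_ob M); g \<in> hom1 D X (mo_ob M); h \<in> hom1 D X (mo_ob M)\<rbrakk>
      \<Longrightarrow> F \<rhd> assoc_at M f g h = assoc_at N (F \<cdot> f) (F \<cdot> g) (F \<cdot> h)"
    and lr: "\<And>X f. f \<in> hom1 D X (mo_ob M) \<Longrightarrow> F \<rhd> lunit_at M f = lunit_at N (F \<cdot> f)"
      "\<And>X f. f \<in> hom1 D X (mo_ob M) \<Longrightarrow> F \<rhd> runit_at M f = runit_at N (F \<cdot> f)"
  shows "is_oplax_mor D P (OplaxMor M N F (id2 D (F \<cdot> mo_tensor M)) (id2 D (F \<cdot> mo_unit M)))"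
    (is "is_oplax_mor D P ?m")
proof (rule is_oplax_morI)
  show "om_phi ?m \<in> hom2 D (om_cell ?m \<cdot> mo_tensor (om_dom ?m))
      (om_cell ?m \<cdot> pr1 P A A \<otimes>\<^bsub>om_cod ?m\<^esub> om_cell ?m \<cdot> pr2 P A A)"
    if "A = mo_ob (om_dom ?m)" for A
    using that tens[of "pr1 P A A" "prd P A A" "pr2 P A A"] by (simp add: tens_pr)
  show "om_phi0 ?m \<in> hom2 D (om_cell ?m \<cdot> mo_unit (om_dom ?m)) (mo_unit (om_cod ?m))"
    using unit[of "one P"] by (simp add: unit_at_one)
qed (auto simp: phi_at_strict phi0_at_strict tens unit assoc lr)

lemma is_oplax_mor_id: "is_monoidal D P M \<Longrightarrow> is_oplax_mor D P (oplax_id M)"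
  using is_oplax_mor_strict[of M M "id1 D (mo_ob M)"] by auto

lemma oplax_mor_comp_id:
  assumes "is_oplax_mor D P m"
  shows "((oplax_id (om_cod m)) \<diamondop> m) = m"
    "(m \<diamondop> (oplax_id (om_dom m))) = m"
  using assms by (auto simp: om_phi_comp phi_at_strict phi_at_pr intro!: oplax_mor.expand)

lemma oplax_mor_comp_assoc:
  assumes "is_oplax_mor D P l" "is_oplax_mor D P m" "is_oplax_mor D P n" "om_dom m = om_cod l" "om_dom n = om_cod m"
  shows "((n \<diamondop> m) \<diamondop> l) = (n \<diamondop> (m \<diamondop> l))"
  using assms by (auto simp: om_phi_comp intro!: oplax_mor.expand)

lemma is_oplax_trans_id: "is_oplax_mor D P m \<Longrightarrow> is_oplax_trans D P (Trans m m (id2 D (om_cell m)))"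
  by (rule is_oplax_transI) auto

lemma Mon_op_simps [simp]:
  "Obj (Mon_op D P) = {M. is_monoidal D P M}" "Cell1 (Mon_op D P) = {m. is_oplax_mor D P m}"
  "Cell2 (Mon_op D P) = {t. is_oplax_trans D P t}"
  "dom1 (Mon_op D P) = om_dom" "cod1 (Mon_op D P) = om_cod" "dom2 (Mon_op D P) = tr_dom" "cod2 (Mon_op D P) = tr_cod"
  "id1 (Mon_op D P) = (\<lambda>M. oplax_id M)"
  "id2 (Mon_op D P) = (\<lambda>m. Trans m m (id2 D (om_cell m)))"
  "comp1 (Mon_op D P) = oplax_mor_comp D P"
  "vcomp (Mon_op D P) = (\<lambda>t s. Trans (tr_dom s) (tr_cod t) (tr_cell t \<bullet> tr_cell s))"
  "hcomp (Mon_op D P) = (\<lambda>t s. Trans (((tr_dom t) \<diamondop> (tr_dom s)))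
                           (((tr_cod t) \<diamondop> (tr_cod s))) (tr_cell t \<star> tr_cell s))"
  by (simp_all add: Mon_op_def)

lemma structured_two_category_Mon_op: "structured_two_category D (Mon_op D P) mo_ob om_cell"
  by unfold_locales
    (auto simp: is_oplax_mor_comp is_oplax_mor_id is_oplax_trans_vcomp is_oplax_trans_post_whisker
      is_oplax_trans_pre_whisker is_oplax_trans_id oplax_mor_comp_id oplax_mor_comp_assoc)

lemma two_category_Mon_op: "two_category (Mon_op D P)"
  by (rule structured_two_category.lifted_two_category[OF structured_two_category_Mon_op])

lemma two_functor_forget: "two_functor (Mon_op D P) D Mon_op_forget"
  unfolding Mon_op_forget_def
  by (rule structured_two_category.forget_two_functor[OF structured_two_category_Mon_op])

end

section \<open>Eilenberg-Moore objects through algebras\<close>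

text \<open>An algebra with domain \<open>X\<close>, that is, a generalized element with an action.
  Such pairs are the monad morphisms from the identity monad on \<open>X\<close>, see
  \<open>is_algebra_iff_monad_mor\<close>.\<close>

definition is_algebra :: "('o, 'f, 'c) twocat \<Rightarrow> ('o, 'f, 'c) monad \<Rightarrow> 'o \<Rightarrow> 'f \<Rightarrow> 'c \<Rightarrow> bool" where
  "is_algebra C N X f a \<longleftrightarrow> X \<in> Obj C \<and> f \<in> hom1 C X (mnd_ob N) \<and> a \<in> hom2 C (mnd_end N \<cdot>\<^bsub>C\<^esub> f) f \<and>
     a \<bullet>\<^bsub>C\<^esub> (mnd_unit N \<lhd>\<^bsub>C\<^esub> f) = id2 C f \<and>
     a \<bullet>\<^bsub>C\<^esub> (mnd_mult N \<lhd>\<^bsub>C\<^esub> f) = a \<bullet>\<^bsub>C\<^esub> (mnd_end N \<rhd>\<^bsub>C\<^esub> a)"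

text \<open>The universal arrow from \<open>iota C\<close> to \<open>N\<close> in terms of algebras.
  The equations in \<open>ex1_lift\<close> are strict, and uniqueness in \<open>ex1_lift2\<close>
  makes \<open>U\<close> faithful on 2-cells.\<close>

locale em_object = two_category C
  for C :: "('o, 'f, 'c) twocat" (structure) +
  fixes N :: "('o, 'f, 'c) monad" and E :: 'o and U :: 'f and \<chi> :: 'c
  assumes monad [simp]: "is_monad C N"
    and algebra_U: "is_algebra C N E U \<chi>"
    and ex1_lift: "is_algebra C N X f a \<Longrightarrow> \<exists>!g. g \<in> hom1 C X E \<and> U \<cdot> g = f \<and> \<chi> \<lhd> g = a"
    and ex1_lift2: "\<lbrakk>g \<in> hom1 C X E; h \<in> hom1 C X E; \<sigma> \<in> hom2 C (U \<cdot> g) (U \<cdot> h);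
        (\<chi> \<lhd> h) \<bullet> (mnd_end N \<rhd> \<sigma>) = \<sigma> \<bullet> (\<chi> \<lhd> g)\<rbrakk>
      \<Longrightarrow> \<exists>!\<rho>. \<rho> \<in> hom2 C g h \<and> U \<rhd> \<rho> = \<sigma>"

context two_category
begin

text \<open>For an identity monad as source, the unit and multiplication on the right-hand sides of
  the morphism laws are identities; what is left are the laws of an action.\<close>

lemma is_algebra_iff_monad_mor:
  assumes "is_monad C N" "X \<in> Obj C"
  shows "is_algebra C N X f a \<longleftrightarrow> is_monad_mor C (MonadMor (identity_monad C X) N f a)"
  unfolding is_algebra_def is_monad_mor_iff using assms by (simp add: is_monad_identity cong: conj_cong)

lemma comp_iota:
  assumes "g \<in> hom1 C X E" "U \<in> Cell1 C" "dom1 C U = E" "\<chi> \<in> Cell2 C" "dom1 C (dom2 C \<chi>) = E" "cod2 C \<chi> = U"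
  shows "MonadMor (identity_monad C E) N U \<chi> \<cdot>\<^bsub>Mnd C\<^esub> on1 (iota C) g
    = MonadMor (identity_monad C X) N (U \<cdot> g) (\<chi> \<lhd> g)"
  by (rule monad_mor.expand) (use assms in simp)

lemma is_algebra_comp:
  assumes "is_monad C N" "is_algebra C N E U \<chi>" "g \<in> hom1 C X E"
  shows "is_algebra C N X (U \<cdot> g) (\<chi> \<lhd> g)"
proof -
  have [simp]: "U \<in> Cell1 C" "dom1 C U = E" "cod1 C U = mnd_ob N" "\<chi> \<in> Cell2 C" "dom2 C \<chi> = mnd_end N \<cdot> U"
    "cod2 C \<chi> = U" "g \<in> Cell1 C" "dom1 C g = X" "cod1 C g = E" "is_monad C N"
    and X: "X \<in> Obj C"
    using assms dom1_Obj[of g] by (simp_all add: is_algebra_def)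
  have u: "\<chi> \<bullet> (mnd_unit N \<lhd> U) = id2 C U" and m: "\<chi> \<bullet> (mnd_mult N \<lhd> U) = \<chi> \<bullet> (mnd_end N \<rhd> \<chi>)"
    using assms(2) by (simp_all add: is_algebra_def)
  have "(\<chi> \<lhd> g) \<bullet> (mnd_unit N \<lhd> (U \<cdot> g)) = (\<chi> \<bullet> (mnd_unit N \<lhd> U)) \<lhd> g" by simp
  also have "\<dots> = id2 C (U \<cdot> g)" unfolding u by simp
  finally have u': "(\<chi> \<lhd> g) \<bullet> (mnd_unit N \<lhd> (U \<cdot> g)) = id2 C (U \<cdot> g)" .
  have "(\<chi> \<lhd> g) \<bullet> (mnd_mult N \<lhd> (U \<cdot> g)) = (\<chi> \<bullet> (mnd_mult N \<lhd> U)) \<lhd> g" by simp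
  also have "\<dots> = (\<chi> \<lhd> g) \<bullet> (mnd_end N \<rhd> (\<chi> \<lhd> g))" unfolding m by simp
  finally show ?thesis using u' X by (simp add: is_algebra_def)
qed

text \<open>Monad morphisms from identity monads to \<open>N\<close> are algebras, and
  transformations between them are the 2-cells that commute with the actions. Under this dictionary
  unique factorization becomes unique lifting.\<close>

lemma em_object_if_universal_arrow:
  assumes N [simp]: "is_monad C N" and univ: "universal_arrow C (Mnd C) (iota C) N E e"
  shows "em_object C N E (mm_cell e) (mm_tau e)" "e = MonadMor (identity_monad C E) N (mm_cell e) (mm_tau e)"
proof -
  interpret univ: universal_arrow C "Mnd C" "iota C" N E e by fact
  let ?U = "mm_cell e" and ?\<chi> = "mm_tau e"
  have E [simp]: "E \<in> Obj C" by (rule univ.R_Obj)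
  have em: "is_monad_mor C e" and ed: "mm_dom e = identity_monad C E" and ec: "mm_cod e = N"
    using univ.e_hom by auto
  then show e: "e = MonadMor (identity_monad C E) N ?U ?\<chi>"
    by (auto intro: monad_mor.expand)
  have U: "?U \<in> Cell1 C" "dom1 C ?U = E" "cod1 C ?U = mnd_ob N" "?\<chi> \<in> Cell2 C" "dom2 C ?\<chi> = mnd_end N \<cdot> ?U" "cod2 C ?\<chi> = ?U"
    using monad_mor_simps[OF em] ed ec by simp_all
  note [simp] = U
  have alg: "is_algebra C N E ?U ?\<chi>"
    using is_algebra_iff_monad_mor[OF N E] em e by metis
  have comp: "e \<cdot>\<^bsub>Mnd C\<^esub> on1 (iota C) g = MonadMor (identity_monad C X) N (?U \<cdot> g) (?\<chi> \<lhd> g)" if "g \<in> hom1 C X E" for g X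
    by (subst e, rule comp_iota[OF that]) simp_all
  show "em_object C N E ?U ?\<chi>"
  proof
    fix X f a assume a: "is_algebra C N X f a"
    then have X: "X \<in> Obj C" by (simp add: is_algebra_def)
    with a have "MonadMor (identity_monad C X) N f a \<in> hom1 (Mnd C) (on0 (iota C) X) N"
      using is_algebra_iff_monad_mor[OF N X] by simp
    from univ.ex1_factor[OF X this]
    have *: "\<exists>!g. g \<in> hom1 C X E \<and> e \<cdot>\<^bsub>Mnd C\<^esub> on1 (iota C) g = MonadMor (identity_monad C X) N f a" .
    have "g \<in> hom1 C X E \<and> e \<cdot>\<^bsub>Mnd C\<^esub> on1 (iota C) g = MonadMor (identity_monad C X) N f a
      \<longleftrightarrow> g \<in> hom1 C X E \<and> ?U \<cdot> g = f \<and> ?\<chi> \<lhd> g = a" for g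
      using comp[of g X] by (metis monad_mor.inject)
    with * show "\<exists>!g. g \<in> hom1 C X E \<and> ?U \<cdot> g = f \<and> ?\<chi> \<lhd> g = a" by simp
  next
    fix X g h \<sigma>
    assume g: "g \<in> hom1 C X E" "h \<in> hom1 C X E" and \<sigma>: "\<sigma> \<in> hom2 C (?U \<cdot> g) (?U \<cdot> h)"
      and eq: "(?\<chi> \<lhd> h) \<bullet> (mnd_end N \<rhd> \<sigma>) = \<sigma> \<bullet> (?\<chi> \<lhd> g)"
    have X: "X \<in> Obj C" using g by auto
    let ?g = "MonadMor (identity_monad C X) N (?U \<cdot> g) (?\<chi> \<lhd> g)" and ?h = "MonadMor (identity_monad C X) N (?U \<cdot> h) (?\<chi> \<lhd> h)"
    have "is_monad_mor C ?g" "is_monad_mor C ?h"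
      using is_algebra_comp[OF N alg] g is_algebra_iff_monad_mor[OF N X] by blast+
    then have "is_monad_trans C (Trans ?g ?h \<sigma>)"
      by (intro is_monad_transI) (use \<sigma> eq g in simp_all)
    then have "\<exists>!\<rho>. \<rho> \<in> hom2 C g h \<and> e \<rhd>\<^bsub>Mnd C\<^esub> on2 (iota C) \<rho> = Trans ?g ?h \<sigma>"
      by (intro univ.ex1_factor2[OF g]) (unfold comp[OF g(1)] comp[OF g(2)], simp)
    moreover have "\<rho> \<in> hom2 C g h \<and> e \<rhd>\<^bsub>Mnd C\<^esub> on2 (iota C) \<rho> = Trans ?g ?h \<sigma> \<longleftrightarrow> \<rho> \<in> hom2 C g h \<and> ?U \<rhd> \<rho> = \<sigma>" for \<rho>
      using comp[OF g(1)] comp[OF g(2)] by (auto simp: post_whisker_def)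
    ultimately show "\<exists>!\<rho>. \<rho> \<in> hom2 C g h \<and> ?U \<rhd> \<rho> = \<sigma>" by simp
  qed (use alg in simp_all)
qed

end

context em_object
begin

text \<open>The dictionary of \<open>em_object_if_universal_arrow\<close> read backwards. It is
  applied both to the given object in \<open>D\<close> and to the lifted one in
  \<open>Mon_op D P\<close>.\<close>

lemma universal_arrow: "universal_arrow C (Mnd C) (iota C) N E (MonadMor (identity_monad C E) N U \<chi>)"
proof -
  interpret iota: two_functor C "Mnd C" "iota C" by (rule two_functor_iota)
  have E [simp]: "E \<in> Obj C" and U: "U \<in> Cell1 C" "dom1 C U = E" "cod1 C U = mnd_ob N" "\<chi> \<in> Cell2 C"
    "dom2 C \<chi> = mnd_end N \<cdot> U" "cod2 C \<chi> = U"
    using algebra_U by (simp_all add: is_algebra_def)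
  let ?e = "MonadMor (identity_monad C E) N U \<chi>"
  have e: "is_monad_mor C ?e"
    using algebra_U is_algebra_iff_monad_mor[OF monad E] by simp
  have comp: "?e \<cdot>\<^bsub>Mnd C\<^esub> on1 (iota C) g = MonadMor (identity_monad C X) N (U \<cdot> g) (\<chi> \<lhd> g)" if "g \<in> hom1 C X E" for g X
    by (rule comp_iota[OF that]) (simp_all add: U)
  show ?thesis
  proof
    fix X f assume X: "X \<in> Obj C" and f: "f \<in> hom1 (Mnd C) (on0 (iota C) X) N"
    then have f': "f = MonadMor (identity_monad C X) N (mm_cell f) (mm_tau f)" "is_monad_mor C f"
      by (auto intro: monad_mor.expand)
    then have "is_algebra C N X (mm_cell f) (mm_tau f)"
      using is_algebra_iff_monad_mor[OF monad X] by metis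
    from ex1_lift[OF this]
    have "\<exists>!g. g \<in> hom1 C X E \<and> U \<cdot> g = mm_cell f \<and> \<chi> \<lhd> g = mm_tau f" .
    moreover have "g \<in> hom1 C X E \<and> ?e \<cdot>\<^bsub>Mnd C\<^esub> on1 (iota C) g = f \<longleftrightarrow>
       g \<in> hom1 C X E \<and> U \<cdot> g = mm_cell f \<and> \<chi> \<lhd> g = mm_tau f" for g
      using comp[of g X] f'(1) by (metis monad_mor.sel(3,4))
    ultimately show "\<exists>!g. g \<in> hom1 C X E \<and> ?e \<cdot>\<^bsub>Mnd C\<^esub> on1 (iota C) g = f" by simp
  next
    fix X g h \<sigma>
    assume g: "g \<in> hom1 C X E" "h \<in> hom1 C X E"
      and \<sigma>: "\<sigma> \<in> hom2 (Mnd C) (?e \<cdot>\<^bsub>Mnd C\<^esub> on1 (iota C) g) (?e \<cdot>\<^bsub>Mnd C\<^esub> on1 (iota C) h)"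
    let ?g = "MonadMor (identity_monad C X) N (U \<cdot> g) (\<chi> \<lhd> g)" and ?h = "MonadMor (identity_monad C X) N (U \<cdot> h) (\<chi> \<lhd> h)"
    have \<sigma>': "is_monad_trans C \<sigma>" "tr_dom \<sigma> = ?g" "tr_cod \<sigma> = ?h"
      using \<sigma> unfolding comp[OF g(1)] comp[OF g(2)] by auto
    have "(\<chi> \<lhd> h) \<bullet> (mnd_end N \<rhd> tr_cell \<sigma>) = tr_cell \<sigma> \<bullet> (\<chi> \<lhd> g)"
      using monad_trans_law[OF \<sigma>'(1)] \<sigma>'  monad_trans_simps(5-7)[OF \<sigma>'(1)] g U by simp
    then have "\<exists>!\<rho>. \<rho> \<in> hom2 C g h \<and> U \<rhd> \<rho> = tr_cell \<sigma>"
      using monad_trans_simps(5-7)[OF \<sigma>'(1)] \<sigma>' by (intro ex1_lift2[OF g]) simp_all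
    moreover have "\<rho> \<in> hom2 C g h \<and> ?e \<rhd>\<^bsub>Mnd C\<^esub> on2 (iota C) \<rho> = \<sigma> \<longleftrightarrow> \<rho> \<in> hom2 C g h \<and> U \<rhd> \<rho> = tr_cell \<sigma>" for \<rho>
      using comp[OF g(1)] comp[OF g(2)] \<sigma>' by (auto simp: post_whisker_def intro!: trans.expand)
    ultimately show "\<exists>!\<rho>. \<rho> \<in> hom2 C g h \<and> ?e \<rhd>\<^bsub>Mnd C\<^esub> on2 (iota C) \<rho> = \<sigma>" by simp
  qed (use e in simp_all)
qed

section \<open>Lifting 1-cells and 2-cells to an Eilenberg-Moore object\<close>

lemma U_simps [simp]:
  "E \<in> Obj C" "U \<in> Cell1 C" "dom1 C U = E" "cod1 C U = mnd_ob N"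
  "\<chi> \<in> Cell2 C" "dom2 C \<chi> = mnd_end N \<cdot> U" "cod2 C \<chi> = U"
  using algebra_U by (simp_all add: is_algebra_def)

definition lift :: "'o \<Rightarrow> 'f \<Rightarrow> 'c \<Rightarrow> 'f" where
  "lift X f a = (THE g. g \<in> hom1 C X E \<and> U \<cdot> g = f \<and> \<chi> \<lhd> g = a)"

lemma lift_simps:
  assumes "is_algebra C N X f a"
  shows "lift X f a \<in> Cell1 C" "dom1 C (lift X f a) = X" "cod1 C (lift X f a) = E"
    "U \<cdot> lift X f a = f" "\<chi> \<lhd> lift X f a = a"
  using theI'[OF ex1_lift[OF assms]] by (simp_all add: lift_def)

lemma lift_eqI:
  assumes "U \<cdot> g = U \<cdot> h" "\<chi> \<lhd> g = \<chi> \<lhd> h" "g \<in> hom1 C X E" "h \<in> hom1 C X E"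
  shows "g = h"
  using ex1_lift[OF is_algebra_comp[OF monad algebra_U assms(4)]] assms by auto

definition lift2 :: "'c \<Rightarrow> 'f \<Rightarrow> 'f \<Rightarrow> 'c" where
  "lift2 \<sigma> g h = (THE \<rho>. \<rho> \<in> hom2 C g h \<and> U \<rhd> \<rho> = \<sigma>)"

lemma lift2_simps:
  assumes "g \<in> hom1 C X E" "h \<in> hom1 C X E" "\<sigma> \<in> hom2 C (U \<cdot> g) (U \<cdot> h)"
    "(\<chi> \<lhd> h) \<bullet> (mnd_end N \<rhd> \<sigma>) = \<sigma> \<bullet> (\<chi> \<lhd> g)"
  shows "lift2 \<sigma> g h \<in> Cell2 C" "dom2 C (lift2 \<sigma> g h) = g" "cod2 C (lift2 \<sigma> g h) = h" "U \<rhd> lift2 \<sigma> g h = \<sigma>"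
  using theI'[OF ex1_lift2[OF assms]] by (simp_all add: lift2_def)

text \<open>Interchange with \<chi>: under \<open>U\<close> every 2-cell into \<open>E\<close>
  becomes a morphism of algebras.\<close>

lemma chi_natural:
  assumes "\<rho> \<in> hom2 C g h" "g \<in> hom1 C X E"
  shows "(\<chi> \<lhd> h) \<bullet> (mnd_end N \<rhd> U \<rhd> \<rho>) = (U \<rhd> \<rho>) \<bullet> (\<chi> \<lhd> g)"
  using whisker_swap[of \<rho> \<chi> g h "mnd_end N \<cdot> U" U] assms by auto

text \<open>\<open>U \<rhd> \<rho>'\<close> is a morphism of algebras by \<open>chi_natural\<close>,
  so its lift is unique. This is the rule by which coherence equations on \<open>E\<close> are
  reduced to the base.\<close>

lemma lift2_eqI:
  assumes "U \<rhd> \<rho> = U \<rhd> \<rho>'" "\<rho> \<in> Cell2 C" "\<rho>' \<in> Cell2 C" "dom2 C \<rho> = dom2 C \<rho>'" "cod2 C \<rho> = cod2 C \<rho>'"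
    "cod1 C (dom2 C \<rho>') = E"
  shows "\<rho> = \<rho>'"
proof -
  let ?g = "dom2 C \<rho>'" and ?h = "cod2 C \<rho>'"
  have "\<exists>!\<rho>. \<rho> \<in> hom2 C ?g ?h \<and> U \<rhd> \<rho> = U \<rhd> \<rho>'"
    by (rule ex1_lift2[where X = "dom1 C ?g"]) (use assms chi_natural[of \<rho>' ?g ?h] in auto)
  with assms show ?thesis by auto
qed

text \<open>The inverse of an invertible morphism of algebras is again a morphism of algebras and
  lifts; the lift is an inverse because \<open>U\<close> is faithful.\<close>

lemma reflects_invertible2:
  assumes \<rho>: "\<rho> \<in> Cell2 C" "cod1 C (dom2 C \<rho>) = E" and inv: "invertible2 C (U \<rhd> \<rho>)"
  shows "invertible2 C \<rho>"
proof -
  let ?g = "dom2 C \<rho>" and ?h = "cod2 C \<rho>" and ?S = "mnd_end N" and ?\<sigma> = "U \<rhd> \<rho>"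
  have cE: "cod1 C ?h = E" "dom1 C ?h = dom1 C ?g" using \<rho> by simp_all
  obtain \<tau> where \<tau>: "\<tau> \<in> Cell2 C" "dom2 C \<tau> = U \<cdot> ?h" "cod2 C \<tau> = U \<cdot> ?g"
    "\<tau> \<bullet> ?\<sigma> = id2 C (U \<cdot> ?g)" "?\<sigma> \<bullet> \<tau> = id2 C (U \<cdot> ?h)"
    using inv \<rho> by (auto simp: invertible2_def)
  have "(\<chi> \<lhd> ?g) \<bullet> (?S \<rhd> \<tau>) = (\<tau> \<bullet> ?\<sigma>) \<bullet> (\<chi> \<lhd> ?g) \<bullet> (?S \<rhd> \<tau>)"
    unfolding \<tau> using \<rho> \<tau>(1-3) cE by simp
  also have "\<dots> = \<tau> \<bullet> (?\<sigma> \<bullet> (\<chi> \<lhd> ?g)) \<bullet> (?S \<rhd> \<tau>)"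
    using \<rho> \<tau>(1-3) cE by simp
  also have "?\<sigma> \<bullet> (\<chi> \<lhd> ?g) = (\<chi> \<lhd> ?h) \<bullet> (?S \<rhd> ?\<sigma>)"
    using chi_natural[of \<rho> ?g ?h] \<rho> by simp
  also have "\<tau> \<bullet> ((\<chi> \<lhd> ?h) \<bullet> (?S \<rhd> ?\<sigma>)) \<bullet> (?S \<rhd> \<tau>) = \<tau> \<bullet> (\<chi> \<lhd> ?h) \<bullet> (?S \<rhd> (?\<sigma> \<bullet> \<tau>))"
    using \<rho> \<tau>(1-3) cE by simp
  also have "\<dots> = \<tau> \<bullet> (\<chi> \<lhd> ?h)"
    unfolding \<tau> using \<rho> \<tau>(1-3) cE by simp
  finally have eq: "(\<chi> \<lhd> ?g) \<bullet> (?S \<rhd> \<tau>) = \<tau> \<bullet> (\<chi> \<lhd> ?h)" .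
  have l: "lift2 \<tau> ?h ?g \<in> Cell2 C" "dom2 C (lift2 \<tau> ?h ?g) = ?h" "cod2 C (lift2 \<tau> ?h ?g) = ?g" "U \<rhd> lift2 \<tau> ?h ?g = \<tau>"
    by (rule lift2_simps[where X = "dom1 C ?g"]; use \<rho> \<tau> cE eq in simp)+
  have "lift2 \<tau> ?h ?g \<bullet> \<rho> = id2 C ?g" "\<rho> \<bullet> lift2 \<tau> ?h ?g = id2 C ?h"
    by (rule lift2_eqI; use l \<rho> \<tau> cE in simp)+
  with l \<rho> show ?thesis by (auto simp: invertible2_def)
qed

end

lemma (in two_category) invertible2_pre_whisker:
  assumes "invertible2 C \<sigma>" "f \<in> Cell1 C" "dom1 C (dom2 C \<sigma>) = cod1 C f"
  shows "invertible2 C (\<sigma> \<lhd> f)"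
proof -
  from assms obtain \<tau> where \<tau>: "\<sigma> \<in> Cell2 C" "\<tau> \<in> Cell2 C" "dom2 C \<tau> = cod2 C \<sigma>" "cod2 C \<tau> = dom2 C \<sigma>"
    "\<tau> \<bullet> \<sigma> = id2 C (dom2 C \<sigma>)" "\<sigma> \<bullet> \<tau> = id2 C (cod2 C \<sigma>)"
    by (auto simp: invertible2_def)
  have "(\<tau> \<lhd> f) \<bullet> (\<sigma> \<lhd> f) = id2 C (dom2 C \<sigma> \<cdot> f)" "(\<sigma> \<lhd> f) \<bullet> (\<tau> \<lhd> f) = id2 C (cod2 C \<sigma> \<cdot> f)"
    using pre_whisker_vcomp[of f \<sigma> \<tau>] pre_whisker_vcomp[of f \<tau> \<sigma>] \<tau> assms(2,3)
    by (simp_all del: pre_whisker_vcomp)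
  with \<tau> assms(2,3) show ?thesis
    unfolding invertible2_def by (intro conjI bexI[of _ "\<tau> \<lhd> f"]) simp_all
qed

section \<open>Lifting the monoidal structure to algebras\<close>

locale monoidal_em_object = two_category_with_products D P + em_object D "Mnd_map0 Mon_op_forget M" E U \<chi>
  for D :: "('o, 'f, 'c) twocat" (structure) and P :: "('o, 'f) products"
    and M :: "(('o, 'f, 'c) monoidal, ('o, 'f, 'c) oplax_mor, (('o, 'f, 'c) oplax_mor, 'c) trans) monad"
    and E :: 'o and U :: 'f and \<chi> :: 'c +
  assumes oplax_monad: "is_monad (Mon_op D P) M"
begin

abbreviation "N \<equiv> Mnd_map0 Mon_op_forget M"
abbreviation "\<C> \<equiv> mnd_ob M"
abbreviation "\<S> \<equiv> mnd_end M"
abbreviation "S \<equiv> om_cell \<S>"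
abbreviation "\<eta> \<equiv> tr_cell (mnd_unit M)"
abbreviation "\<mu> \<equiv> tr_cell (mnd_mult M)"
abbreviation tens_C (\<open>_ \<otimes> _\<close> [75, 75] 74) where "f \<otimes> g \<equiv> f \<otimes>\<^bsub>\<C>\<^esub> g"
abbreviation tensc_C (\<open>_ \<odot> _\<close> [71, 71] 70) where "\<sigma> \<odot> \<tau> \<equiv> \<sigma> \<odot>\<^bsub>\<C>\<^esub> \<tau>"

text \<open>The rewrites express the general facts on monads directly through oplax morphisms and
  transformations, so that \<open>M_simps\<close> can be read off from
  \<open>oplax_monad\<close>.\<close>

sublocale Mon: two_category "Mon_op D P"
  rewrites "Obj (Mon_op D P) = {M. is_monoidal D P M}" and "Cell1 (Mon_op D P) = {m. is_oplax_mor D P m}"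
    and "Cell2 (Mon_op D P) = {t. is_oplax_trans D P t}"
    and "dom1 (Mon_op D P) = om_dom" and "cod1 (Mon_op D P) = om_cod"
    and "dom2 (Mon_op D P) = tr_dom" and "cod2 (Mon_op D P) = tr_cod"
    and "comp1 (Mon_op D P) = oplax_mor_comp D P"
  by (rule two_category_Mon_op) simp_all

lemma N_simps [simp]: "mnd_ob N = mo_ob \<C>" "mnd_end N = S" "mnd_unit N = \<eta>" "mnd_mult N = \<mu>"
  by (simp_all add: Mnd_map0_def Mon_op_forget_def)

lemma M_simps [simp]:
  "is_monoidal D P \<C>" "is_oplax_mor D P \<S>" "om_dom \<S> = \<C>" "om_cod \<S> = \<C>"
  "is_oplax_trans D P (mnd_unit M)" "tr_dom (mnd_unit M) = oplax_id \<C>" "tr_cod (mnd_unit M) = \<S>"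
  "is_oplax_trans D P (mnd_mult M)" "tr_dom (mnd_mult M) = \<S> \<diamondop> \<S>" "tr_cod (mnd_mult M) = \<S>"
  using Mon.monad_simps[OF oplax_monad] by simp_all

lemma algebra_simps:
  assumes "is_algebra D N X f a"
  shows "X \<in> Obj D" "f \<in> Cell1 D" "dom1 D f = X" "cod1 D f = mo_ob \<C>" "a \<in> Cell2 D" "dom2 D a = S \<cdot> f" "cod2 D a = f"
    "a \<bullet> (\<eta> \<lhd> f) = id2 D f" "a \<bullet> (\<mu> \<lhd> f) = a \<bullet> (S \<rhd> a)"
  using assms by (simp_all add: is_algebra_def)

lemma algebra_tens:
  assumes a: "is_algebra D N X f a" and b: "is_algebra D N X g b"
  shows "is_algebra D N X (f \<otimes> g) ((a \<odot> b) \<bullet> phi_at \<S> f g)"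
proof -
  note [simp] = algebra_simps(1-7)[OF a] algebra_simps(1-7)[OF b]
  let ?\<phi> = "phi_at \<S>"
  \<comment> \<open>The structure cells of \<open>oplax_id\<close> are identities, so only that of
    \<S> remains in the axiom for the monad unit.\<close>
  have "?\<phi> f g \<bullet> (\<eta> \<lhd> (f \<otimes> g)) = (\<eta> \<lhd> f) \<odot> (\<eta> \<lhd> g)"
    using oplax_trans_phi_at[of "mnd_unit M" f X g] by (simp add: phi_at_strict)
  then have "((a \<odot> b) \<bullet> ?\<phi> f g) \<bullet> (\<eta> \<lhd> (f \<otimes> g)) = (a \<bullet> (\<eta> \<lhd> f)) \<odot> (b \<bullet> (\<eta> \<lhd> g))"
    by simp
  also have "\<dots> = id2 D (f \<otimes> g)"
    unfolding algebra_simps(8)[OF a] algebra_simps(8)[OF b] by simp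
  finally have u: "((a \<odot> b) \<bullet> ?\<phi> f g) \<bullet> (\<eta> \<lhd> (f \<otimes> g)) = id2 D (f \<otimes> g)" .
  have "?\<phi> f g \<bullet> (\<mu> \<lhd> (f \<otimes> g)) = ((\<mu> \<lhd> f) \<odot> (\<mu> \<lhd> g)) \<bullet> ?\<phi> (S \<cdot> f) (S \<cdot> g) \<bullet> (S \<rhd> ?\<phi> f g)"
    using oplax_trans_phi_at[of "mnd_mult M" f X g] by simp
  then have "((a \<odot> b) \<bullet> ?\<phi> f g) \<bullet> (\<mu> \<lhd> (f \<otimes> g))
    = ((a \<bullet> (\<mu> \<lhd> f)) \<odot> (b \<bullet> (\<mu> \<lhd> g))) \<bullet> ?\<phi> (S \<cdot> f) (S \<cdot> g) \<bullet> (S \<rhd> ?\<phi> f g)"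
    by simp
  also have "\<dots> = (a \<odot> b) \<bullet> (((S \<rhd> a) \<odot> (S \<rhd> b)) \<bullet> ?\<phi> (S \<cdot> f) (S \<cdot> g)) \<bullet> (S \<rhd> ?\<phi> f g)"
    unfolding algebra_simps(9)[OF a] algebra_simps(9)[OF b] by simp
  \<comment> \<open>Naturality at \<open>a\<close> and \<open>b\<close> carries the actions past the
    structure cell, which completes the second copy of the new action.\<close>
  also have "((S \<rhd> a) \<odot> (S \<rhd> b)) \<bullet> ?\<phi> (S \<cdot> f) (S \<cdot> g) = ?\<phi> f g \<bullet> (S \<rhd> (a \<odot> b))"
    using phi_natural[of \<S> a "S \<cdot> f" f b "S \<cdot> g" g X] by simp
  also have "(a \<odot> b) \<bullet> (?\<phi> f g \<bullet> (S \<rhd> (a \<odot> b))) \<bullet> (S \<rhd> ?\<phi> f g)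
    = ((a \<odot> b) \<bullet> ?\<phi> f g) \<bullet> (S \<rhd> ((a \<odot> b) \<bullet> ?\<phi> f g))"
    by simp
  finally show ?thesis
    unfolding is_algebra_def N_simps using u by simp
qed

text \<open>The two algebra laws are the unit conditions on the oplax transformations \<eta> and
  \<mu>.\<close>

lemma algebra_unit:
  assumes [simp]: "X \<in> Obj D"
  shows "is_algebra D N X (unit_at \<C> X) (phi0_at \<S> X)"
proof -
  have "phi0_at \<S> X \<bullet> (\<eta> \<lhd> unit_at \<C> X) = id2 D (unit_at \<C> X)"
    using oplax_trans_phi0_at[of "mnd_unit M" X] by (simp add: phi0_at_strict)
  moreover have "phi0_at \<S> X \<bullet> (\<mu> \<lhd> unit_at \<C> X) = phi0_at \<S> X \<bullet> (S \<rhd> phi0_at \<S> X)"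
    using oplax_trans_phi0_at[of "mnd_mult M" X] by simp
  ultimately show ?thesis
    unfolding is_algebra_def N_simps by simp
qed

text \<open>Naturality of the associator at the actions, followed by the associativity axiom of the
  oplax morphism \<S>. The unitors behave in the same way, with the unit axioms of \<S>.\<close>

lemma assoc_algebra_mor:
  assumes f: "f \<in> hom1 D X (mo_ob \<C>)" "g \<in> hom1 D X (mo_ob \<C>)" "h \<in> hom1 D X (mo_ob \<C>)"
    and a: "a \<in> hom2 D (S \<cdot> f) f" "b \<in> hom2 D (S \<cdot> g) g" "c \<in> hom2 D (S \<cdot> h) h"
  shows "((((a \<odot> b) \<bullet> phi_at \<S> f g) \<odot> c) \<bullet> phi_at \<S> (f \<otimes> g) h) \<bullet> (S \<rhd> assoc_at \<C> f g h)
    = assoc_at \<C> f g h \<bullet> (a \<odot> ((b \<odot> c) \<bullet> phi_at \<S> g h)) \<bullet> phi_at \<S> f (g \<otimes> h)"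
proof -
  have [simp]: "X \<in> Obj D" "f \<in> Cell1 D" "dom1 D f = X" "cod1 D f = mo_ob \<C>" "g \<in> Cell1 D" "dom1 D g = X" "cod1 D g = mo_ob \<C>"
    "h \<in> Cell1 D" "dom1 D h = X" "cod1 D h = mo_ob \<C>" "a \<in> Cell2 D" "dom2 D a = S \<cdot> f" "cod2 D a = f"
    "b \<in> Cell2 D" "dom2 D b = S \<cdot> g" "cod2 D b = g" "c \<in> Cell2 D" "dom2 D c = S \<cdot> h" "cod2 D c = h"
    using f a dom1_Obj[of f] by simp_all
  let ?\<phi> = "phi_at \<S>" and ?\<alpha> = "assoc_at \<C>"
  have "?\<alpha> f g h \<bullet> (a \<odot> ((b \<odot> c) \<bullet> ?\<phi> g h)) \<bullet> ?\<phi> f (g \<otimes> h)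
    = (?\<alpha> f g h \<bullet> (a \<odot> (b \<odot> c))) \<bullet> (id2 D (S \<cdot> f) \<odot> ?\<phi> g h) \<bullet> ?\<phi> f (g \<otimes> h)"
    by simp
  also have "?\<alpha> f g h \<bullet> (a \<odot> (b \<odot> c)) = ((a \<odot> b) \<odot> c) \<bullet> ?\<alpha> (S \<cdot> f) (S \<cdot> g) (S \<cdot> h)"
    by (rule assoc_natural[where X = X]) simp_all
  also have "(((a \<odot> b) \<odot> c) \<bullet> ?\<alpha> (S \<cdot> f) (S \<cdot> g) (S \<cdot> h)) \<bullet> (id2 D (S \<cdot> f) \<odot> ?\<phi> g h) \<bullet> ?\<phi> f (g \<otimes> h)
    = ((a \<odot> b) \<odot> c) \<bullet> (?\<alpha> (S \<cdot> f) (S \<cdot> g) (S \<cdot> h) \<bullet> (id2 D (S \<cdot> f) \<odot> ?\<phi> g h) \<bullet> ?\<phi> f (g \<otimes> h))"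
    by simp
  also have "?\<alpha> (S \<cdot> f) (S \<cdot> g) (S \<cdot> h) \<bullet> (id2 D (S \<cdot> f) \<odot> ?\<phi> g h) \<bullet> ?\<phi> f (g \<otimes> h)
    = (?\<phi> f g \<odot> id2 D (S \<cdot> h)) \<bullet> ?\<phi> (f \<otimes> g) h \<bullet> (S \<rhd> ?\<alpha> f g h)"
    using oplax_assoc_at[of \<S> f X g h] by simp
  finally show ?thesis by simp
qed

lemma unit_algebra_mor:
  assumes f: "f \<in> hom1 D X (mo_ob \<C>)" and a: "a \<in> hom2 D (S \<cdot> f) f"
  shows "a \<bullet> (S \<rhd> lunit_at \<C> f) = lunit_at \<C> f \<bullet> (phi0_at \<S> X \<odot> a) \<bullet> phi_at \<S> (unit_at \<C> X) f"
    and "a \<bullet> (S \<rhd> runit_at \<C> f) = runit_at \<C> f \<bullet> (a \<odot> phi0_at \<S> X) \<bullet> phi_at \<S> f (unit_at \<C> X)"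
proof -
  have [simp]: "X \<in> Obj D" "f \<in> Cell1 D" "dom1 D f = X" "cod1 D f = mo_ob \<C>" 
    "a \<in> Cell2 D" "dom2 D a = S \<cdot> f" "cod2 D a = f"
    using f a dom1_Obj[of f] by simp_all
  let ?\<phi> = "phi_at \<S>" and ?i = "phi0_at \<S> X" and ?I = "unit_at \<C> X"
  have n: "lunit_at \<C> f \<bullet> (id2 D ?I \<odot> a) = a \<bullet> lunit_at \<C> (S \<cdot> f)"
    "runit_at \<C> f \<bullet> (a \<odot> id2 D ?I) = a \<bullet> runit_at \<C> (S \<cdot> f)"
    by (rule lunit_natural[where X = X]; simp)+
  have "lunit_at \<C> f \<bullet> (?i \<odot> a) \<bullet> ?\<phi> ?I f = (lunit_at \<C> f \<bullet> (id2 D ?I \<odot> a)) \<bullet> (?i \<odot> id2 D (S \<cdot> f)) \<bullet> ?\<phi> ?I f"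
    by simp
  also have "\<dots> = a \<bullet> (lunit_at \<C> (S \<cdot> f) \<bullet> (?i \<odot> id2 D (S \<cdot> f)) \<bullet> ?\<phi> ?I f)"
    unfolding n by simp
  also have "lunit_at \<C> (S \<cdot> f) \<bullet> (?i \<odot> id2 D (S \<cdot> f)) \<bullet> ?\<phi> ?I f = S \<rhd> lunit_at \<C> f"
    using oplax_lunit_at[of \<S> f X] by simp
  finally show "a \<bullet> (S \<rhd> lunit_at \<C> f) = lunit_at \<C> f \<bullet> (?i \<odot> a) \<bullet> ?\<phi> ?I f" ..
  have "runit_at \<C> f \<bullet> (a \<odot> ?i) \<bullet> ?\<phi> f ?I = (runit_at \<C> f \<bullet> (a \<odot> id2 D ?I)) \<bullet> (id2 D (S \<cdot> f) \<odot> ?i) \<bullet> ?\<phi> f ?I"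
    by simp
  also have "\<dots> = a \<bullet> (runit_at \<C> (S \<cdot> f) \<bullet> (id2 D (S \<cdot> f) \<odot> ?i) \<bullet> ?\<phi> f ?I)"
    unfolding n by simp
  also have "runit_at \<C> (S \<cdot> f) \<bullet> (id2 D (S \<cdot> f) \<odot> ?i) \<bullet> ?\<phi> f ?I = S \<rhd> runit_at \<C> f"
    using oplax_runit_at[of \<S> f X] by simp
  finally show "a \<bullet> (S \<rhd> runit_at \<C> f) = runit_at \<C> f \<bullet> (a \<odot> ?i) \<bullet> ?\<phi> f ?I" ..
qed

section \<open>The monoidal structure on the Eilenberg-Moore object\<close>

lemma U_algebra: "g \<in> hom1 D X E \<Longrightarrow> is_algebra D N X (U \<cdot> g) (\<chi> \<lhd> g)"
  by (rule is_algebra_comp[OF monad algebra_U])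

text \<open>The two projections from \<open>prd P E E\<close>, composed with \<open>U\<close>, form
  the generic pair of algebras, and it is their tensor product that is lifted. Other pairs are
  obtained by precomposition.\<close>

definition em_tensor :: 'f where
  "em_tensor = lift (prd P E E) (U \<cdot> pr1 P E E \<otimes> U \<cdot> pr2 P E E)
     (((\<chi> \<lhd> pr1 P E E) \<odot> (\<chi> \<lhd> pr2 P E E)) \<bullet> phi_at \<S> (U \<cdot> pr1 P E E) (U \<cdot> pr2 P E E))"

definition em_unit :: 'f where
  "em_unit = lift (one P) (unit_at \<C> (one P)) (phi0_at \<S> (one P))"

lemma em_tensor_simps [simp]:
  "em_tensor \<in> Cell1 D" "dom1 D em_tensor = prd P E E" "cod1 D em_tensor = E"
  and U_em_tensor: "U \<cdot> em_tensor = U \<cdot> pr1 P E E \<otimes> U \<cdot> pr2 P E E"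
  and chi_em_tensor: "\<chi> \<lhd> em_tensor =
    ((\<chi> \<lhd> pr1 P E E) \<odot> (\<chi> \<lhd> pr2 P E E)) \<bullet> phi_at \<S> (U \<cdot> pr1 P E E) (U \<cdot> pr2 P E E)"
  unfolding em_tensor_def
  by (rule lift_simps[OF algebra_tens[OF U_algebra U_algebra]]; simp)+

lemma em_unit_simps [simp]:
  "em_unit \<in> Cell1 D" "dom1 D em_unit = one P" "cod1 D em_unit = E"
  and U_em_unit: "U \<cdot> em_unit = unit_at \<C> (one P)"
  and chi_em_unit: "\<chi> \<lhd> em_unit = phi0_at \<S> (one P)"
  unfolding em_unit_def by (rule lift_simps[OF algebra_unit]; simp)+

text \<open>Precomposition with the pair specializes the generic case. The second equation says that
  the action on a tensor product is the one of \<open>algebra_tens\<close>.\<close>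

lemma U_tensor_pair [simp]:
  assumes "f \<in> Cell1 D" "g \<in> Cell1 D" "cod1 D f = E" "cod1 D g = E" "dom1 D g = dom1 D f"
  shows "U \<cdot> em_tensor \<cdot> \<langle>f, g\<rangle> = U \<cdot> f \<otimes> U \<cdot> g"
    "\<chi> \<lhd> (em_tensor \<cdot> \<langle>f, g\<rangle>) = ((\<chi> \<lhd> f) \<odot> (\<chi> \<lhd> g)) \<bullet> phi_at \<S> (U \<cdot> f) (U \<cdot> g)"
proof -
  have "U \<cdot> em_tensor \<cdot> \<langle>f, g\<rangle> = (U \<cdot> em_tensor) \<cdot> \<langle>f, g\<rangle>" using assms by simp
  also have "\<dots> = U \<cdot> f \<otimes> U \<cdot> g" unfolding U_em_tensor using assms by simp
  finally show "U \<cdot> em_tensor \<cdot> \<langle>f, g\<rangle> = U \<cdot> f \<otimes> U \<cdot> g" .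
  have "\<chi> \<lhd> (em_tensor \<cdot> \<langle>f, g\<rangle>) = (\<chi> \<lhd> em_tensor) \<lhd> \<langle>f, g\<rangle>" using assms by simp
  also have "\<dots> = ((\<chi> \<lhd> f) \<odot> (\<chi> \<lhd> g)) \<bullet> phi_at \<S> (U \<cdot> f) (U \<cdot> g)"
    unfolding chi_em_tensor using assms by simp
  finally show "\<chi> \<lhd> (em_tensor \<cdot> \<langle>f, g\<rangle>) = ((\<chi> \<lhd> f) \<odot> (\<chi> \<lhd> g)) \<bullet> phi_at \<S> (U \<cdot> f) (U \<cdot> g)" .
qed

lemma U_unit_bang [simp]:
  assumes "X \<in> Obj D"
  shows "U \<cdot> em_unit \<cdot> !\<^sub>X = unit_at \<C> X" "\<chi> \<lhd> (em_unit \<cdot> !\<^sub>X) = phi0_at \<S> X"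
proof -
  have "U \<cdot> em_unit \<cdot> !\<^sub>X = (U \<cdot> em_unit) \<cdot> !\<^sub>X" using assms by simp
  also have "\<dots> = unit_at \<C> X" unfolding U_em_unit using assms by simp
  finally show "U \<cdot> em_unit \<cdot> !\<^sub>X = unit_at \<C> X" .
  have "\<chi> \<lhd> (em_unit \<cdot> !\<^sub>X) = (\<chi> \<lhd> em_unit) \<lhd> !\<^sub>X" using assms by simp
  also have "\<dots> = phi0_at \<S> X" unfolding chi_em_unit using assms by simp
  finally show "\<chi> \<lhd> (em_unit \<cdot> !\<^sub>X) = phi0_at \<S> X" .
qed

definition em_assoc :: 'c where
  "em_assoc = lift2 (assoc_at \<C> (U \<cdot> q1 E) (U \<cdot> q2 E) (U \<cdot> q3 E))
     (em_tensor \<cdot> \<langle>q1 E, em_tensor \<cdot> \<langle>q2 E, q3 E\<rangle>\<rangle>) (em_tensor \<cdot> \<langle>em_tensor \<cdot> \<langle>q1 E, q2 E\<rangle>, q3 E\<rangle>)"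

definition em_lunit :: 'c where
  "em_lunit = lift2 (lunit_at \<C> U) (em_tensor \<cdot> \<langle>em_unit \<cdot> !\<^sub>E, id1 D E\<rangle>) (id1 D E)"

definition em_runit :: 'c where
  "em_runit = lift2 (runit_at \<C> U) (em_tensor \<cdot> \<langle>id1 D E, em_unit \<cdot> !\<^sub>E\<rangle>) (id1 D E)"

lemma em_assoc_simps:
  "em_assoc \<in> Cell2 D" "dom2 D em_assoc = em_tensor \<cdot> \<langle>q1 E, em_tensor \<cdot> \<langle>q2 E, q3 E\<rangle>\<rangle>"
  "cod2 D em_assoc = em_tensor \<cdot> \<langle>em_tensor \<cdot> \<langle>q1 E, q2 E\<rangle>, q3 E\<rangle>"
  "U \<rhd> em_assoc = assoc_at \<C> (U \<cdot> q1 E) (U \<cdot> q2 E) (U \<cdot> q3 E)"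
proof -
  let ?d = "em_tensor \<cdot> \<langle>q1 E, em_tensor \<cdot> \<langle>q2 E, q3 E\<rangle>\<rangle>" and ?c = "em_tensor \<cdot> \<langle>em_tensor \<cdot> \<langle>q1 E, q2 E\<rangle>, q3 E\<rangle>"
    and ?\<sigma> = "assoc_at \<C> (U \<cdot> q1 E) (U \<cdot> q2 E) (U \<cdot> q3 E)"
  have 1: "?d \<in> hom1 D (prd P E (prd P E E)) E" "?c \<in> hom1 D (prd P E (prd P E E)) E" by simp_all
  have 2: "?\<sigma> \<in> hom2 D (U \<cdot> ?d) (U \<cdot> ?c)" by simp
  \<comment> \<open>The associator has to commute with the actions on its boundary, which simp
    computes by \<open>U_tensor_pair\<close>.\<close>
  have 3: "(\<chi> \<lhd> ?c) \<bullet> (mnd_end N \<rhd> ?\<sigma>) = ?\<sigma> \<bullet> (\<chi> \<lhd> ?d)"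
    using assoc_algebra_mor[of "U \<cdot> q1 E" "prd P E (prd P E E)" "U \<cdot> q2 E" "U \<cdot> q3 E" "\<chi> \<lhd> q1 E" "\<chi> \<lhd> q2 E" "\<chi> \<lhd> q3 E"]
    by simp
  show "em_assoc \<in> Cell2 D" "dom2 D em_assoc = ?d" "cod2 D em_assoc = ?c" "U \<rhd> em_assoc = ?\<sigma>"
    unfolding em_assoc_def by (rule lift2_simps[OF 1 2 3])+
qed

lemma em_lunit_simps:
  "em_lunit \<in> Cell2 D" "dom2 D em_lunit = em_tensor \<cdot> \<langle>em_unit \<cdot> !\<^sub>E, id1 D E\<rangle>" "cod2 D em_lunit = id1 D E"
  "U \<rhd> em_lunit = lunit_at \<C> U"
proof -
  let ?d = "em_tensor \<cdot> \<langle>em_unit \<cdot> !\<^sub>E, id1 D E\<rangle>" and ?\<sigma> = "lunit_at \<C> U"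
  have 1: "?d \<in> hom1 D E E" "id1 D E \<in> hom1 D E E" by simp_all
  have 2: "?\<sigma> \<in> hom2 D (U \<cdot> ?d) (U \<cdot> id1 D E)" by simp
  have 3: "(\<chi> \<lhd> id1 D E) \<bullet> (mnd_end N \<rhd> ?\<sigma>) = ?\<sigma> \<bullet> (\<chi> \<lhd> ?d)"
    using unit_algebra_mor(1)[of U E \<chi>] by simp
  show "em_lunit \<in> Cell2 D" "dom2 D em_lunit = ?d" "cod2 D em_lunit = id1 D E" "U \<rhd> em_lunit = ?\<sigma>"
    unfolding em_lunit_def by (rule lift2_simps[OF 1 2 3])+
qed

lemma em_runit_simps:
  "em_runit \<in> Cell2 D" "dom2 D em_runit = em_tensor \<cdot> \<langle>id1 D E, em_unit \<cdot> !\<^sub>E\<rangle>" "cod2 D em_runit = id1 D E"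
  "U \<rhd> em_runit = runit_at \<C> U"
proof -
  let ?d = "em_tensor \<cdot> \<langle>id1 D E, em_unit \<cdot> !\<^sub>E\<rangle>" and ?\<sigma> = "runit_at \<C> U"
  have 1: "?d \<in> hom1 D E E" "id1 D E \<in> hom1 D E E" by simp_all
  have 2: "?\<sigma> \<in> hom2 D (U \<cdot> ?d) (U \<cdot> id1 D E)" by simp
  have 3: "(\<chi> \<lhd> id1 D E) \<bullet> (mnd_end N \<rhd> ?\<sigma>) = ?\<sigma> \<bullet> (\<chi> \<lhd> ?d)"
    using unit_algebra_mor(2)[of U E \<chi>] by simp
  show "em_runit \<in> Cell2 D" "dom2 D em_runit = ?d" "cod2 D em_runit = id1 D E" "U \<rhd> em_runit = ?\<sigma>"
    unfolding em_runit_def by (rule lift2_simps[OF 1 2 3])+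
qed

definition em_monoidal :: "('o, 'f, 'c) monoidal"  (\<open>\<E>\<close>) where
  "\<E> = Monoidal E em_tensor em_unit em_assoc em_lunit em_runit"

lemma em_sel [simp]: "mo_ob \<E> = E" "mo_tensor \<E> = em_tensor" "mo_unit \<E> = em_unit" "mo_assoc \<E> = em_assoc"
  "mo_lunit \<E> = em_lunit" "mo_runit \<E> = em_runit"
  by (simp_all add: em_monoidal_def)

lemma em_monoidal_data [simp]: "monoidal_data \<E>"
  by (simp add: monoidal_data_def tens_def unit_at_def em_assoc_simps em_lunit_simps em_runit_simps)

text \<open>These rules and those of the next lemmas push \<open>U\<close> and \<chi> through the
  structure of \<E>, so that an equation of 2-cells into \<open>E\<close> turns into its counterpart
  in \<C>.\<close>

lemma em_tens [simp]:
  assumes "f \<in> Cell1 D" "g \<in> Cell1 D" "cod1 D f = E" "cod1 D g = E" "dom1 D g = dom1 D f"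
  shows "U \<cdot> (f \<otimes>\<^bsub>\<E>\<^esub> g) = U \<cdot> f \<otimes> U \<cdot> g"
    "\<chi> \<lhd> (f \<otimes>\<^bsub>\<E>\<^esub> g) = ((\<chi> \<lhd> f) \<odot> (\<chi> \<lhd> g)) \<bullet> phi_at \<S> (U \<cdot> f) (U \<cdot> g)"
  using U_tensor_pair[OF assms] by (simp_all add: tens_def[of _ \<E>])

lemma em_unit_at [simp]:
  assumes "X \<in> Obj D"
  shows "U \<cdot> unit_at \<E> X = unit_at \<C> X" "\<chi> \<lhd> unit_at \<E> X = phi0_at \<S> X"
  using assms by (simp_all add: unit_at_def[of \<E>])

lemma em_tensc [simp]:
  assumes "\<sigma> \<in> Cell2 D" "\<tau> \<in> Cell2 D" "cod1 D (dom2 D \<sigma>) = E" "cod1 D (dom2 D \<tau>) = E"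
    "dom1 D (dom2 D \<tau>) = dom1 D (dom2 D \<sigma>)"
  shows "U \<rhd> (\<sigma> \<odot>\<^bsub>\<E>\<^esub> \<tau>) = (U \<rhd> \<sigma>) \<odot> (U \<rhd> \<tau>)"
proof -
  have "U \<rhd> (\<sigma> \<odot>\<^bsub>\<E>\<^esub> \<tau>) = (U \<cdot> em_tensor) \<rhd> \<llangle>\<sigma>, \<tau>\<rrangle>"
    using assms by (simp add: tensc_def[of _ \<E>])
  also have "\<dots> = (U \<rhd> \<sigma>) \<odot> (U \<rhd> \<tau>)"
    unfolding U_em_tensor using assms by simp
  finally show ?thesis .
qed

lemma em_assoc_at [simp]:
  assumes "f \<in> Cell1 D" "g \<in> Cell1 D" "h \<in> Cell1 D" "cod1 D f = E" "cod1 D g = E" "cod1 D h = E"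
    "dom1 D g = dom1 D f" "dom1 D h = dom1 D f"
  shows "U \<rhd> assoc_at \<E> f g h = assoc_at \<C> (U \<cdot> f) (U \<cdot> g) (U \<cdot> h)"
proof -
  have "U \<rhd> assoc_at \<E> f g h = (U \<rhd> em_assoc) \<lhd> \<langle>f, \<langle>g, h\<rangle>\<rangle>"
    using assms by (simp add: assoc_at_def[of \<E>] em_assoc_simps(1,2))
  also have "\<dots> = assoc_at \<C> (U \<cdot> f) (U \<cdot> g) (U \<cdot> h)"
    unfolding em_assoc_simps(4) using assms by simp
  finally show ?thesis .
qed

lemma em_lunit_at [simp]:
  assumes "f \<in> Cell1 D" "cod1 D f = E"
  shows "U \<rhd> lunit_at \<E> f = lunit_at \<C> (U \<cdot> f)" "U \<rhd> runit_at \<E> f = runit_at \<C> (U \<cdot> f)"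
proof -
  have "U \<rhd> lunit_at \<E> f = (U \<rhd> em_lunit) \<lhd> f" "U \<rhd> runit_at \<E> f = (U \<rhd> em_runit) \<lhd> f"
    using assms by (simp_all add: lunit_at_def[of \<E>] runit_at_def[of \<E>] em_lunit_simps(1,2) em_runit_simps(1,2))
  then show "U \<rhd> lunit_at \<E> f = lunit_at \<C> (U \<cdot> f)" "U \<rhd> runit_at \<E> f = runit_at \<C> (U \<cdot> f)"
    unfolding em_lunit_simps(4) em_runit_simps(4) using assms by simp_all
qed

lemma em_is_monoidal [simp]: "is_monoidal D P \<E>"
proof -
  have "invertible2 D (mo_assoc \<C>)" "invertible2 D (mo_lunit \<C>)" "invertible2 D (mo_runit \<C>)"
    using M_simps(1) unfolding is_monoidal_iff by blast+
  \<comment> \<open>The structure cells at elements in the image of \<open>U\<close> are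
    restrictions of invertible cells, and \<open>U\<close> reflects invertibility.\<close>
  then have "invertible2 D (assoc_at \<C> (U \<cdot> q1 E) (U \<cdot> q2 E) (U \<cdot> q3 E))"
    "invertible2 D (lunit_at \<C> U)" "invertible2 D (runit_at \<C> U)"
    unfolding assoc_at_def lunit_at_def runit_at_def by - (rule invertible2_pre_whisker; simp)+
  then have "invertible2 D em_assoc" "invertible2 D em_lunit" "invertible2 D em_runit"
    by - (rule reflects_invertible2; simp add: em_assoc_simps em_lunit_simps em_runit_simps)+
  \<comment> \<open>Under \<open>U\<close> both sides become those of the pentagon of \<C> at the
    images of the four projections; the triangle is handled in the same way.\<close>
  moreover have "pentagon D P (mo_ob \<E>) (mo_tensor \<E>) (mo_assoc \<E>)"
    unfolding pentagon_iff Let_def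
    by (rule lift2_eqI) (use pentagon_at[of \<C> "U \<cdot> p1 E" "prd P E (prd P E (prd P E E))" "U \<cdot> p2 E" "U \<cdot> p3 E" "U \<cdot> p4 E"] in simp_all)
  moreover have "triangle D P (mo_ob \<E>) (mo_tensor \<E>) (mo_unit \<E>) (mo_assoc \<E>) (mo_lunit \<E>) (mo_runit \<E>)"
    unfolding triangle_iff Let_def
    by (rule lift2_eqI) (use triangle_at[of \<C> "U \<cdot> pr1 P E E" "prd P E E" "U \<cdot> pr2 P E E"] in simp_all)
  ultimately show ?thesis
    unfolding is_monoidal_iff by simp
qed

section \<open>Universality of the lifted object among oplax algebras\<close>

definition em_forget :: "('o, 'f, 'c) oplax_mor"  (\<open>\<U>\<close>) where
  "\<U> = OplaxMor \<E> \<C> U (id2 D (U \<cdot> em_tensor)) (id2 D (U \<cdot> em_unit))"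

definition em_action :: "(('o, 'f, 'c) oplax_mor, 'c) trans" where
  "em_action = Trans (\<S> \<diamondop> \<U>) \<U> \<chi>"

lemma forget_sel [simp]: "om_dom \<U> = \<E>" "om_cod \<U> = \<C>" "om_cell \<U> = U"
  "om_phi \<U> = id2 D (U \<cdot> em_tensor)" "om_phi0 \<U> = id2 D (U \<cdot> em_unit)"
  by (simp_all add: em_forget_def)

lemma action_sel [simp]: "tr_dom em_action = \<S> \<diamondop> \<U>" "tr_cod em_action = \<U>" "tr_cell em_action = \<chi>"
  by (simp_all add: em_action_def)

lemma forget_is_oplax_mor [simp]: "is_oplax_mor D P \<U>"
  using is_oplax_mor_strict[of \<E> \<C> U] by (auto simp: em_forget_def)

lemma forget_phi_at [simp]:
  assumes "f \<in> Cell1 D" "g \<in> Cell1 D" "cod1 D f = E" "cod1 D g = E" "dom1 D g = dom1 D f"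
  shows "phi_at \<U> f g = id2 D (U \<cdot> f \<otimes> U \<cdot> g)"
  using assms by (simp add: phi_at_strict)

lemma forget_phi0_at [simp]: "X \<in> Obj D \<Longrightarrow> phi0_at \<U> X = id2 D (unit_at \<C> X)"
  by (simp add: phi0_at_strict)

text \<open>As the structure cells of \<U> are identities, the axioms are just the formulas for the
  action on tensor products and on the unit object.\<close>

lemma action_is_oplax_trans [simp]: "is_oplax_trans D P em_action"
  by (rule is_oplax_transI) (auto simp: is_oplax_mor_comp)

text \<open>2-cells of \<open>Mon_op D P\<close> are equal when their boundaries and underlying
  cells agree. Once the boundaries are fixed, the algebra laws are therefore those in
  \<open>D\<close>.\<close>

lemma oplax_algebra_iff:
  "is_algebra (Mon_op D P) M X f a \<longleftrightarrow> is_oplax_mor D P f \<and> om_dom f = X \<and> om_cod f = \<C> \<and>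
    is_oplax_trans D P a \<and> tr_dom a = (\<S> \<diamondop> f) \<and> tr_cod a = f \<and>
    is_algebra D N (mo_ob X) (om_cell f) (tr_cell a)" (is "?l \<longleftrightarrow> ?r")
proof (cases "is_oplax_mor D P f \<and> om_dom f = X \<and> om_cod f = \<C> \<and>
    is_oplax_trans D P a \<and> tr_dom a = (\<S> \<diamondop> f) \<and> tr_cod a = f")
  case True
  then have f [simp]: "is_oplax_mor D P f" "om_dom f = X" "om_cod f = \<C>"
    "is_oplax_trans D P a" "tr_dom a = \<S> \<diamondop> f" "tr_cod a = f"
    by blast+
  have X [simp]: "is_monoidal D P X" "mo_ob X \<in> Obj D" using oplax_mor_simps(2)[OF f(1)] by simp_all
  have c [simp]: "tr_cell a \<in> Cell2 D" "dom2 D (tr_cell a) = S \<cdot> om_cell f" "cod2 D (tr_cell a) = om_cell f"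
    "om_cell f \<in> Cell1 D" "dom1 D (om_cell f) = mo_ob X" "cod1 D (om_cell f) = mo_ob \<C>"
    using oplax_trans_simps(5-7)[OF f(4)] oplax_data_simps(3-5)[of f] by simp_all
  have id: "oplax_id \<C> \<diamondop> f = f"
    using oplax_mor_comp_id(1)[OF f(1)] by simp
  have assoc: "((\<S> \<diamondop> \<S>) \<diamondop> f) = (\<S> \<diamondop> (\<S> \<diamondop> f))"
    by (rule oplax_mor_comp_assoc) simp_all
  show ?thesis
    unfolding is_algebra_def
    by (simp add: pre_whisker_def[of "Mon_op D P"] post_whisker_def[of "Mon_op D P"] id assoc
        flip: pre_whisker_def[of D] post_whisker_def[of D])
next
  case False
  then show ?thesis unfolding is_algebra_def by auto
qed

lemma oplax_lift:
  assumes alg: "is_algebra (Mon_op D P) M X f a"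
  shows "\<exists>!g. g \<in> hom1 (Mon_op D P) X \<E> \<and> (\<U> \<diamondop> g) = f \<and> em_action \<lhd>\<^bsub>Mon_op D P\<^esub> g = a"
proof -
  have f: "is_oplax_mor D P f" "om_dom f = X" "om_cod f = \<C>" "is_oplax_trans D P a"
    "tr_dom a = \<S> \<diamondop> f" "tr_cod a = f"
    and alg': "is_algebra D N (mo_ob X) (om_cell f) (tr_cell a)"
    using alg unfolding oplax_algebra_iff by blast+
  note [simp] = f
  let ?A = "mo_ob X" and ?F = "om_cell f"
  have X [simp]: "is_monoidal D P X" "?A \<in> Obj D"
    using oplax_mor_simps(2)[OF f(1)] by simp_all
  have c [simp]: "tr_cell a \<in> Cell2 D" "dom2 D (tr_cell a) = S \<cdot> ?F" "cod2 D (tr_cell a) = ?F"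
    "?F \<in> Cell1 D" "dom1 D ?F = ?A" "cod1 D ?F = mo_ob \<C>"
    using oplax_trans_simps(5-7)[OF f(4)] oplax_data_simps(3-5)[of f] by simp_all
  define G where "G = lift ?A ?F (tr_cell a)"
  have G [simp]: "G \<in> Cell1 D" "dom1 D G = ?A" "cod1 D G = E" and UG: "U \<cdot> G = ?F" and chiG: "\<chi> \<lhd> G = tr_cell a"
    unfolding G_def by (rule lift_simps[OF alg'])+
  \<comment> \<open>The defining equations of \<open>G\<close>, restated for composites that
    continue to the right.\<close>
  have UG' [simp]: "U \<cdot> G \<cdot> h = ?F \<cdot> h" if "h \<in> Cell1 D" "cod1 D h = ?A" for h
    using comp1_assoc'[of h G U] UG that by simp
  have UG2 [simp]: "U \<rhd> G \<rhd> \<rho> = ?F \<rhd> \<rho>" if "\<rho> \<in> Cell2 D" "cod1 D (dom2 D \<rho>) = ?A" for \<rho>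
    using post_whisker_comp1[of G U \<rho>] UG that by simp
  have chiG' [simp]: "\<chi> \<lhd> (G \<cdot> h) = tr_cell a \<lhd> h" if "h \<in> Cell1 D" "cod1 D h = ?A" for h
    using pre_whisker_comp1[of h G \<chi>] chiG that by simp
  let ?p = "pr1 P ?A ?A" and ?p' = "pr2 P ?A ?A"
  \<comment> \<open>Candidates for the structure cells of the lifted morphism, namely the lifts of
    those of \<open>f\<close>.\<close>
  let ?\<gamma> = "lift2 (om_phi f) (G \<cdot> mo_tensor X) (G \<cdot> ?p \<otimes>\<^bsub>\<E>\<^esub> G \<cdot> ?p')"
  let ?\<gamma>\<^sub>0 = "lift2 (om_phi0 f) (G \<cdot> mo_unit X) em_unit"
  \<comment> \<open>The axiom of the transformation \<open>a\<close> at the two projections is the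
    condition for \<open>om_phi f\<close> to be a morphism of algebras; likewise below for
    \<open>om_phi0 f\<close>.\<close>
  have "(\<chi> \<lhd> (G \<cdot> ?p \<otimes>\<^bsub>\<E>\<^esub> G \<cdot> ?p')) \<bullet> (mnd_end N \<rhd> om_phi f) = om_phi f \<bullet> (\<chi> \<lhd> (G \<cdot> mo_tensor X))"
    using oplax_trans_phi_at[of a ?p "prd P ?A ?A" ?p'] by (simp add: phi_at_pr tens_pr)
  then have \<gamma>: "?\<gamma> \<in> Cell2 D" "dom2 D ?\<gamma> = G \<cdot> mo_tensor X" "cod2 D ?\<gamma> = G \<cdot> ?p \<otimes>\<^bsub>\<E>\<^esub> G \<cdot> ?p'" "U \<rhd> ?\<gamma> = om_phi f"
    by - (rule lift2_simps[where X = "prd P ?A ?A"]; simp)+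
  have "(\<chi> \<lhd> em_unit) \<bullet> (mnd_end N \<rhd> om_phi0 f) = om_phi0 f \<bullet> (\<chi> \<lhd> (G \<cdot> mo_unit X))"
    using oplax_trans_phi0_at[of a "one P"] by (simp add: phi0_at_one unit_at_one chi_em_unit)
  then have \<gamma>0: "?\<gamma>\<^sub>0 \<in> Cell2 D" "dom2 D ?\<gamma>\<^sub>0 = G \<cdot> mo_unit X" "cod2 D ?\<gamma>\<^sub>0 = em_unit" "U \<rhd> ?\<gamma>\<^sub>0 = om_phi0 f"
    by - (rule lift2_simps[where X = "one P"]; simp add: U_em_unit unit_at_one)+
  define g where "g = OplaxMor X \<E> G ?\<gamma> ?\<gamma>\<^sub>0"
  have g [simp]: "om_dom g = X" "om_cod g = \<E>" "om_cell g = G" and g': "om_phi g = ?\<gamma>" "om_phi0 g = ?\<gamma>\<^sub>0"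
    by (simp_all add: g_def)
  have [simp]: "oplax_data g"
    using \<gamma> \<gamma>0 by (simp add: oplax_data_def g')
  have phi [simp]: "U \<rhd> phi_at g h k = phi_at f h k"
    if "h \<in> Cell1 D" "k \<in> Cell1 D" "cod1 D h = ?A" "cod1 D k = ?A" "dom1 D k = dom1 D h" for h k
    using post_pre_whisker[of U "\<langle>h, k\<rangle>" ?\<gamma>] \<gamma> that by (simp add: phi_at_def g')
  have phi0 [simp]: "U \<rhd> phi0_at g Y = phi0_at f Y" if "Y \<in> Obj D" for Y
    using post_pre_whisker[of U "!\<^sub>Y" ?\<gamma>\<^sub>0] \<gamma>0 that by (simp add: phi0_at_def g')
  have mor [simp]: "is_oplax_mor D P g"
  proof (rule is_oplax_morI)
    show "om_phi g \<in> hom2 D (om_cell g \<cdot> mo_tensor (om_dom g)) (om_cell g \<cdot> pr1 P A A \<otimes>\<^bsub>om_cod g\<^esub> om_cell g \<cdot> pr2 P A A)"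
      if "A = mo_ob (om_dom g)" for A
      using that \<gamma> by (simp add: g')
    show "om_phi0 g \<in> hom2 D (om_cell g \<cdot> mo_unit (om_dom g)) (mo_unit (om_cod g))"
      using \<gamma>0 by (simp add: g')
  next
    fix Y h k l assume "h \<in> hom1 D Y (mo_ob (om_dom g))" "k \<in> hom1 D Y (mo_ob (om_dom g))" "l \<in> hom1 D Y (mo_ob (om_dom g))"
    note [simp] = hom1D[OF this(1)] hom1D[OF this(2)] hom1D[OF this(3)]
    show "assoc_at (om_cod g) (om_cell g \<cdot> h) (om_cell g \<cdot> k) (om_cell g \<cdot> l)
        \<bullet> (id2 D (om_cell g \<cdot> h) \<odot>\<^bsub>om_cod g\<^esub> phi_at g k l) \<bullet> phi_at g h (k \<otimes>\<^bsub>om_dom g\<^esub> l)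
      = (phi_at g h k \<odot>\<^bsub>om_cod g\<^esub> id2 D (om_cell g \<cdot> l)) \<bullet> phi_at g (h \<otimes>\<^bsub>om_dom g\<^esub> k) l
        \<bullet> (om_cell g \<rhd> assoc_at (om_dom g) h k l)"
      by (rule lift2_eqI) (use oplax_assoc_at[of f h Y k l] in simp_all)
  next
    fix Y h assume "h \<in> hom1 D Y (mo_ob (om_dom g))"
    note [simp] = hom1D[OF this]
    show "runit_at (om_cod g) (om_cell g \<cdot> h) \<bullet> (id2 D (om_cell g \<cdot> h) \<odot>\<^bsub>om_cod g\<^esub> phi0_at g Y)
        \<bullet> phi_at g h (unit_at (om_dom g) Y) = om_cell g \<rhd> runit_at (om_dom g) h"
      by (rule lift2_eqI) (use oplax_runit_at[of f h Y] in simp_all)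
    show "lunit_at (om_cod g) (om_cell g \<cdot> h) \<bullet> (phi0_at g Y \<odot>\<^bsub>om_cod g\<^esub> id2 D (om_cell g \<cdot> h))
        \<bullet> phi_at g (unit_at (om_dom g) Y) h = om_cell g \<rhd> lunit_at (om_dom g) h"
      by (rule lift2_eqI) (use oplax_lunit_at[of f h Y] in simp_all)
  qed simp_all
  \<comment> \<open>\<U> has identity structure cells, so composition with it only whiskers those of
    \<open>k\<close> by \<open>U\<close>.\<close>
  have comp_U: "om_phi (\<U> \<diamondop> k) = U \<rhd> om_phi k" "om_phi0 (\<U> \<diamondop> k) = U \<rhd> om_phi0 k"
    if "is_oplax_mor D P k" "om_cod k = \<E>" for k
    using that by (simp_all add: om_phi_comp U_em_unit unit_at_one)
  have Ug: "(\<U> \<diamondop> g) = f"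
    by (rule oplax_mor.expand) (use \<gamma> \<gamma>0 in \<open>simp add: comp_U UG g' del: oplax_mor_comp_simps(4)\<close>)
  have whisk: "em_action \<lhd>\<^bsub>Mon_op D P\<^esub> k = Trans (\<S> \<diamondop> (\<U> \<diamondop> k)) (\<U> \<diamondop> k) (\<chi> \<lhd> om_cell k)"
    if "is_oplax_mor D P k" "om_cod k = \<E>" for k
    using that oplax_mor_comp_assoc[of k \<U> \<S>] by (simp add: pre_whisker_def)
  show ?thesis
  proof (rule ex1I)
    show "g \<in> hom1 (Mon_op D P) X \<E> \<and> (\<U> \<diamondop> g) = f \<and> em_action \<lhd>\<^bsub>Mon_op D P\<^esub> g = a"
      using Ug by (auto simp: whisk chiG intro: trans.expand)
    fix k assume k: "k \<in> hom1 (Mon_op D P) X \<E> \<and> (\<U> \<diamondop> k) = f \<and> em_action \<lhd>\<^bsub>Mon_op D P\<^esub> k = a"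
    then have k' [simp]: "is_oplax_mor D P k" "om_dom k = X" "om_cod k = \<E>" by simp_all
    have kc [simp]: "om_cell k \<in> Cell1 D" "dom1 D (om_cell k) = ?A" "cod1 D (om_cell k) = E"
      using oplax_data_simps(3-5)[of k] by simp_all
    have Uk: "(\<U> \<diamondop> k) = \<U> \<diamondop> g" using k Ug by simp
    have "om_cell (\<U> \<diamondop> k) = om_cell (\<U> \<diamondop> g)" "om_phi (\<U> \<diamondop> k) = om_phi (\<U> \<diamondop> g)"
      "om_phi0 (\<U> \<diamondop> k) = om_phi0 (\<U> \<diamondop> g)"
      unfolding Uk by (rule refl)+
    then have eq: "U \<cdot> om_cell k = U \<cdot> G" "U \<rhd> om_phi k = U \<rhd> om_phi g" "U \<rhd> om_phi0 k = U \<rhd> om_phi0 g"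
      by (simp_all add: comp_U del: oplax_mor_comp_simps(4))
    have "tr_cell (em_action \<lhd>\<^bsub>Mon_op D P\<^esub> k) = tr_cell a" using k by simp
    then have "\<chi> \<lhd> om_cell k = \<chi> \<lhd> G"
      using whisk[of k] chiG by simp
    \<comment> \<open>The underlying 1-cell is determined by \<open>U\<close> together with \<chi>.
      Only once it is known do the structure cells have equal boundaries, and then faithfulness of
      \<open>U\<close> settles them.\<close>
    then have kG: "om_cell k = G"
      by (intro lift_eqI[of "om_cell k" G ?A] eq) simp_all
    moreover have "om_phi k = om_phi g"
      by (rule lift2_eqI[OF eq(2)]) (simp_all add: kG)
    moreover have "om_phi0 k = om_phi0 g"
      by (rule lift2_eqI[OF eq(3)]) (simp_all add: kG)
    ultimately show "k = g" by (intro oplax_mor.expand) simp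
  qed
qed

text \<open>The underlying 2-cell lifts in \<open>D\<close>. That the lift respects the structure
  cells is an equation of 2-cells into \<open>E\<close>, which \<open>U\<close> reduces to the
  corresponding axiom of \<open>s\<close>.\<close>

lemma oplax_lift2:
  assumes g: "g \<in> hom1 (Mon_op D P) X \<E>" "h \<in> hom1 (Mon_op D P) X \<E>"
    and s: "s \<in> hom2 (Mon_op D P) (\<U> \<diamondop> g) (\<U> \<diamondop> h)"
    and eq: "(em_action \<lhd>\<^bsub>Mon_op D P\<^esub> h) \<bullet>\<^bsub>Mon_op D P\<^esub> (\<S> \<rhd>\<^bsub>Mon_op D P\<^esub> s) = s \<bullet>\<^bsub>Mon_op D P\<^esub> (em_action \<lhd>\<^bsub>Mon_op D P\<^esub> g)"
  shows "\<exists>!r. r \<in> hom2 (Mon_op D P) g h \<and> \<U> \<rhd>\<^bsub>Mon_op D P\<^esub> r = s"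
proof -
  have g' [simp]: "is_oplax_mor D P g" "om_dom g = X" "om_cod g = \<E>" "is_oplax_mor D P h" "om_dom h = X" "om_cod h = \<E>"
    and s' [simp]: "is_oplax_trans D P s" "tr_dom s = \<U> \<diamondop> g" "tr_cod s = \<U> \<diamondop> h"
    using g s by simp_all
  let ?A = "mo_ob X" and ?\<sigma> = "tr_cell s" and ?G = "om_cell g" and ?H = "om_cell h"
  have X [simp]: "is_monoidal D P X" "?A \<in> Obj D"
    using oplax_mor_simps(2)[OF g'(1)] by simp_all
  have c [simp]: "?G \<in> Cell1 D" "dom1 D ?G = ?A" "cod1 D ?G = E" "?H \<in> Cell1 D" "dom1 D ?H = ?A" "cod1 D ?H = E"
    "?\<sigma> \<in> Cell2 D" "dom2 D ?\<sigma> = U \<cdot> ?G" "cod2 D ?\<sigma> = U \<cdot> ?H"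
    using oplax_data_simps(3-5)[of g] oplax_data_simps(3-5)[of h] oplax_trans_simps(5-7)[OF s'(1)] by simp_all
  have w: "tr_cell (em_action \<lhd>\<^bsub>Mon_op D P\<^esub> k) = \<chi> \<lhd> om_cell k" for k
    by (simp add: pre_whisker_def)
  have w': "tr_cell (\<S> \<rhd>\<^bsub>Mon_op D P\<^esub> s) = S \<rhd> ?\<sigma>"
    by (simp add: post_whisker_def)
  have v: "tr_cell (t \<bullet>\<^bsub>Mon_op D P\<^esub> t') = tr_cell t \<bullet> tr_cell t'" for t t'
    by simp
  have "(\<chi> \<lhd> ?H) \<bullet> (mnd_end N \<rhd> ?\<sigma>) = ?\<sigma> \<bullet> (\<chi> \<lhd> ?G)"
    using arg_cong[OF eq, of tr_cell] unfolding v w w' N_simps .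
  then have r: "lift2 ?\<sigma> ?G ?H \<in> Cell2 D" "dom2 D (lift2 ?\<sigma> ?G ?H) = ?G" "cod2 D (lift2 ?\<sigma> ?G ?H) = ?H" "U \<rhd> lift2 ?\<sigma> ?G ?H = ?\<sigma>"
    by - (rule lift2_simps[where X = ?A]; simp)+
  let ?\<rho> = "lift2 ?\<sigma> ?G ?H"
  note [simp] = r(1-3)
  have r4 [simp]: "U \<rhd> (?\<rho> \<lhd> k) = ?\<sigma> \<lhd> k" if "k \<in> Cell1 D" "cod1 D k = ?A" for k
    using post_pre_whisker[of U k ?\<rho>] r(4) that by simp
  let ?t = "Trans g h ?\<rho>"
  have trans: "is_oplax_trans D P ?t"
  proof (rule is_oplax_transI)
    fix Y k l assume "k \<in> hom1 D Y (mo_ob (om_dom (tr_dom ?t)))" "l \<in> hom1 D Y (mo_ob (om_dom (tr_dom ?t)))"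
    note [simp] = hom1D[OF this(1)] hom1D[OF this(2)]
    show "phi_at (tr_cod ?t) k l \<bullet> (tr_cell ?t \<lhd> (k \<otimes>\<^bsub>om_dom (tr_dom ?t)\<^esub> l))
      = ((tr_cell ?t \<lhd> k) \<odot>\<^bsub>om_cod (tr_dom ?t)\<^esub> (tr_cell ?t \<lhd> l)) \<bullet> phi_at (tr_dom ?t) k l"
      by (rule lift2_eqI) (use oplax_trans_phi_at[of s k Y l] in simp_all)
  next
    fix Y assume [simp]: "Y \<in> Obj D"
    show "phi0_at (tr_cod ?t) Y \<bullet> (tr_cell ?t \<lhd> unit_at (om_dom (tr_dom ?t)) Y) = phi0_at (tr_dom ?t) Y"
      by (rule lift2_eqI) (use oplax_trans_phi0_at[of s Y] in simp_all)
  qed simp_all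
  have whisk: "\<U> \<rhd>\<^bsub>Mon_op D P\<^esub> t = Trans (\<U> \<diamondop> (tr_dom t)) (\<U> \<diamondop> (tr_cod t)) (U \<rhd> tr_cell t)" for t
    by (simp add: post_whisker_def)
  show ?thesis
  proof (rule ex1I)
    show "Trans g h ?\<rho> \<in> hom2 (Mon_op D P) g h \<and> \<U> \<rhd>\<^bsub>Mon_op D P\<^esub> Trans g h ?\<rho> = s"
      using trans unfolding whisk by (simp add: r(4) trans.expand)
    fix t assume t: "t \<in> hom2 (Mon_op D P) g h \<and> \<U> \<rhd>\<^bsub>Mon_op D P\<^esub> t = s"
    then have t' [simp]: "is_oplax_trans D P t" "tr_dom t = g" "tr_cod t = h" by simp_all
    have "tr_cell (\<U> \<rhd>\<^bsub>Mon_op D P\<^esub> t) = ?\<sigma>" using t by simp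
    then have "U \<rhd> tr_cell t = ?\<sigma>" unfolding whisk by simp
    then have "tr_cell t = ?\<rho>"
      by - (rule lift2_eqI, simp_all add: r(4))
    then show "t = Trans g h ?\<rho>" by (intro trans.expand) simp
  qed
qed

lemma oplax_em_object: "em_object (Mon_op D P) M \<E> \<U> em_action"
proof
  show "is_monad (Mon_op D P) M" by (rule oplax_monad)
  show "is_algebra (Mon_op D P) M \<E> \<U> em_action"
    unfolding oplax_algebra_iff using algebra_U by simp
qed (simp_all only: Mon_op_simps oplax_lift oplax_lift2)

text \<open>Both universal properties must hold for one and the same pair. The image in
  \<open>D\<close> of the lifted arrow is the given one because the forgetful 2-functor preserves
  identity monads.\<close>

lemma standard_universal_arrow:
  "\<exists>R e. universal_arrow (Mon_op D P) (Mnd (Mon_op D P)) (iota (Mon_op D P)) M R e \<and>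
    universal_arrow D (Mnd D) (iota D) (on0 (Mnd_map Mon_op_forget) M) (on0 Mon_op_forget R)
      (on1 (Mnd_map Mon_op_forget) e)"
proof (intro exI conjI)
  interpret forget: two_functor "Mon_op D P" D Mon_op_forget by (rule two_functor_forget)
  let ?e = "MonadMor (identity_monad (Mon_op D P) \<E>) M \<U> em_action"
  show "universal_arrow (Mon_op D P) (Mnd (Mon_op D P)) (iota (Mon_op D P)) M \<E> ?e"
    by (rule em_object.universal_arrow[OF oplax_em_object])
  have [simp]: "on0 Mon_op_forget = mo_ob" "on1 Mon_op_forget = om_cell" "on2 Mon_op_forget = tr_cell"
    by (simp_all add: Mon_op_forget_def)
  have "on0 Mon_op_forget \<E> = E" "on1 (Mnd_map Mon_op_forget) ?e = MonadMor (identity_monad D E) N U \<chi>"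
    using forget.Mnd_map_iota(1)[of \<E>]
    by (auto intro!: monad_mor.expand)
  then show "universal_arrow D (Mnd D) (iota D) (on0 (Mnd_map Mon_op_forget) M) (on0 Mon_op_forget \<E>)
      (on1 (Mnd_map Mon_op_forget) ?e)"
    using universal_arrow by (simp del: Mnd_simps)
qed

end

theorem theorem5p1:
  fixes D :: "('o, 'f, 'c) twocat" and P :: "('o, 'f) products"
  assumes "two_category_with_products D P"
    and "admits_EM D"
  shows "admits_EM (Mon_op D P) \<and> standard_EM (Mon_op D P) D Mon_op_forget"
proof -
  interpret two_category_with_products D P by fact
  obtain EM u e where "two_adjunction D (Mnd D) (iota D) EM u e"
    using assms(2) unfolding admits_EM_def by blast
  then interpret adj: two_adjunction D "Mnd D" "iota D" EM u e .
  interpret forget: two_functor "Mon_op D P" D Mon_op_forget by (rule two_functor_forget)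
  show ?thesis
  proof (rule standard_EM_if_universal_arrows[OF two_functor_forget assms(2)])
    fix M assume M: "M \<in> Obj (Mnd (Mon_op D P))"
    let ?N = "Mnd_map0 Mon_op_forget M"
    have M': "is_monad (Mon_op D P) M" using M by (simp only: forget.source.Mnd_simps mem_Collect_eq)
    have N: "is_monad D ?N" by (rule forget.is_monad_map[OF M'])
    then have "?N \<in> Obj (Mnd D)" by simp
    \<comment> \<open>The counit of the given adjunction at the underlying monad supplies the EM
      object in \<open>D\<close> over which the monoidal one is built.\<close>
    note univ = adj.universal_arrow_counit[OF this]
    have "em_object D ?N (on0 EM ?N) (mm_cell (e ?N)) (mm_tau (e ?N))"
      by (rule em_object_if_universal_arrow(1)[OF N univ])
    then have "monoidal_em_object D P M (on0 EM ?N) (mm_cell (e ?N)) (mm_tau (e ?N))"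
      by (intro monoidal_em_object.intro two_category_with_products_axioms monoidal_em_object_axioms.intro M')
    then show "\<exists>R e. universal_arrow (Mon_op D P) (Mnd (Mon_op D P)) (iota (Mon_op D P)) M R e \<and>
        universal_arrow D (Mnd D) (iota D) (on0 (Mnd_map Mon_op_forget) M) (on0 Mon_op_forget R)
          (on1 (Mnd_map Mon_op_forget) e)"
      by (rule monoidal_em_object.standard_universal_arrow)
  qed
qed

end
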